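(* For each $n$ let $X_0,\ldots,X_{n-1}$ be independent standard gaussian random variables and let $A_n=n^{-1/2}(X_{|i-j|})_{1\le i,j\le n}$ (a gaussian Toeplitz matrix). Let $p_n$ be a sequence of positive integers such that $p_n=o(\log n/\log\log n)$. Let $W_n=\operatorname{Tr}(A_n^{p_n})$. Then, as $n\to\infty$, $$\frac{W_n-\mathbb{E}(W_n)}{\sqrt{\mathrm{Var}(W_n)}}\ \text{ converges in total variation to }\ N(0,1).$$ Moreover, there exists a positive constant $C$ such that $\mathrm{Var}(W_n)\ge(C/p_n)^{p_n}n$ for all $n$. The central limit theorem also holds for $W_n=\operatorname{Tr}f(A_n)$, when $f$ is a fixed nonzero polynomial with nonnegative coefficients. In that case, $\mathrm{Var}(W_n)\ge Cn$ for some positive constant $C$ depending on $f$.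
   Context: The total variation distance between the laws of two random variables $U$ and $V$ is $\sup_B|\mathbb{P}(U\in B)-\mathbb{P}(V\in B)|$, the supremum being over all Borel sets $B\subseteq\mathbb{R}$; convergence in total variation means that this distance to the limit law tends to zero.
   Formalization: "Nonzero polynomial with nonnegative coefficients" is read as nonconstant: for a nonzero constant f = c, Tr f(A_n) = cn is deterministic, so Var(W_n) = 0 and both the central limit theorem and Var(W_n) ≥ Cn fail. *)

theory Defs
  imports
    "HOL-Probability.Probability"
    "HOL-Library.Landau_Symbols"
    "HOL-Computational_Algebra.Polynomial"
    "Jordan_Normal_Form.Matrix"
begin

text \<open>
  Matrices are those of Jordan_Normal_Form, since their size varies with \<open>n\<close>. The indices of \<open>A\<^sub>n\<close>,
  usually \<open>1, \<dots>, n\<close>, are here \<open>0, \<dots>, n - 1\<close>, which leaves the differences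
  \<open>\<bar>i - j\<bar>\<close> unchanged.
\<close>

definition mat_trace :: "'a::comm_monoid_add Matrix.mat \<Rightarrow> 'a" where
  "mat_trace A = (\<Sum>i<dim_row A. A $$ (i, i))"

text \<open>Used for square matrices only: \<open>f(A) = \<Sum>\<^sub>k f\<^sub>k A\<^sup>k\<close>, where \<open>A\<^sup>0\<close> is the identity.\<close>

definition mat_poly :: "'a::comm_semiring_1 poly \<Rightarrow> 'a Matrix.mat \<Rightarrow> 'a Matrix.mat" where
  "mat_poly f A = Matrix.mat (dim_row A) (dim_row A)
     (\<lambda>ij. \<Sum>k\<le>degree f. coeff f k * (A ^\<^sub>m k) $$ ij)"

definition toeplitz :: "nat \<Rightarrow> (nat \<Rightarrow> real) \<Rightarrow> real Matrix.mat" where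
  "toeplitz n x = (1 / sqrt (real n)) \<cdot>\<^sub>m
     Matrix.mat n n (\<lambda>(i, j). x (nat \<bar>int i - int j\<bar>))"

definition std_gaussian_family :: "'w measure \<Rightarrow> nat \<Rightarrow> (nat \<Rightarrow> 'w \<Rightarrow> real) \<Rightarrow> bool" where
  "std_gaussian_family M n X \<longleftrightarrow>
     prob_space M \<and>
     prob_space.indep_vars M (\<lambda>_. borel) X {..<n} \<and>
     (\<forall>i<n. distributed M lborel (X i) std_normal_density)"

text \<open>The arguments are laws, i.e. Borel probability measures on the real line.\<close>

definition tv_dist :: "real measure \<Rightarrow> real measure \<Rightarrow> real" where
  "tv_dist P Q = (SUP B\<in>sets borel. \<bar>measure P B - measure Q B\<bar>)"

definition standardized :: "'w measure \<Rightarrow> ('w \<Rightarrow> real) \<Rightarrow> 'w \<Rightarrow> real" where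
  "standardized M W \<omega> =
     (W \<omega> - prob_space.expectation M W) / sqrt (prob_space.variance M W)"

text \<open>The \<open>n\<close>-th variable may live on its own probability space.\<close>

definition tv_clt :: "(nat \<Rightarrow> 'w measure) \<Rightarrow> (nat \<Rightarrow> 'w \<Rightarrow> real) \<Rightarrow> bool" where
  "tv_clt M W \<longleftrightarrow>
     (\<lambda>n. tv_dist (distr (M n) borel (standardized (M n) (W n))) std_normal_distribution)
       \<longlonglongrightarrow> 0"

end

theory Submission
  imports Defs "HOL-Real_Asymp.Real_Asymp"
begin

text \<open>
  For a polynomial \<open>F\<close> of independent standard gaussians let \<open>G\<close> solve \<open>-L G = F - E F\<close>, where
  \<open>L = \<Delta> - x \<cdot> \<nabla>\<close> is the Ornstein-Uhlenbeck generator. Gaussian integration by parts turns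
  Stein's equation into \<open>E h(F) - E h(N) = E[\<phi>'(F) (1 - T / Var F)]\<close> (\<open>F\<close> standardized inside
  \<open>h\<close> and \<open>\<phi>'\<close>) with \<open>T = \<nabla>F \<cdot> \<nabla>G\<close> and \<open>E T = Var F\<close>, so that the total variation distance
  to the normal law is at most \<open>2 sqrt(Var T) / Var F\<close>.

  When \<open>F\<close> has nonnegative coefficients so does \<open>G\<close>, and from
  \<open>(1 - L) \<partial>\<^sub>iG = \<partial>\<^sub>iF\<close> one gets \<open>E[u \<partial>\<^sub>iG] \<le> E[u \<partial>\<^sub>iF]\<close> for every \<open>u\<close> with nonnegative coefficients.
  This yields a Poincare inequality and allows one to replace \<open>G\<close> by \<open>F\<close>:
  \<open>Var T \<le> 4 E[\<parallel>\<nabla>\<^sup>2F \<nabla>F\<parallel>\<^sup>2]\<close>.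

  For \<open>F = Tr f(A)\<close> the gradient and the Hessian are controlled by \<open>n\<close> and the operator norm of \<open>A\<close>. Since
  only \<open>Var T = o(n\<^sup>2)\<close> is needed, the crude bound \<open>\<parallel>A\<parallel> \<le> (Tr A\<^sup>q)\<^bsup>1/q\<^esup>\<close> with \<open>q\<close> a power of two
  comparable to the degree suffices; \<open>E Tr A\<^sup>q\<close> is bounded by dominating \<open>Tr A\<^sup>q\<close>
  coefficientwise by \<open>n\<close> times a power of a single gaussian.
  The lower bound \<open>Var F \<ge> f\<^sub>d\<^sup>2 n\<close> comes from the first chaos if the degree \<open>d\<close> is odd and from the
  second chaos if it is even.
\<close>

section \<open>Polynomials with nonnegative coefficients\<close>

text \<open>Positivity is used in expectation only. A polynomial with nonnegative coefficients
  changes sign as a function, but all moments of a standard gaussian are nonnegative, hence so is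
  its mean. The class is closed under sums, products, derivatives and the solution operator
  \<open>F \<mapsto> G\<close>, so expanding a covariance or a Dirichlet form produces terms that
  may simply be dropped or compared one by one.

  Orders of magnitude: for bounded operator norm the gradient has squared norm of order n and the
  Hessian operator norm of order 1, so
  \<open>E[\<parallel>\<nabla>\<^sup>2F \<nabla>F\<parallel>\<^sup>2]\<close> would be of order n.
  The trace bound on the operator norm costs a further factor \<open>sqrt n\<close>, which leaves
  \<open>n ^ (3/2)\<close> against \<open>(Var F)\<^sup>2\<close>, at least of order
  \<open>n\<^sup>2\<close>. The distance is thus of order \<open>n ^ (-1/4)\<close> times a factor
  \<open>d ^ O(d)\<close> in the degree d, and the growth condition on the degree makes that factor
  a power \<open>n ^ o(1)\<close>.\<close>

text \<open>Polynomials in \<open>x\<^sub>0, \<dots>, x\<^sub>n\<^sub>-\<^sub>1\<close> are identified with the functions they define; \<open>poshom n d\<close>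
  are the forms of degree \<open>d\<close>. The zero function is a form of every degree.\<close>

inductive poshom :: "nat \<Rightarrow> nat \<Rightarrow> ((nat \<Rightarrow> real) \<Rightarrow> real) \<Rightarrow> bool" for n where
  poshom_const: "c \<ge> 0 \<Longrightarrow> poshom n 0 (\<lambda>_. c)"
| poshom_zero: "poshom n d (\<lambda>_. 0)"
| poshom_var: "i < n \<Longrightarrow> poshom n d f \<Longrightarrow> poshom n (Suc d) (\<lambda>x. x i * f x)"
| poshom_add: "poshom n d f \<Longrightarrow> poshom n d g \<Longrightarrow> poshom n d (\<lambda>x. f x + g x)"

inductive pospoly :: "nat \<Rightarrow> ((nat \<Rightarrow> real) \<Rightarrow> real) \<Rightarrow> bool" for n where
  pospoly_hom: "poshom n d f \<Longrightarrow> pospoly n f"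
| pospoly_add: "pospoly n f \<Longrightarrow> pospoly n g \<Longrightarrow> pospoly n (\<lambda>x. f x + g x)"

definition pd :: "nat \<Rightarrow> ((nat \<Rightarrow> real) \<Rightarrow> real) \<Rightarrow> (nat \<Rightarrow> real) \<Rightarrow> real" where
  "pd i f x = deriv (\<lambda>t. f (x(i := t))) (x i)"

definition gauss :: "nat \<Rightarrow> (nat \<Rightarrow> real) measure" where
  "gauss n = Pi\<^sub>M {..<n} (\<lambda>_. std_normal_distribution)"

lemma poshom_0_const: "poshom n d f \<Longrightarrow> d = 0 \<Longrightarrow> \<exists>c\<ge>0. f = (\<lambda>_. c)"
proof (induction rule: poshom.induct)
  case (poshom_add d f g)
  then obtain a b where "a \<ge> 0" "b \<ge> 0" "f = (\<lambda>_. a)" "g = (\<lambda>_. b)" by blast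
  then show ?case by (intro exI[of _ "a + b"]) auto
qed auto

lemma poshom_cmult: "poshom n d f \<Longrightarrow> c \<ge> 0 \<Longrightarrow> poshom n d (\<lambda>x. c * f x)"
proof (induction rule: poshom.induct)
  case (poshom_const a)
  then show ?case using poshom.poshom_const[of "c * a" n] by simp
next
  case (poshom_zero d)
  then show ?case by (simp add: poshom.poshom_zero)
next
  case (poshom_var i d f)
  then have "poshom n (Suc d) (\<lambda>x. x i * (c * f x))" by (intro poshom.poshom_var) auto
  then show ?case by (simp add: ac_simps)
next
  case (poshom_add d f g)
  then show ?case by (simp add: distrib_left poshom.poshom_add)
qed

lemma poshom_mult: "poshom n d f \<Longrightarrow> poshom n e g \<Longrightarrow> poshom n (d + e) (\<lambda>x. f x * g x)"
proof (induction rule: poshom.induct)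
  case (poshom_const c)
  then show ?case by (simp add: poshom_cmult)
next
  case (poshom_zero d)
  then show ?case by (simp add: poshom.poshom_zero)
next
  case (poshom_var i d f)
  then have "poshom n (Suc (d + e)) (\<lambda>x. x i * (f x * g x))" by (intro poshom.poshom_var) auto
  then show ?case by (simp add: ac_simps)
next
  case (poshom_add d f g)
  then show ?case by (simp add: distrib_right poshom.poshom_add)
qed

lemma poshom_sum: "(\<And>i. i \<in> I \<Longrightarrow> poshom n d (f i)) \<Longrightarrow> poshom n d (\<lambda>x. \<Sum>i\<in>I. f i x)"
proof (induction I rule: infinite_finite_induct)
  case (insert i I)
  then show ?case by (simp add: poshom_add)
qed (simp_all add: poshom_zero)

section \<open>Calculus of partial derivatives\<close>

lemma has_field_derivative_poshom:
  assumes "poshom n d f"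
  shows "poshom n (d - 1) (pd i f) \<and>
    (\<forall>x t. ((\<lambda>t. f (x(i := t))) has_real_derivative pd i f (x(i := t))) (at t))"
  using assms
proof (induction rule: poshom.induct)
  case (poshom_const c)
  have "pd i (\<lambda>_. c) = (\<lambda>_. 0)" by (auto simp: pd_def fun_eq_iff)
  then show ?case by (auto intro: poshom.poshom_const)
next
  case (poshom_zero d)
  have "pd i (\<lambda>_. 0) = (\<lambda>_. 0)" by (auto simp: pd_def fun_eq_iff)
  then show ?case by (auto intro: poshom.poshom_zero)
next
  case (poshom_add d f g)
  have d: "((\<lambda>t. f (x(i := t)) + g (x(i := t))) has_real_derivative
      (pd i f (x(i := t)) + pd i g (x(i := t)))) (at t)" for x t
    using poshom_add.IH by (intro derivative_intros) blast+
  have eq: "pd i (\<lambda>x. f x + g x) = (\<lambda>x. pd i f x + pd i g x)"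
  proof
    fix x show "pd i (\<lambda>x. f x + g x) x = pd i f x + pd i g x"
      unfolding pd_def[of i "\<lambda>x. f x + g x"] using d[of x "x i"] by (simp add: DERIV_imp_deriv)
  qed
  show ?case unfolding eq using d poshom.poshom_add poshom_add.IH by blast
next
  case (poshom_var j d f)
  have d: "((\<lambda>t. (x(i := t)) j * f (x(i := t))) has_real_derivative
      ((if j = i then f (x(i := t)) else 0) + (x(i := t)) j * pd i f (x(i := t)))) (at t)" for x t
  proof -
    have f: "((\<lambda>t. f (x(i := t))) has_real_derivative pd i f (x(i := t))) (at t)"
      using poshom_var.IH by blast
    show ?thesis
    proof (cases "j = i")
      case True
      then show ?thesis using DERIV_mult[OF DERIV_ident f] by (simp add: ac_simps)
    next
      case False
      then show ?thesis using DERIV_cmult[OF f, of "x j"] by simp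
    qed
  qed
  have eq: "pd i (\<lambda>x. x j * f x) = (\<lambda>x. (if j = i then f x else 0) + x j * pd i f x)"
  proof
    fix x show "pd i (\<lambda>x. x j * f x) x = (if j = i then f x else 0) + x j * pd i f x"
      unfolding pd_def[of i "\<lambda>x. x j * f x"] using d[of x "x i"] by (simp add: DERIV_imp_deriv)
  qed
  have 1: "poshom n d (\<lambda>x. if j = i then f x else 0)"
    using poshom_var.hyps by (cases "j = i") (auto intro: poshom_zero)
  \<comment> \<open>Truncated subtraction separates the cases: \<open>Suc (d - 1)\<close> is
    \<open>d\<close> only for \<open>d > 0\<close>. A form of degree 0 is constant, and its
    derivative is the zero form, which has every degree.\<close>
  have 2: "poshom n d (\<lambda>x. x j * pd i f x)"
  proof (cases "d = 0")
    case True
    then obtain c where "f = (\<lambda>_. c)" using poshom_0_const poshom_var.hyps by blast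
    then have "pd i f = (\<lambda>_. 0)" by (auto simp: pd_def fun_eq_iff)
    then show ?thesis by (simp add: poshom_zero)
  next
    case False
    then show ?thesis using poshom.poshom_var[of j n "d - 1" "pd i f"] poshom_var by simp
  qed
  show ?case unfolding eq diff_Suc_1 using d poshom_add[OF 1 2] by blast
qed

lemma poshom_pd: "poshom n d f \<Longrightarrow> poshom n (d - 1) (pd i f)"
  using has_field_derivative_poshom by blast

lemma pospoly_pd_aux:
  assumes "pospoly n f"
  shows "pospoly n (pd i f) \<and>
    (\<forall>x t. ((\<lambda>t. f (x(i := t))) has_real_derivative pd i f (x(i := t))) (at t))"
  using assms
proof (induction rule: pospoly.induct)
  case (pospoly_hom d f)
  then show ?case using has_field_derivative_poshom pospoly.pospoly_hom by blast
next
  case (pospoly_add f g)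
  have d: "((\<lambda>t. f (x(i := t)) + g (x(i := t))) has_real_derivative
      (pd i f (x(i := t)) + pd i g (x(i := t)))) (at t)" for x t
    using pospoly_add.IH by (intro derivative_intros) blast+
  have eq: "pd i (\<lambda>x. f x + g x) = (\<lambda>x. pd i f x + pd i g x)"
  proof
    fix x show "pd i (\<lambda>x. f x + g x) x = pd i f x + pd i g x"
      unfolding pd_def[of i "\<lambda>x. f x + g x"] using d[of x "x i"] by (simp add: DERIV_imp_deriv)
  qed
  show ?case unfolding eq using d pospoly.pospoly_add pospoly_add.IH by blast
qed

lemma pospoly_pd: "pospoly n f \<Longrightarrow> pospoly n (pd i f)"
  and pospoly_has_derivative:
    "pospoly n f \<Longrightarrow> ((\<lambda>t. f (x(i := t))) has_real_derivative pd i f (x(i := t))) (at t)"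
  using pospoly_pd_aux by blast+

lemma pd_eqI:
  assumes "\<And>x. ((\<lambda>t. f (x(i := t))) has_real_derivative f' x) (at (x i))"
  shows "pd i f = f'"
  unfolding pd_def fun_eq_iff by (intro allI DERIV_imp_deriv assms)

lemma pospoly_has_derivative_at:
  "pospoly n f \<Longrightarrow> ((\<lambda>t. f (x(i := t))) has_real_derivative pd i f x) (at (x i))"
  using pospoly_has_derivative[of n f x i "x i"] by simp

lemma pd_add:
  "pospoly n f \<Longrightarrow> pospoly n g \<Longrightarrow> pd i (\<lambda>x. f x + g x) = (\<lambda>x. pd i f x + pd i g x)"
  by (intro pd_eqI derivative_intros pospoly_has_derivative_at)

lemma pd_const: "pd i (\<lambda>_. c) = (\<lambda>_. 0)"
  by (intro pd_eqI) simp

lemma pd_cmult: "pospoly n f \<Longrightarrow> pd i (\<lambda>x. c * f x) = (\<lambda>x. c * pd i f x)"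
  by (intro pd_eqI DERIV_cmult pospoly_has_derivative_at)

lemma pd_mult:
  "pospoly n f \<Longrightarrow> pospoly n g \<Longrightarrow>
   pd i (\<lambda>x. f x * g x) = (\<lambda>x. pd i f x * g x + f x * pd i g x)"
  by (intro pd_eqI) (auto intro!: derivative_eq_intros pospoly_has_derivative_at)

lemma pd_sum:
  "(\<And>k. k \<in> K \<Longrightarrow> pospoly n (f k)) \<Longrightarrow> pd i (\<lambda>x. \<Sum>k\<in>K. f k x) = (\<lambda>x. \<Sum>k\<in>K. pd i (f k) x)"
  by (intro pd_eqI DERIV_sum) (auto intro: pospoly_has_derivative_at)

lemma pd_var: "pd i (\<lambda>x. x j) = (\<lambda>_. if i = j then 1 else 0)"
  by (intro pd_eqI) auto

lemma pospoly_const: "c \<ge> 0 \<Longrightarrow> pospoly n (\<lambda>_. c)"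
  by (rule pospoly_hom[OF poshom_const])

lemma poshom_single_var: "i < n \<Longrightarrow> poshom n 1 (\<lambda>x. x i)"
  using poshom_var[of i n 0 "\<lambda>_. 1"] poshom_const[of 1 n] by simp

lemma pospoly_var: "i < n \<Longrightarrow> pospoly n (\<lambda>x. x i)"
  by (rule pospoly_hom[OF poshom_single_var])

lemma pospoly_mult:
  assumes "pospoly n f" "pospoly n g"
  shows "pospoly n (\<lambda>x. f x * g x)"
  using assms(1)
proof (induction rule: pospoly.induct)
  case f: (pospoly_hom d f)
  show ?case using assms(2)
  proof (induction rule: pospoly.induct)
    case (pospoly_hom e g)
    then show ?case using f poshom_mult pospoly.pospoly_hom by blast
  next
    case (pospoly_add g h)
    then show ?case by (simp add: distrib_left pospoly.pospoly_add)
  qed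
next
  case (pospoly_add f h)
  then show ?case by (simp add: distrib_right pospoly.pospoly_add)
qed

lemma pospoly_cmult: "c \<ge> 0 \<Longrightarrow> pospoly n f \<Longrightarrow> pospoly n (\<lambda>x. c * f x)"
  by (intro pospoly_mult pospoly_const)

lemma pospoly_sum: "(\<And>i. i \<in> I \<Longrightarrow> pospoly n (f i)) \<Longrightarrow> pospoly n (\<lambda>x. \<Sum>i\<in>I. f i x)"
proof (induction I rule: infinite_finite_induct)
  case (insert i I)
  then show ?case by (simp add: pospoly_add)
qed (simp_all add: pospoly_const)

lemma pospoly_power: "pospoly n f \<Longrightarrow> pospoly n (\<lambda>x. f x ^ k)"
  by (induction k) (auto intro: pospoly_const pospoly_mult)

lemmas pospoly_intros = pospoly_const pospoly_var pospoly_add pospoly_mult pospoly_sum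
  pospoly_power pospoly_pd

text \<open>Induction replaces Schwarz's theorem: two applications of the product rule to
  \<open>x k * f x\<close> give three terms, one with both derivatives on \<open>f\<close> and two
  that are exchanged when \<open>i\<close> and \<open>j\<close> are.\<close>

lemma pd_commute:
  assumes "pospoly n f"
  shows "pd i (pd j f) = pd j (pd i f)"
proof -
  have hom: "pd i (pd j f) = pd j (pd i f)" if "poshom n d f" for d f
    using that
  proof (induction rule: poshom.induct)
    case (poshom_const c)
    show ?case by (simp add: pd_const)
  next
    case (poshom_zero d)
    show ?case by (simp add: pd_const)
  next
    case (poshom_add d f g)
    note p = poshom_add.hyps[THEN pospoly_hom]
    then show ?case using poshom_add.IH by (simp add: pd_add[of n] pospoly_pd)
  next
    case (poshom_var k d f)
    note p = poshom_var.hyps(2)[THEN pospoly_hom] pospoly_var[OF poshom_var.hyps(1)]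
    note q = p pospoly_pd[OF p(1)]
    have c: "pospoly n (\<lambda>x. of_bool b)" for b by (rule pospoly_const) simp
    have m: "pd l (\<lambda>x. x k * g x) = (\<lambda>x. of_bool (l = k) * g x + x k * pd l g x)"
      if "pospoly n g" for l g
      using pd_mult[OF p(2) that, of l] by (simp add: pd_var of_bool_def)
    have c': "pospoly n (\<lambda>x. of_bool b * g x)" if "pospoly n g" for b g
      using pospoly_mult[OF c that] by simp
    show ?case using poshom_var.IH
      by (simp add: m q pd_add[of n] c' pospoly_mult pd_cmult[of n])
  qed
  show ?thesis using assms
  proof (induction rule: pospoly.induct)
    case (pospoly_hom d f)
    then show ?case by (rule hom)
  next
    case (pospoly_add f g)
    then show ?case by (simp add: pd_add[of n] pospoly_pd)
  qed
qed

lemma euler_poshom: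
  assumes "poshom n d f"
  shows "(\<Sum>i<n. x i * pd i f x) = real d * f x"
  using assms
proof (induction rule: poshom.induct)
  case (poshom_var k d f)
  note p = poshom_var.hyps(2)[THEN pospoly_hom] pospoly_var[OF poshom_var.hyps(1)]
  have "(\<Sum>i<n. x i * pd i (\<lambda>x. x k * f x) x) =
     (\<Sum>i<n. (if i = k then x k * f x else 0) + x k * (x i * pd i f x))"
    unfolding pd_mult[OF p(2,1)] pd_var by (intro sum.cong) (auto simp: algebra_simps)
  also have "\<dots> = x k * f x + x k * (real d * f x)"
    using poshom_var.hyps poshom_var.IH
    by (simp add: sum.distrib sum_distrib_left[symmetric])
  finally show ?case by (simp add: algebra_simps)
next
  case (poshom_add d f g)
  note p = poshom_add.hyps[THEN pospoly_hom]
  show ?case using poshom_add.IH by (simp add: pd_add[OF p] distrib_left sum.distrib)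
qed (simp_all add: pd_const)

section \<open>Expectations under the standard gaussian measure\<close>

interpretation std_normal: prob_space std_normal_distribution
  using real_dist_normal_dist by (simp add: real_distribution_def)

interpretation gauss: product_prob_space "\<lambda>_::nat. std_normal_distribution" UNIV
  by unfold_locales

lemma prob_space_gauss: "prob_space (gauss n)"
  unfolding gauss_def by (intro prob_space_PiM std_normal.prob_space_axioms)

lemma integral_std_normal_moment_nonneg: "0 \<le> (LINT x|std_normal_distribution. x ^ k)"
  by (cases "even k")
     (auto elim!: evenE simp: std_normal_distribution_even_moments integral_std_normal_distribution_moment_odd)

text \<open>The source of all positivity. The monomial weight makes the induction work: a factor
  \<open>x i\<close> is absorbed by raising the exponent \<open>a i\<close>, until only products of
  one-dimensional moments are left.\<close>

lemma poshom_integrable: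
  assumes "poshom n d f"
  shows "integrable (gauss n) (\<lambda>x. f x * (\<Prod>i<n. x i ^ a i)) \<and>
    0 \<le> (LINT x|gauss n. f x * (\<Prod>i<n. x i ^ a i))"
  using assms
proof (induction arbitrary: a rule: poshom.induct)
  case (poshom_const c)
  have "integrable (gauss n) (\<lambda>x. (\<Prod>i<n. x i ^ a i))"
    unfolding gauss_def
    by (intro gauss.product_integrable_prod integrable_std_normal_distribution_moment) auto
  moreover have "(LINT x|gauss n. (\<Prod>i<n. x i ^ a i)) = (\<Prod>i<n. LINT y|std_normal_distribution. y ^ a i)"
    unfolding gauss_def
    by (intro gauss.product_integral_prod integrable_std_normal_distribution_moment) auto
  ultimately show ?case using poshom_const
    by (auto intro!: mult_nonneg_nonneg prod_nonneg integral_std_normal_moment_nonneg)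
next
  case (poshom_var i d f)
  have "(\<lambda>x. x i * f x * (\<Prod>j<n. x j ^ a j)) = (\<lambda>x. f x * (\<Prod>j<n. x j ^ (a(i := Suc (a i))) j))"
  proof
    fix x :: "nat \<Rightarrow> real"
    have "(\<Prod>j<n. x j ^ (a(i := Suc (a i))) j) = x i ^ Suc (a i) * (\<Prod>j\<in>{..<n}-{i}. x j ^ a j)"
      using poshom_var.hyps(1) by (subst prod.remove[of _ i]) (auto intro!: prod.cong)
    moreover have "(\<Prod>j<n. x j ^ a j) = x i ^ a i * (\<Prod>j\<in>{..<n}-{i}. x j ^ a j)"
      using poshom_var.hyps(1) by (subst prod.remove[of _ i]) auto
    ultimately show "x i * f x * (\<Prod>j<n. x j ^ a j) = f x * (\<Prod>j<n. x j ^ (a(i := Suc (a i))) j)"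
      by simp
  qed
  then show ?case using poshom_var.IH by simp
qed (auto simp: distrib_right)

lemma pospoly_expectation_aux:
  assumes "pospoly n f"
  shows "integrable (gauss n) f \<and> 0 \<le> (LINT x|gauss n. f x)"
  using assms
proof (induction rule: pospoly.induct)
  case (pospoly_hom d f)
  then show ?case using poshom_integrable[of n d f "\<lambda>_. 0"] by simp
qed auto

lemma pospoly_integrable: "pospoly n f \<Longrightarrow> integrable (gauss n) f"
  and pospoly_expectation_nonneg: "pospoly n f \<Longrightarrow> 0 \<le> (LINT x|gauss n. f x)"
  using pospoly_expectation_aux by blast+

text \<open>Reduces integrability and the behaviour at infinity, in one coordinate with the others
  frozen, to univariate polynomials.\<close>

lemma pospoly_section:
  assumes "pospoly n f"
  shows "\<exists>q. \<forall>t. f (x(i := t)) = poly q t"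
  using assms
proof (induction rule: pospoly.induct)
  case (pospoly_hom d f)
  then show ?case
  proof (induction rule: poshom.induct)
    case (poshom_const c)
    show ?case by (rule exI[of _ "[:c:]"]) simp
  next
    case (poshom_zero d)
    show ?case by (rule exI[of _ 0]) simp
  next
    case (poshom_var j d f)
    then obtain q where "\<forall>t. f (x(i := t)) = poly q t" by blast
    then show ?case
      by (intro exI[of _ "(if j = i then [:0, 1:] else [:x j:]) * q"]) (auto simp: fun_upd_def)
  next
    case (poshom_add d f g)
    then obtain q r where "\<forall>t. f (x(i := t)) = poly q t" "\<forall>t. g (x(i := t)) = poly r t" by blast
    then show ?case by (intro exI[of _ "q + r"]) (auto simp: fun_upd_def)
  qed
next
  case (pospoly_add f g)
  then obtain q r where "\<forall>t. f (x(i := t)) = poly q t" "\<forall>t. g (x(i := t)) = poly r t" by blast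
  then show ?case by (intro exI[of _ "q + r"]) (auto simp: fun_upd_def)
qed

section \<open>Gaussian integration by parts and the Ornstein-Uhlenbeck equation\<close>

lemma poly_times_std_normal_density_at_top:
  "((\<lambda>t. poly q t * std_normal_density t) \<longlongrightarrow> 0) at_top"
proof -
  have mono: "((\<lambda>t. t ^ k * std_normal_density t) \<longlongrightarrow> 0) at_top" for k
  proof (rule tendsto_sandwich)
    show "\<forall>\<^sub>F t in at_top. 0 \<le> t ^ k * std_normal_density t"
      using eventually_ge_at_top[of 0] by eventually_elim (simp add: normal_density_nonneg)
    show "\<forall>\<^sub>F t in at_top. t ^ k * std_normal_density t \<le> t ^ k / exp t"
      \<comment> \<open>From 2 on, \<open>t\<^sup>2 / 2\<close> is at least \<open>t\<close>, so the
        density lies below \<open>exp (- t)\<close>.\<close>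
      using eventually_ge_at_top[of 2]
    proof eventually_elim
      case (elim t)
      have "2 * t \<le> t * t" using elim by (intro mult_right_mono) auto
      then have "exp (- t\<^sup>2 / 2) \<le> exp (- t)" by (simp add: power2_eq_square)
      moreover have "1 / sqrt (2 * pi) \<le> 1" using pi_ge_two by (simp add: divide_le_eq)
      ultimately have "std_normal_density t \<le> 1 * exp (- t)"
        unfolding std_normal_density_def by (intro mult_mono) auto
      then show ?case using elim by (simp add: exp_minus field_simps mult_left_mono)
    qed
    show "((\<lambda>t::real. t ^ k / exp t) \<longlongrightarrow> 0) at_top" by (rule tendsto_power_div_exp_0)
  qed auto
  have "((\<lambda>t. \<Sum>i\<le>degree q. coeff q i * (t ^ i * std_normal_density t)) \<longlongrightarrow>
    (\<Sum>i\<le>degree q. coeff q i * 0)) at_top"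
    by (intro tendsto_intros mono)
  then show ?thesis by (simp add: poly_altdef sum_distrib_right mult.assoc)
qed

lemma poly_times_std_normal_density_at_bot:
  "((\<lambda>t. poly q t * std_normal_density t) \<longlongrightarrow> 0) at_bot"
  unfolding filterlim_at_bot_mirror
  using poly_times_std_normal_density_at_top[of "pcompose q [:0, -1:]"]
  by (simp add: poly_pcompose std_normal_density_def)

lemma integrable_poly_std_normal: "integrable std_normal_distribution (poly q)"
proof -
  have "integrable std_normal_distribution (\<lambda>t. \<Sum>i\<le>degree q. coeff q i * t ^ i)"
    by (intro Bochner_Integration.integrable_sum integrable_mult_right integrable_std_normal_distribution_moment)
  then show ?thesis by (simp add: poly_altdef[abs_def])
qed

lemma std_normal_density_has_derivative:
  "(std_normal_density has_real_derivative - t * std_normal_density t) (at t)"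
  unfolding std_normal_density_def[abs_def] by (auto intro!: derivative_eq_intros simp: field_simps)

text \<open>The integrand \<open>h\<close> below is the derivative of \<open>g\<close> times the
  density. Domination of \<open>g\<close> by a polynomial makes both boundary values vanish.\<close>

lemma std_normal_ibp:
  assumes deriv: "\<And>t. (g has_real_derivative g' t) (at t)"
    and cont: "continuous_on UNIV g'"
    and int: "integrable std_normal_distribution (\<lambda>t. t * g t)" "integrable std_normal_distribution g'"
    and bound: "\<And>t. \<bar>g t\<bar> \<le> B * \<bar>poly q t\<bar>"
  shows "(LINT t|std_normal_distribution. t * g t) = (LINT t|std_normal_distribution. g' t)"
proof -
  let ?d = std_normal_density
  have cg: "continuous_on UNIV g"
    using deriv by (meson DERIV_continuous continuous_at_imp_continuous_on)
  have meas [measurable]: "g \<in> borel_measurable borel" "g' \<in> borel_measurable borel"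
    using cg cont by (simp_all add: borel_measurable_continuous_onI)
  have i1: "integrable lborel (\<lambda>t. ?d t * (t * g t))" and i2: "integrable lborel (\<lambda>t. ?d t * g' t)"
    using int by (simp_all add: integrable_density normal_density_nonneg)
  define h where "h t = ?d t * g' t - ?d t * (t * g t)" for t
  have ih: "integrable lborel h" unfolding h_def by (intro Bochner_Integration.integrable_diff i1 i2)
  have lim: "((\<lambda>t. g t * ?d t) \<longlongrightarrow> 0) F" if "((\<lambda>t. poly q t * ?d t) \<longlongrightarrow> 0) F" for F
  proof (rule Lim_null_comparison)
    show "\<forall>\<^sub>F t in F. norm (g t * ?d t) \<le> B * \<bar>poly q t * ?d t\<bar>"
      using bound by (intro always_eventually) (auto simp: abs_mult normal_density_nonneg mult.assoc[symmetric] intro!: mult_right_mono)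
    show "((\<lambda>t. B * \<bar>poly q t * ?d t\<bar>) \<longlongrightarrow> 0) F"
      using tendsto_mult_right_zero[OF tendsto_rabs_zero[OF that], of B] by simp
  qed
  have "(LBINT t=-\<infinity>..\<infinity>. h t) = 0 - 0"
  proof (rule interval_integral_FTC_integrable[where F = "\<lambda>t. g t * ?d t"])
    fix t :: real
    show "((\<lambda>t. g t * ?d t) has_vector_derivative h t) (at t)"
      unfolding has_real_derivative_iff_has_vector_derivative[symmetric] h_def
      by (rule DERIV_cong[OF DERIV_mult[OF deriv std_normal_density_has_derivative]]) (simp add: algebra_simps)
    have "isCont g' t" "isCont g t"
      using cont cg by (auto simp: continuous_on_eq_continuous_at)
    moreover have "isCont ?d t"
      by (rule DERIV_isCont[OF std_normal_density_has_derivative])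
    ultimately
    show "isCont h t" unfolding h_def by (intro continuous_intros)
  next
    show "set_integrable lborel (einterval (- \<infinity>) \<infinity>) h"
      using ih by (simp add: set_integrable_def)
    show "(((\<lambda>t. g t * ?d t) \<circ> real_of_ereal) \<longlongrightarrow> 0) (at_right (- \<infinity>))"
      using lim[OF poly_times_std_normal_density_at_bot]
      by (simp add: ereal_tendsto_simps)
    show "(((\<lambda>t. g t * ?d t) \<circ> real_of_ereal) \<longlongrightarrow> 0) (at_left \<infinity>)"
      using lim[OF poly_times_std_normal_density_at_top]
      by (simp add: ereal_tendsto_simps)
  qed simp
  then have "(LINT t|lborel. h t) = 0"
    by (simp add: interval_lebesgue_integral_def set_lebesgue_integral_def)
  then have "(LINT t|lborel. ?d t * (t * g t)) = (LINT t|lborel. ?d t * g' t)"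
    unfolding h_def using i1 i2 by simp
  then show ?thesis
    by (simp add: integral_density normal_density_nonneg)
qed

lemma pospoly_bounded_integrable:
  assumes "pospoly n u" "pospoly n F" "continuous_on UNIV \<phi>" "\<And>t. \<bar>\<phi> t :: real\<bar> \<le> B"
  shows "integrable (gauss n) (\<lambda>x. u x * \<phi> (F x))"
proof (rule Bochner_Integration.integrable_bound)
  show "integrable (gauss n) (\<lambda>x. B * u x)"
    by (intro integrable_mult_right pospoly_integrable assms)
  have [measurable]: "u \<in> borel_measurable (gauss n)" "F \<in> borel_measurable (gauss n)"
    "\<phi> \<in> borel_measurable borel"
    using assms pospoly_integrable by (auto intro: borel_measurable_continuous_onI borel_measurable_integrable)
  show "(\<lambda>x. u x * \<phi> (F x)) \<in> borel_measurable (gauss n)" by measurable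
  have "\<bar>B\<bar> = B" using assms(4)[of 0] by linarith
  then show "AE x in gauss n. norm (u x * \<phi> (F x)) \<le> norm (B * u x)"
    using assms(4) by (auto simp: abs_mult mult.commute[of B] intro!: mult_left_mono)
qed

text \<open>The factor \<open>\<phi> (F x)\<close> is present because the solution of Stein's
  equation is not a polynomial; boundedness of \<open>\<phi>\<close> and \<open>\<phi>'\<close>
  keeps everything integrable. Fubini isolates coordinate \<open>i\<close>, where the
  one-dimensional formula applies.\<close>

lemma gauss_ibp:
  assumes "i < n" "pospoly n u" "pospoly n F"
    and deriv: "\<And>t. (\<phi> has_real_derivative \<phi>' t) (at t)"
    and cont: "continuous_on UNIV \<phi>'"
    and B: "\<And>t. \<bar>\<phi> t\<bar> \<le> B" "\<And>t. \<bar>\<phi>' t\<bar> \<le> B'"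
  shows "(LINT x|gauss n. x i * u x * \<phi> (F x)) =
    (LINT x|gauss n. pd i u x * \<phi> (F x) + u x * pd i F x * \<phi>' (F x))"
proof -
  define I where "I = {..<n} - {i}"
  have I: "finite I" "i \<notin> I" "insert i I = {..<n}" using assms(1) by (auto simp: I_def)
  have c\<phi>: "continuous_on UNIV \<phi>"
    using deriv by (meson DERIV_continuous continuous_at_imp_continuous_on)
  note intg = pospoly_bounded_integrable
  have 1: "integrable (gauss n) (\<lambda>x. x i * u x * \<phi> (F x))"
    by (intro intg[where B = B] pospoly_mult pospoly_var assms c\<phi>)
  have 2: "integrable (gauss n) (\<lambda>x. pd i u x * \<phi> (F x) + u x * pd i F x * \<phi>' (F x))"
    by (intro Bochner_Integration.integrable_add intg[where B = B] intg[where B = B'] pospoly_mult pospoly_pd assms c\<phi>)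
  have slice: "(LINT t|std_normal_distribution. t * (u (x(i := t)) * \<phi> (F (x(i := t))))) =
    (LINT t|std_normal_distribution. pd i u (x(i := t)) * \<phi> (F (x(i := t)))
        + u (x(i := t)) * pd i F (x(i := t)) * \<phi>' (F (x(i := t))))" for x
  proof -
    obtain q where q: "\<And>t. u (x(i := t)) = poly q t" using pospoly_section[OF assms(2)] by blast
    obtain r where r: "\<And>t. F (x(i := t)) = poly r t" using pospoly_section[OF assms(3)] by blast
    obtain q' where q': "\<And>t. pd i u (x(i := t)) = poly q' t"
      using pospoly_section[OF pospoly_pd[OF assms(2)]] by blast
    obtain r' where r': "\<And>t. pd i F (x(i := t)) = poly r' t"
      using pospoly_section[OF pospoly_pd[OF assms(3)]] by blast
    have dq: "(poly q has_real_derivative poly q' t) (at t)" for t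
      using pospoly_has_derivative[OF assms(2), of x i t] unfolding q q' .
    have dr: "(poly r has_real_derivative poly r' t) (at t)" for t
      using pospoly_has_derivative[OF assms(3), of x i t] unfolding r r' .
    have m [measurable]: "\<phi> \<in> borel_measurable borel" "\<phi>' \<in> borel_measurable borel"
      using c\<phi> cont by (auto intro: borel_measurable_continuous_onI)
    have pm [measurable]: "poly p \<in> borel_measurable borel" for p :: "real poly"
      by (intro borel_measurable_continuous_onI continuous_intros)
    have bi: "integrable std_normal_distribution (\<lambda>t. poly p t * \<psi> (poly r t))"
      if "\<And>t. \<bar>\<psi> t\<bar> \<le> C" and [measurable]: "\<psi> \<in> borel_measurable borel" for p \<psi> and C :: real
    proof (rule Bochner_Integration.integrable_bound)
      show "integrable std_normal_distribution (\<lambda>t. C * poly p t)"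
        by (intro integrable_mult_right integrable_poly_std_normal)
      have "\<bar>C\<bar> = C" using that(1)[of 0] by linarith
      then show "AE t in std_normal_distribution. norm (poly p t * \<psi> (poly r t)) \<le> norm (C * poly p t)"
        using that(1) by (auto simp: abs_mult mult.commute[of C] intro!: mult_left_mono)
    qed measurable
    show ?thesis unfolding q r q' r'
    proof (rule std_normal_ibp[where q = q and B = B])
      fix t
      have "((\<lambda>t. poly q t * \<phi> (poly r t)) has_real_derivative
        (poly q' t * \<phi> (poly r t) + \<phi>' (poly r t) * poly r' t * poly q t)) (at t)"
        by (intro DERIV_mult dq DERIV_chain2[OF deriv] dr)
      then show "((\<lambda>t. poly q t * \<phi> (poly r t)) has_real_derivative
        poly q' t * \<phi> (poly r t) + poly q t * poly r' t * \<phi>' (poly r t)) (at t)"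
        by (simp add: ac_simps)
      show "\<bar>poly q t * \<phi> (poly r t)\<bar> \<le> B * \<bar>poly q t\<bar>"
        using mult_right_mono[OF B(1)[of "poly r t"] abs_ge_zero[of "poly q t"]]
        by (simp add: abs_mult mult.commute)
    next
      show "continuous_on UNIV (\<lambda>t. poly q' t * \<phi> (poly r t) + poly q t * poly r' t * \<phi>' (poly r t))"
        by (intro continuous_intros continuous_on_compose2[OF c\<phi>] continuous_on_compose2[OF cont]) auto
      show "integrable std_normal_distribution (\<lambda>t. t * (poly q t * \<phi> (poly r t)))"
        using bi[OF B(1) m(1), of "[:0, 1:] * q"] by (simp add: mult.assoc)
      show "integrable std_normal_distribution
         (\<lambda>t. poly q' t * \<phi> (poly r t) + poly q t * poly r' t * \<phi>' (poly r t))"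
        using bi[OF B(1) m(1), of q'] bi[OF B(2) m(2), of "q * r'"]
        by (intro Bochner_Integration.integrable_add) auto
    qed
  qed
  have "(LINT x|gauss n. x i * u x * \<phi> (F x)) =
    (LINT x|Pi\<^sub>M I (\<lambda>_. std_normal_distribution). LINT t|std_normal_distribution. t * (u (x(i := t)) * \<phi> (F (x(i := t)))))"
    using 1 unfolding gauss_def I(3)[symmetric]
    by (subst gauss.product_integral_insert[OF I(1,2)]) (simp_all add: mult.assoc)
  also have "\<dots> = (LINT x|gauss n. pd i u x * \<phi> (F x) + u x * pd i F x * \<phi>' (F x))"
    using 2 unfolding gauss_def I(3)[symmetric] slice
    by (subst gauss.product_integral_insert[OF I(1,2)]) simp_all
  finally show ?thesis .
qed

lemma gauss_ibp_pospoly: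
  assumes "i < n" "pospoly n u"
  shows "(LINT x|gauss n. x i * u x) = (LINT x|gauss n. pd i u x)"
  using gauss_ibp[of i n u "\<lambda>_. 0" "\<lambda>_. 1" "\<lambda>_. 0" 1 0] assms by (simp add: pospoly_const)

text \<open>\<open>G\<close> solves \<open>(lam - L) G = F - c\<close> for the Ornstein-Uhlenbeck generator
  \<open>L = \<Delta> - x \<cdot> \<nabla>\<close>; the equation is arranged so that both sides have nonnegative coefficients.\<close>

definition ou_solves ::
    "nat \<Rightarrow> real \<Rightarrow> ((nat \<Rightarrow> real) \<Rightarrow> real) \<Rightarrow> ((nat \<Rightarrow> real) \<Rightarrow> real) \<Rightarrow> real \<Rightarrow> bool" where
  "ou_solves n lam F G c \<longleftrightarrow>
     (\<forall>x. lam * G x + (\<Sum>i<n. x i * pd i G x) + c = F x + (\<Sum>i<n. pd i (pd i G) x))"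

text \<open>On forms of degree \<open>d\<close> Euler's identity turns
  \<open>x \<cdot> \<nabla>\<close> into multiplication by \<open>d\<close>, while the Laplacian
  lowers the degree by two. So if \<open>G\<close> solves the equation for the Laplacian of
  \<open>F\<close>, then \<open>(F + G) / d\<close> solves it for \<open>F\<close>, and no negative
  coefficient ever arises.\<close>

lemma ou_solves_hom:
  "poshom n d F \<Longrightarrow> \<exists>G c. pospoly n G \<and> ou_solves n 0 F G c"
proof (induction d arbitrary: F rule: less_induct)
  case (less d)
  show ?case
  proof (cases "d = 0")
    case True
    then obtain c where "F = (\<lambda>_. c)" using poshom_0_const less.prems by blast
    then show ?thesis
      by (intro exI[of _ "\<lambda>_. 0"] exI[of _ c]) (simp add: ou_solves_def pd_const pospoly_const)
  next
    case False
    define H where "H x = (\<Sum>i<n. pd i (pd i F) x)" for x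
    have "poshom n (d - 1 - 1) H"
      unfolding H_def by (intro poshom_sum poshom_pd less.prems)
    moreover have "d - 1 - 1 < d" using False by simp
    ultimately obtain G c where G: "pospoly n G" "ou_solves n 0 H G c" using less.IH by blast
    have F: "pospoly n F" using less.prems by (rule pospoly_hom)
    define K where "K x = (1 / real d) * (F x + G x)" for x
    have FG: "pospoly n (\<lambda>x. F x + G x)" by (intro pospoly_add F G)
    have pK: "pd i K = (\<lambda>x. (1 / real d) * (pd i F x + pd i G x))" for i
      unfolding K_def[abs_def] pd_cmult[OF FG] pd_add[OF F G(1)] ..
    have ppK: "pd i (pd i K) x = (1 / real d) * (pd i (pd i F) x + pd i (pd i G) x)" for i x
      unfolding pK pd_cmult[OF pospoly_add[OF pospoly_pd[OF F] pospoly_pd[OF G(1)]]]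
        pd_add[OF pospoly_pd[OF F] pospoly_pd[OF G(1)]] ..
    have "(\<Sum>i<n. x i * pd i K x) + c / real d = F x + (\<Sum>i<n. pd i (pd i K) x)" for x
    proof -
      have "(\<Sum>i<n. x i * pd i K x) = (1 / real d) * ((\<Sum>i<n. x i * pd i F x) + (\<Sum>i<n. x i * pd i G x))"
        unfolding pK by (simp add: sum_distrib_left sum.distrib distrib_left ac_simps)
      moreover have "(\<Sum>i<n. pd i (pd i K) x) = (1 / real d) * (H x + (\<Sum>i<n. pd i (pd i G) x))"
        unfolding ppK H_def by (simp add: sum_distrib_left sum.distrib distrib_left)
      ultimately show ?thesis
        using euler_poshom[OF less.prems, of x] G(2) False unfolding ou_solves_def
        by (simp add: field_simps)
    qed
    moreover have "pospoly n K" unfolding K_def by (intro pospoly_cmult FG) simp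
    ultimately show ?thesis by (auto simp: ou_solves_def)
  qed
qed

lemma ou_solution_exists:
  "pospoly n F \<Longrightarrow> \<exists>G c. pospoly n G \<and> ou_solves n 0 F G c"
proof (induction rule: pospoly.induct)
  case (pospoly_hom d f)
  then show ?case by (rule ou_solves_hom)
next
  case (pospoly_add f g)
  then obtain G c H b where G: "pospoly n G" "ou_solves n 0 f G c"
    and H: "pospoly n H" "ou_solves n 0 g H b" by blast
  have "ou_solves n 0 (\<lambda>x. f x + g x) (\<lambda>x. G x + H x) (c + b)"
    unfolding ou_solves_def
  proof
    fix x
    have "0 * G x + (\<Sum>i<n. x i * pd i G x) + c = f x + (\<Sum>i<n. pd i (pd i G) x)"
      "0 * H x + (\<Sum>i<n. x i * pd i H x) + b = g x + (\<Sum>i<n. pd i (pd i H) x)"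
      using G(2) H(2) unfolding ou_solves_def by blast+
    then show "0 * (G x + H x) + (\<Sum>i<n. x i * pd i (\<lambda>x. G x + H x) x) + (c + b) =
      f x + g x + (\<Sum>i<n. pd i (pd i (\<lambda>x. G x + H x)) x)"
      using G(1) H(1)
      by (simp add: pd_add[of n] pospoly_pd distrib_left sum.distrib)
  qed
  then show ?case using pospoly.pospoly_add[OF G(1) H(1)] by blast
qed

text \<open>The weak form of the equation. Integrating \<open>u\<close> times
  \<open>x i * pd i G x\<close> by parts yields a second derivative of \<open>G\<close> that cancels
  the one on the right and leaves the Dirichlet form of \<open>u\<close> and
  \<open>G\<close>.\<close>

lemma ou_solves_expectation:
  assumes "pospoly n F" "pospoly n G" "pospoly n u" "ou_solves n lam F G c"
  shows "lam * (LINT x|gauss n. u x * G x) + (\<Sum>i<n. LINT x|gauss n. pd i u x * pd i G x)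
     + c * (LINT x|gauss n. u x) = (LINT x|gauss n. u x * F x)"
proof -
  note int = pospoly_integrable
  have ibp: "(LINT x|gauss n. u x * (x i * pd i G x)) =
     (LINT x|gauss n. pd i u x * pd i G x) + (LINT x|gauss n. u x * pd i (pd i G) x)" if "i < n" for i
  proof -
    have "(LINT x|gauss n. x i * (u x * pd i G x)) = (LINT x|gauss n. pd i (\<lambda>x. u x * pd i G x) x)"
      by (intro gauss_ibp_pospoly that pospoly_mult pospoly_pd assms)
    also have "\<dots> = (LINT x|gauss n. pd i u x * pd i G x + u x * pd i (pd i G) x)"
      using assms by (simp add: pd_mult[of n] pospoly_pd)
    also have "\<dots> = (LINT x|gauss n. pd i u x * pd i G x) + (LINT x|gauss n. u x * pd i (pd i G) x)"
      by (intro Bochner_Integration.integral_add int pospoly_mult pospoly_pd assms)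
    finally show ?thesis by (simp add: ac_simps)
  qed
  have "(LINT x|gauss n. u x * (lam * G x + (\<Sum>i<n. x i * pd i G x) + c)) =
     (LINT x|gauss n. u x * (F x + (\<Sum>i<n. pd i (pd i G) x)))"
    using assms(4) unfolding ou_solves_def by simp
  also have "(\<lambda>x. u x * (lam * G x + (\<Sum>i<n. x i * pd i G x) + c)) =
     (\<lambda>x. lam * (u x * G x) + (\<Sum>i<n. u x * (x i * pd i G x)) + c * u x)"
    by (simp add: algebra_simps sum_distrib_left)
  also have "(\<lambda>x. u x * (F x + (\<Sum>i<n. pd i (pd i G) x))) =
     (\<lambda>x. u x * F x + (\<Sum>i<n. u x * pd i (pd i G) x))"
    by (simp add: algebra_simps sum_distrib_left)
  also have "(LINT x|gauss n. u x * F x + (\<Sum>i<n. u x * pd i (pd i G) x)) =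
     (LINT x|gauss n. u x * F x) + (\<Sum>i<n. LINT x|gauss n. u x * pd i (pd i G) x)"
    using assms by (subst Bochner_Integration.integral_add)
      (simp_all add: int pospoly_intros Bochner_Integration.integral_sum)
  also have "(LINT x|gauss n. lam * (u x * G x) + (\<Sum>i<n. u x * (x i * pd i G x)) + c * u x) =
     lam * (LINT x|gauss n. u x * G x) + (\<Sum>i<n. LINT x|gauss n. u x * (x i * pd i G x))
      + c * (LINT x|gauss n. u x)"
  proof -
    have "integrable (gauss n) (\<lambda>x. lam * (u x * G x))" "integrable (gauss n) (\<lambda>x. c * u x)"
      "integrable (gauss n) (\<lambda>x. u x * G x)" "integrable (gauss n) u"
      by (intro integrable_mult_right int pospoly_mult assms)+
    moreover have i: "integrable (gauss n) (\<lambda>x. u x * (x i * pd i G x))" if "i < n" for i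
      by (intro int pospoly_mult pospoly_var pospoly_pd assms that)
    moreover from i have "integrable (gauss n) (\<lambda>x. \<Sum>i<n. u x * (x i * pd i G x))"
      by (intro Bochner_Integration.integrable_sum) auto
    ultimately show ?thesis
      by (subst Bochner_Integration.integral_add; (simp add: Bochner_Integration.integral_sum)?)
  qed
  finally have "lam * (LINT x|gauss n. u x * G x) + (\<Sum>i<n. LINT x|gauss n. u x * (x i * pd i G x))
      + c * (LINT x|gauss n. u x) =
     (LINT x|gauss n. u x * F x) + (\<Sum>i<n. LINT x|gauss n. u x * pd i (pd i G) x)" .
  moreover have "(\<Sum>i<n. LINT x|gauss n. u x * (x i * pd i G x)) =
    (\<Sum>i<n. LINT x|gauss n. pd i u x * pd i G x) + (\<Sum>i<n. LINT x|gauss n. u x * pd i (pd i G) x)"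
    by (simp add: ibp sum.distrib)
  ultimately show ?thesis by simp
qed

text \<open>The commutator of \<open>\<partial>\<^sub>j\<close> with
  \<open>x \<cdot> \<nabla>\<close> is \<open>\<partial>\<^sub>j\<close> itself, so each derivative
  raises \<open>lam\<close> by one and removes the constant. The signs of \<open>lam\<close> and
  \<open>c\<close> keep both sides in the class where the rules for \<open>pd\<close> hold.\<close>

lemma ou_solves_pd:
  assumes "pospoly n F" "pospoly n G" "ou_solves n lam F G c" "j < n" "lam \<ge> 0" "c \<ge> 0"
  shows "ou_solves n (lam + 1) (pd j F) (pd j G) 0"
  unfolding ou_solves_def
proof
  fix x
  note p = assms(1,2) pospoly_pd[OF assms(2)] pospoly_pd[OF pospoly_pd[OF assms(2)]]
  have eq: "(\<lambda>x. lam * G x + (\<Sum>i<n. x i * pd i G x) + c) = (\<lambda>x. F x + (\<Sum>i<n. pd i (pd i G) x))"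
    using assms(3) unfolding ou_solves_def by blast
  have 1: "pd j (\<lambda>x. lam * G x + (\<Sum>i<n. x i * pd i G x) + c) =
      (\<lambda>x. lam * pd j G x + (\<Sum>i<n. of_bool (j = i) * pd i G x + x i * pd j (pd i G) x))"
  proof -
    have m: "pospoly n (\<lambda>x. x i * pd i G x)" if "i < n" for i
      by (intro pospoly_mult pospoly_var pospoly_pd assms that)
    then have S: "pospoly n (\<lambda>x. \<Sum>i<n. x i * pd i G x)" by (intro pospoly_sum) auto
    have L: "pospoly n (\<lambda>x. lam * G x)" by (intro pospoly_cmult assms)
    have "pd j (\<lambda>x. lam * G x + (\<Sum>i<n. x i * pd i G x) + c) =
        (\<lambda>x. pd j (\<lambda>x. lam * G x) x + pd j (\<lambda>x. \<Sum>i<n. x i * pd i G x) x)"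
      by (simp add: pd_add[OF pospoly_add[OF L S] pospoly_const[OF assms(6)]] pd_add[OF L S] pd_const)
    also have "pd j (\<lambda>x. lam * G x) = (\<lambda>x. lam * pd j G x)" by (rule pd_cmult[OF assms(2)])
    also have "pd j (\<lambda>x. \<Sum>i<n. x i * pd i G x) = (\<lambda>x. \<Sum>i<n. pd j (\<lambda>x. x i * pd i G x) x)"
      by (rule pd_sum) (auto intro: m)
    also have "\<dots> = (\<lambda>x. \<Sum>i<n. of_bool (j = i) * pd i G x + x i * pd j (pd i G) x)"
      by (intro ext sum.cong refl)
         (simp add: pd_mult[OF pospoly_var pospoly_pd[OF assms(2)]] pd_var of_bool_def)
    finally show ?thesis .
  qed
  have 2: "pd j (\<lambda>x. F x + (\<Sum>i<n. pd i (pd i G) x)) =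
      (\<lambda>x. pd j F x + (\<Sum>i<n. pd j (pd i (pd i G)) x))"
    using assms p by (simp add: pd_add[of n] pd_sum[of _ n] pospoly_intros)
  have c: "pd j (pd i H) = pd i (pd j H)" if "pospoly n H" for i H
    using that by (rule pd_commute)
  have if1: "(\<Sum>i<n. of_bool (j = i) * pd i G x + x i * pd j (pd i G) x) =
      pd j G x + (\<Sum>i<n. x i * pd i (pd j G) x)"
    using assms(4) by (simp add: sum.distrib c[OF assms(2)])
  have "lam * pd j G x + (pd j G x + (\<Sum>i<n. x i * pd i (pd j G) x)) =
     pd j F x + (\<Sum>i<n. pd i (pd i (pd j G)) x)"
    using fun_cong[OF arg_cong[OF eq, of "pd j"], of x] unfolding 1 2 if1
    by (simp add: c p c[of "pd _ G"])
  then show "(lam + 1) * pd j G x + (\<Sum>i<n. x i * pd i (pd j G) x) + 0 =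
     pd j F x + (\<Sum>i<n. pd i (pd i (pd j G)) x)"
    by (simp add: algebra_simps)
qed

lemma ou_solves_le:
  assumes "pospoly n F" "pospoly n G" "pospoly n u" "ou_solves n lam F G 0" "lam \<ge> 1"
  shows "(LINT x|gauss n. u x * G x) \<le> (LINT x|gauss n. u x * F x)"
proof -
  have "0 \<le> (\<Sum>i<n. LINT x|gauss n. pd i u x * pd i G x)"
    by (intro sum_nonneg pospoly_expectation_nonneg pospoly_mult pospoly_pd assms)
  moreover have "1 * (LINT x|gauss n. u x * G x) \<le> lam * (LINT x|gauss n. u x * G x)"
    using assms by (intro mult_right_mono pospoly_expectation_nonneg pospoly_mult)
  ultimately show ?thesis using ou_solves_expectation[OF assms(1-4)] by simp
qed

section \<open>Variance bounds\<close>

abbreviation gE :: "nat \<Rightarrow> ((nat \<Rightarrow> real) \<Rightarrow> real) \<Rightarrow> real" where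
  "gE n f \<equiv> integral\<^sup>L (gauss n) f"

lemma prob_gauss: "measure (gauss n) (space (gauss n)) = 1"
  using prob_space.prob_space[OF prob_space_gauss] .

lemma gE_const: "gE n (\<lambda>_. c) = c"
  by (simp add: prob_gauss)

lemma gE_mono: "pospoly n f \<Longrightarrow> pospoly n g \<Longrightarrow> (\<And>x. f x \<le> g x) \<Longrightarrow> gE n f \<le> gE n g"
  by (intro integral_mono pospoly_integrable)

lemma gE_add: "pospoly n f \<Longrightarrow> pospoly n g \<Longrightarrow> gE n (\<lambda>x. f x + g x) = gE n f + gE n g"
  by (intro Bochner_Integration.integral_add pospoly_integrable)

lemma gE_sum: "(\<And>i. i \<in> I \<Longrightarrow> pospoly n (f i)) \<Longrightarrow> gE n (\<lambda>x. \<Sum>i\<in>I. f i x) = (\<Sum>i\<in>I. gE n (f i))"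
  by (intro Bochner_Integration.integral_sum pospoly_integrable)

lemma ou_solution:
  assumes "pospoly n F"
  obtains G where "pospoly n G" "ou_solves n 0 F G (gE n F)"
proof -
  obtain G c where G: "pospoly n G" "ou_solves n 0 F G c" using ou_solution_exists[OF assms] by blast
  \<comment> \<open>Testing against \<open>u = 1\<close> identifies the constant.\<close>
  have "c = gE n F"
    using ou_solves_expectation[OF assms G(1) pospoly_const[of 1] G(2)]
    by (simp add: pd_const prob_gauss)
  with G show ?thesis using that by blast
qed

lemma ou_cov:
  assumes "pospoly n F" "pospoly n G" "ou_solves n 0 F G (gE n F)" "pospoly n u"
  shows "gE n (\<lambda>x. u x * F x) - gE n u * gE n F = (\<Sum>i<n. gE n (\<lambda>x. pd i u x * pd i G x))"
  using ou_solves_expectation[OF assms(1,2,4,3)] by (simp add: mult.commute)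

lemma ou_solves_pd1:
  assumes "pospoly n F" "pospoly n G" "ou_solves n 0 F G (gE n F)" "i < n"
  shows "ou_solves n 1 (pd i F) (pd i G) 0"
  using ou_solves_pd[OF assms] pospoly_expectation_nonneg[OF assms(1)] by simp

lemma ou_solves_pd2:
  assumes "pospoly n F" "pospoly n G" "ou_solves n 0 F G (gE n F)" "i < n" "j < n"
  shows "ou_solves n 2 (pd j (pd i F)) (pd j (pd i G)) 0"
  using ou_solves_pd[OF pospoly_pd[OF assms(1)] pospoly_pd[OF assms(2)] ou_solves_pd1[OF assms(1-4)] assms(5)]
  by simp

text \<open>Positive correlation: by \<open>ou_cov\<close> the covariance is a sum of means of
  products of derivatives, each of them nonnegative.\<close>

lemma pospoly_cov_nonneg:
  assumes "pospoly n u" "pospoly n v"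
  shows "gE n u * gE n v \<le> gE n (\<lambda>x. u x * v x)"
proof -
  obtain G where G: "pospoly n G" "ou_solves n 0 v G (gE n v)" using ou_solution[OF assms(2)] .
  have "0 \<le> (\<Sum>i<n. gE n (\<lambda>x. pd i u x * pd i G x))"
    by (intro sum_nonneg pospoly_expectation_nonneg pospoly_mult pospoly_pd assms G)
  then show ?thesis using ou_cov[OF assms(2) G assms(1)] by simp
qed

definition gVar :: "nat \<Rightarrow> ((nat \<Rightarrow> real) \<Rightarrow> real) \<Rightarrow> real" where
  "gVar n F = gE n (\<lambda>x. (F x - gE n F)\<^sup>2)"

lemma gVar_eq:
  assumes "pospoly n F"
  shows "gVar n F = gE n (\<lambda>x. F x * F x) - gE n F * gE n F"
proof -
  have "integrable (gauss n) F" "integrable (gauss n) (\<lambda>x. (F x)\<^sup>2)"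
    by (intro pospoly_integrable pospoly_power assms)+
  then show ?thesis
    unfolding gVar_def using prob_space.variance_eq[OF prob_space_gauss] by (simp add: power2_eq_square)
qed

lemma poincare_pospoly:
  assumes "pospoly n T"
  shows "gVar n T \<le> (\<Sum>j<n. gE n (\<lambda>x. pd j T x * pd j T x))"
proof -
  obtain G where G: "pospoly n G" "ou_solves n 0 T G (gE n T)" using ou_solution[OF assms] .
  have "gVar n T = (\<Sum>j<n. gE n (\<lambda>x. pd j T x * pd j G x))"
    using ou_cov[OF assms G assms] gVar_eq[OF assms] by simp
  also have "\<dots> \<le> (\<Sum>j<n. gE n (\<lambda>x. pd j T x * pd j T x))"
    using assms G by (intro sum_mono ou_solves_le[where lam = 1] pospoly_pd ou_solves_pd1) auto
  finally show ?thesis .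
qed

text \<open>The carre du champ of the Ornstein-Uhlenbeck generator; with \<open>G\<close> the
  solution for \<open>F\<close> it is the \<open>T\<close> of the overview.\<close>

definition carre :: "nat \<Rightarrow> ((nat \<Rightarrow> real) \<Rightarrow> real) \<Rightarrow> ((nat \<Rightarrow> real) \<Rightarrow> real) \<Rightarrow> (nat \<Rightarrow> real) \<Rightarrow> real" where
  "carre n F G x = (\<Sum>i<n. pd i F x * pd i G x)"

definition hess_grad :: "nat \<Rightarrow> ((nat \<Rightarrow> real) \<Rightarrow> real) \<Rightarrow> nat \<Rightarrow> (nat \<Rightarrow> real) \<Rightarrow> real" where
  "hess_grad n F j x = (\<Sum>i<n. pd j (pd i F) x * pd i F x)"

lemma pospoly_carre: "pospoly n F \<Longrightarrow> pospoly n G \<Longrightarrow> pospoly n (carre n F G)"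
  unfolding carre_def[abs_def] by (intro pospoly_sum pospoly_mult pospoly_pd)

lemma pospoly_hess_grad: "pospoly n F \<Longrightarrow> pospoly n (hess_grad n F j)"
  unfolding hess_grad_def[abs_def] by (intro pospoly_sum pospoly_mult pospoly_pd)

lemma gE_carre_solution:
  assumes "pospoly n F" "pospoly n G" "ou_solves n 0 F G (gE n F)"
  shows "gE n (carre n F G) = gVar n F"
  unfolding carre_def[abs_def] gVar_eq[OF assms(1)] using ou_cov[OF assms assms(1)] assms
  by (subst gE_sum) (auto intro!: pospoly_mult pospoly_pd)

text \<open>Every factor \<open>\<nabla>G\<close> or \<open>\<nabla>\<^sup>2G\<close> may be replaced by the
  corresponding derivative of \<open>F\<close>, one at a time.\<close>

lemma gVar_carre_le:
  assumes F: "pospoly n F" and G: "pospoly n G" "ou_solves n 0 F G (gE n F)"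
  shows "gVar n (carre n F G) \<le> 4 * (\<Sum>j<n. gE n (\<lambda>x. (hess_grad n F j x)\<^sup>2))"
proof -
  define T where "T = carre n F G"
  define Z where "Z = hess_grad n F"
  have T: "pospoly n T" unfolding T_def by (intro pospoly_carre F G)
  have Z: "pospoly n (Z j)" for j unfolding Z_def by (intro pospoly_hess_grad F)
  have pT: "pd j T = (\<lambda>x. \<Sum>i<n. pd j (pd i F) x * pd i G x + pd i F x * pd j (pd i G) x)" for j
  proof -
    have "pd j T = (\<lambda>x. \<Sum>i<n. pd j (\<lambda>x. pd i F x * pd i G x) x)"
      unfolding T_def carre_def[abs_def] by (intro pd_sum[of _ n] pospoly_mult pospoly_pd F G)
    also have "\<dots> = (\<lambda>x. \<Sum>i<n. pd j (pd i F) x * pd i G x + pd i F x * pd j (pd i G) x)"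
      by (intro ext sum.cong refl) (simp add: pd_mult[OF pospoly_pd[OF F] pospoly_pd[OF G(1)]])
    finally show ?thesis .
  qed
  \<comment> \<open>The 2 counts the two terms of the product rule for \<open>pd j T\<close>.
    Applying \<open>key\<close> to each factor of the square of \<open>pd j T\<close> gives the 4;
    this is why \<open>u\<close> is arbitrary.\<close>
  have key: "gE n (\<lambda>x. u x * pd j T x) \<le> 2 * gE n (\<lambda>x. u x * Z j x)"
    if u: "pospoly n u" and j: "j < n" for u j
  proof -
    note pp = pospoly_mult pospoly_pd u F G(1)
    have "gE n (\<lambda>x. u x * pd j T x) =
        gE n (\<lambda>x. \<Sum>i<n. u x * pd j (pd i F) x * pd i G x + u x * pd i F x * pd j (pd i G) x)"
      unfolding pT by (simp add: sum_distrib_left algebra_simps)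
    also have "\<dots> = (\<Sum>i<n. gE n (\<lambda>x. u x * pd j (pd i F) x * pd i G x)
        + gE n (\<lambda>x. u x * pd i F x * pd j (pd i G) x))"
      by (subst gE_sum; (subst gE_add)?) (intro pospoly_add pp refl sum.cong)+
    also have "\<dots> \<le> (\<Sum>i<n. gE n (\<lambda>x. u x * pd j (pd i F) x * pd i F x)
        + gE n (\<lambda>x. u x * pd i F x * pd j (pd i F) x))"
      using ou_solves_pd1[OF F G] ou_solves_pd2[OF F G _ j]
      by (intro sum_mono add_mono ou_solves_le[where lam = 1] ou_solves_le[where lam = 2] pp) auto
    also have "\<dots> = 2 * (\<Sum>i<n. gE n (\<lambda>x. u x * (pd j (pd i F) x * pd i F x)))"
      by (simp add: sum_distrib_left ac_simps)
    also have "(\<Sum>i<n. gE n (\<lambda>x. u x * (pd j (pd i F) x * pd i F x))) = gE n (\<lambda>x. u x * Z j x)"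
      unfolding Z_def hess_grad_def sum_distrib_left by (subst gE_sum) (intro pp refl)+
    finally show ?thesis .
  qed
  have "gVar n T \<le> (\<Sum>j<n. gE n (\<lambda>x. pd j T x * pd j T x))" by (rule poincare_pospoly[OF T])
  also have "\<dots> \<le> (\<Sum>j<n. 4 * gE n (\<lambda>x. (Z j x)\<^sup>2))"
  proof (rule sum_mono)
    fix j assume "j \<in> {..<n}"
    then have j: "j < n" by simp
    have "gE n (\<lambda>x. pd j T x * pd j T x) \<le> 2 * gE n (\<lambda>x. pd j T x * Z j x)"
      by (intro key pospoly_pd T j)
    also have "gE n (\<lambda>x. pd j T x * Z j x) \<le> 2 * gE n (\<lambda>x. Z j x * Z j x)"
      using key[OF Z j] by (simp add: mult.commute)
    finally show "gE n (\<lambda>x. pd j T x * pd j T x) \<le> 4 * gE n (\<lambda>x. (Z j x)\<^sup>2)"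
      by (simp add: power2_eq_square)
  qed
  finally show ?thesis by (simp add: T_def Z_def sum_distrib_left)
qed

text \<open>The contribution of the first chaos in direction \<open>i\<close>: keep one summand of
  the covariance formula and split its mean by positive correlation. The derivative of
  \<open>G\<close> has the same mean as that of \<open>v\<close> because it solves the equation with
  \<open>lam = 1\<close>.\<close>

lemma pospoly_cov_ge:
  assumes u: "pospoly n u" and v: "pospoly n v" and i: "i < n"
  shows "gE n (pd i u) * gE n (pd i v) \<le> gE n (\<lambda>x. u x * v x) - gE n u * gE n v"
proof -
  obtain G where G: "pospoly n G" "ou_solves n 0 v G (gE n v)" using ou_solution[OF v] .
  have "gE n (pd i G) = gE n (pd i v)"
    using ou_solves_expectation[OF pospoly_pd[OF v] pospoly_pd[OF G(1)] pospoly_const[of 1]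
        ou_solves_pd1[OF v G i]] by (simp add: pd_const)
  then have "gE n (pd i u) * gE n (pd i v) = gE n (pd i u) * gE n (pd i G)" by simp
  also have "\<dots> \<le> gE n (\<lambda>x. pd i u x * pd i G x)"
    by (intro pospoly_cov_nonneg pospoly_pd u G)
  also have "\<dots> \<le> (\<Sum>i<n. gE n (\<lambda>x. pd i u x * pd i G x))"
    using i by (intro member_le_sum pospoly_expectation_nonneg pospoly_mult pospoly_pd u G) auto
  also have "\<dots> = gE n (\<lambda>x. u x * v x) - gE n u * gE n v" using ou_cov[OF v G u] by simp
  finally show ?thesis .
qed

lemma gVar_ge_first:
  assumes "pospoly n F" "i < n"
  shows "(gE n (pd i F))\<^sup>2 \<le> gVar n F"
  using pospoly_cov_ge[OF assms(1,1,2)] by (simp add: gVar_eq[OF assms(1)] power2_eq_square)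

text \<open>The second chaos contributes at least \<open>(1/2) \<Sum>\<^sub>i (E \<partial>\<^sub>i\<^sub>iF)\<^sup>2\<close>.\<close>

lemma gVar_ge_second:
  assumes F: "pospoly n F"
  shows "(\<Sum>i<n. gE n (pd i (pd i F)))\<^sup>2 \<le> 2 * real n * gVar n F"
proof -
  obtain G where G: "pospoly n G" "ou_solves n 0 F G (gE n F)" using ou_solution[OF F] .
  note pp = pospoly_pd F G(1)
  \<comment> \<open>Second derivatives of \<open>G\<close> solve the equation with
    \<open>lam = 2\<close>, so their means are half those of \<open>F\<close>.\<close>
  have EG: "gE n (pd i (pd i F)) = 2 * gE n (pd i (pd i G))" if "i < n" for i
    using ou_solves_expectation[OF pospoly_pd[OF pospoly_pd[OF F]] pospoly_pd[OF pospoly_pd[OF G(1)]]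
        pospoly_const[of 1] ou_solves_pd2[OF F G that that]] by (simp add: pd_const)
  have ge: "(gE n (pd i (pd i F)))\<^sup>2 / 2 \<le> gE n (\<lambda>x. pd i F x * pd i G x)" if i: "i < n" for i
  proof -
    have "(gE n (pd i (pd i F)))\<^sup>2 / 2 = gE n (pd i (pd i F)) * gE n (pd i (pd i G))"
      using EG[OF i] by (simp add: power2_eq_square)
    also have "\<dots> \<le> gE n (\<lambda>x. pd i F x * pd i G x) - gE n (pd i F) * gE n (pd i G)"
      by (intro pospoly_cov_ge pp i)
    also have "\<dots> \<le> gE n (\<lambda>x. pd i F x * pd i G x)"
      using pospoly_expectation_nonneg[OF pospoly_pd[OF F]] pospoly_expectation_nonneg[OF pospoly_pd[OF G(1)]]
      by simp
    finally show ?thesis .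
  qed
  have "(\<Sum>i<n. gE n (pd i (pd i F)))\<^sup>2 \<le> (\<Sum>i<n. (gE n (pd i (pd i F)))\<^sup>2) * real n"
    using sum_squared_le_sum_of_squares[of "\<lambda>i. gE n (pd i (pd i F))" "{..<n}"] by simp
  also have "\<dots> = 2 * real n * (\<Sum>i<n. (gE n (pd i (pd i F)))\<^sup>2 / 2)"
    by (simp add: sum_divide_distrib[symmetric])
  also have "\<dots> \<le> 2 * real n * (\<Sum>i<n. gE n (\<lambda>x. pd i F x * pd i G x))"
    using ge by (intro mult_left_mono sum_mono) auto
  also have "(\<Sum>i<n. gE n (\<lambda>x. pd i F x * pd i G x)) = gVar n F"
    using ou_cov[OF F G F] gVar_eq[OF F] by simp
  finally show ?thesis .
qed

section \<open>Stein's method\<close>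

text \<open>Stein's solution needs an antiderivative with known limits at both ends. The cumulative
  integral has these limits; it inherits its derivative from some antiderivative \<open>K0\<close>,
  from which it differs by a constant.\<close>

lemma continuous_integrable_antiderivative:
  fixes k :: "real \<Rightarrow> real"
  assumes cont: "continuous_on UNIV k" and int: "integrable lborel k"
  obtains K where "\<And>w. (K has_real_derivative k w) (at w)"
    "(K \<longlongrightarrow> 0) at_bot" "(K \<longlongrightarrow> (LINT t|lborel. k t)) at_top"
proof -
  have isC: "isCont k x" for x using cont by (simp add: continuous_on_eq_continuous_at)
  have meas [measurable]: "k \<in> borel_measurable borel" using cont by (rule borel_measurable_continuous_onI)
  obtain K0 where K0: "\<And>x. (K0 has_real_derivative k x) (at x)"
    using einterval_antiderivative[of "-\<infinity>" \<infinity> k] isC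
    unfolding has_real_derivative_iff_has_vector_derivative by auto
  define K where "K w = (LINT t|lborel. indicator {..w} t *\<^sub>R k t)" for w
  have i: "integrable lborel (\<lambda>t. indicator {..w} t *\<^sub>R k t)" for w
    using int by (rule integrable_mult_indicator[rotated]) simp
  have diff: "K u - K a = K0 u - K0 a" if "a \<le> u" for a u
  proof -
    have "K u - K a = (LINT t|lborel. indicator {..u} t *\<^sub>R k t - indicator {..a} t *\<^sub>R k t)"
      unfolding K_def by (rule Bochner_Integration.integral_diff[symmetric]; rule i)
    also have "\<dots> = (LINT t|lborel. k t * indicator {a..u} t)"
    proof (rule integral_cong_AE)
      \<comment> \<open>The two indicators differ by that of \<open>{a<..u}\<close>, so equality
        fails at most at the single point \<open>a\<close>.\<close>
      show "AE t in lborel. indicator {..u} t *\<^sub>R k t - indicator {..a} t *\<^sub>R k t = k t * indicator {a..u} t"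
        using AE_lborel_singleton[of a] by (rule AE_mp) (use that in \<open>auto simp: indicator_def\<close>)
    qed measurable
    also have "\<dots> = K0 u - K0 a"
      by (intro has_bochner_integral_integral_eq has_bochner_integral_FTC_Icc_real that)
         (auto intro: K0 isC)
    finally show ?thesis .
  qed
  define c where "c = K 0 - K0 0"
  have eq: "K = (\<lambda>u. K0 u + c)"
  proof
    fix u show "K u = K0 u + c"
      using diff[of 0 u] diff[of u 0] by (cases "0 \<le> u") (auto simp: c_def)
  qed
  have "(K has_real_derivative k w) (at w)" for w
    unfolding eq by (auto intro!: derivative_eq_intros K0)
  moreover have "(K \<longlongrightarrow> (LINT t|lborel. k t)) at_top"
    unfolding K_def[abs_def] by (rule tendsto_integral_at_top[OF _ int]) simp
  moreover have "(K \<longlongrightarrow> 0) at_bot"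
  proof (rule tendsto_at_botI_sequentially)
    fix X :: "nat \<Rightarrow> real" assume X: "filterlim X at_bot sequentially"
    have "(\<lambda>n. LINT t|lborel. indicator {..X n} t *\<^sub>R k t) \<longlonglongrightarrow> integral\<^sup>L lborel (\<lambda>_::real. 0 :: real)"
    proof (rule integral_dominated_convergence[where w = "\<lambda>t. norm (k t)"])
      show "integrable lborel (\<lambda>t. norm (k t))" using int by simp
      show "AE t in lborel. (\<lambda>n. indicator {..X n} t *\<^sub>R k t) \<longlonglongrightarrow> 0"
      proof (intro AE_I2 tendsto_eventually)
        fix t
        have "\<forall>\<^sub>F n in sequentially. X n < t"
          using X by (simp add: filterlim_at_bot_dense)
        then show "\<forall>\<^sub>F n in sequentially. indicator {..X n} t *\<^sub>R k t = 0"
          by eventually_elim auto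
      qed
    qed (auto simp: indicator_def)
    then show "(\<lambda>n. K (X n)) \<longlonglongrightarrow> 0" by (simp add: K_def)
  qed
  ultimately show ?thesis using that by blast
qed

text \<open>For \<open>w > 0\<close> both \<open>\<rho>(w) / w \<plusminus> K(w)\<close>, with \<open>\<rho>\<close> the normal density, are
  decreasing and vanish at infinity.\<close>

lemma stein_tail_bound:
  fixes K :: "real \<Rightarrow> real"
  assumes K: "\<And>w. (K has_real_derivative g w * std_normal_density w) (at w)"
    and lim: "(K \<longlongrightarrow> 0) at_bot" "(K \<longlongrightarrow> 0) at_top"
    and g: "\<And>w. \<bar>g w\<bar> \<le> 1"
  shows "\<bar>w\<bar> * \<bar>K w\<bar> \<le> std_normal_density w"
proof -
  let ?d = std_normal_density
  have d0: "?d t > 0" for t by (simp add: normal_density_pos)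
  have pos: "0 \<le> ?d w / w + s * K w" if w: "w > 0" and s: "\<bar>s\<bar> = 1" for w s
  proof -
    define u where "u t = ?d t / t + s * K t" for t
    have du: "(u has_real_derivative (- ?d t - ?d t / t\<^sup>2 + s * (g t * ?d t))) (at t)" if "t > 0" for t
      unfolding u_def using that
      by (intro DERIV_cong[OF DERIV_add[OF DERIV_divide[OF std_normal_density_has_derivative DERIV_ident]
            DERIV_cmult[OF K]]]) (auto simp: power2_eq_square field_simps)
    have "u t \<le> u w" if "w \<le> t" for t
    proof (rule DERIV_nonpos_imp_nonincreasing[OF that])
      fix x assume x: "w \<le> x" "x \<le> t"
      have "s * g x \<le> \<bar>s\<bar> * \<bar>g x\<bar>" by (metis abs_ge_self abs_mult)
      then have "s * g x * ?d x \<le> 1 * ?d x" using g[of x] s d0[of x] by (intro mult_right_mono) auto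
      moreover have "0 \<le> ?d x / x\<^sup>2" using d0[of x] by (simp add: less_imp_le)
      ultimately have "- ?d x - ?d x / x\<^sup>2 + s * (g x * ?d x) \<le> 0"
        unfolding mult.assoc by linarith
      then show "\<exists>y. (u has_real_derivative y) (at x) \<and> y \<le> 0"
        using du[of x] w x by auto
    qed
    then have "\<forall>\<^sub>F t in at_top. u t \<le> u w"
      by (rule eventually_mono[OF eventually_ge_at_top[of w]])
    moreover have "(u \<longlongrightarrow> 0 + s * 0) at_top"
    proof -
      have "((\<lambda>t. ?d t * inverse t) \<longlongrightarrow> 0 * 0) at_top"
        using poly_times_std_normal_density_at_top[of 1]
        by (intro tendsto_mult tendsto_inverse_0_at_top filterlim_ident) simp
      then show ?thesis unfolding u_def
        by (intro tendsto_add tendsto_mult tendsto_const lim) (simp add: divide_inverse)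
    qed
    ultimately have "0 + s * 0 \<le> u w" by (intro tendsto_upperbound[of u _ at_top]) auto
    then show ?thesis by (simp add: u_def)
  qed
  have neg: "0 \<le> - (?d w / w) + s * K w" if w: "w < 0" and s: "\<bar>s\<bar> = 1" for w s
  proof -
    define u where "u t = - (?d t / t) + s * K t" for t
    have du: "(u has_real_derivative (?d t + ?d t / t\<^sup>2 + s * (g t * ?d t))) (at t)" if "t < 0" for t
      unfolding u_def using that
      by (intro DERIV_cong[OF DERIV_add[OF DERIV_minus[OF DERIV_divide[OF std_normal_density_has_derivative DERIV_ident]]
            DERIV_cmult[OF K]]]) (auto simp: power2_eq_square field_simps)
    have "u t \<le> u w" if "t \<le> w" for t
    proof (rule DERIV_nonneg_imp_nondecreasing[OF that])
      fix x assume x: "t \<le> x" "x \<le> w"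
      have "- (s * g x) \<le> \<bar>s\<bar> * \<bar>g x\<bar>" by (metis abs_ge_minus_self abs_mult)
      then have "- (s * g x) * ?d x \<le> 1 * ?d x" using g[of x] s d0[of x] by (intro mult_right_mono) auto
      moreover have "0 \<le> ?d x / x\<^sup>2" using d0[of x] by (simp add: less_imp_le)
      ultimately have "0 \<le> ?d x + ?d x / x\<^sup>2 + s * (g x * ?d x)"
        by (simp add: mult.assoc del: divide_nonneg_nonneg)
      then show "\<exists>y. (u has_real_derivative y) (at x) \<and> 0 \<le> y"
        using du[of x] w x by auto
    qed
    then have "\<forall>\<^sub>F t in at_bot. u t \<le> u w"
      by (rule eventually_mono[OF eventually_le_at_bot[of w]])
    moreover have "(u \<longlongrightarrow> - 0 + s * 0) at_bot"
    proof -
      have "((\<lambda>t. ?d t * inverse t) \<longlongrightarrow> 0 * 0) at_bot"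
        using poly_times_std_normal_density_at_bot[of 1]
        by (intro tendsto_mult tendsto_inverse_0 filterlim_mono[OF tendsto_inverse_0 order_refl at_bot_le_at_infinity]) simp
      then show ?thesis unfolding u_def
        by (intro tendsto_add tendsto_mult tendsto_const tendsto_minus lim) (simp add: divide_inverse)
    qed
    ultimately have "- 0 + s * 0 \<le> u w" by (intro tendsto_upperbound[of u _ at_bot]) auto
    then show ?thesis by (simp add: u_def)
  qed
  consider "w > 0" | "w < 0" | "w = 0" by linarith
  then show ?thesis
  proof cases
    case 1
    then have "\<bar>K w\<bar> \<le> ?d w / w" using pos[OF 1, of 1] pos[OF 1, of "-1"] by auto
    then show ?thesis using 1 by (simp add: field_simps)
  next
    case 2
    then have "\<bar>K w\<bar> \<le> - (?d w / w)" using neg[OF 2, of 1] neg[OF 2, of "-1"] by auto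
    then show ?thesis using 2 by (simp add: field_simps)
  qed (simp add: d0 less_imp_le)
qed

text \<open>With \<open>g = h - \<mu>\<close>, the solution is the antiderivative of
  \<open>g\<close> times the density, divided by the density; centring makes that antiderivative
  vanish at both ends. The tail bound says \<open>\<bar>w * \<phi> w\<bar> \<le> 1\<close>, so
  \<open>\<phi>' = g + w * \<phi>\<close> is at most 2. The value of \<open>B\<close>, found by
  compactness on \<open>[-1, 1]\<close>, serves integrability only.\<close>

lemma stein_solution:
  fixes h :: "real \<Rightarrow> real"
  assumes cont: "continuous_on UNIV h" and h: "\<And>x. 0 \<le> h x" "\<And>x. h x \<le> 1"
  defines "\<mu> \<equiv> LINT x|std_normal_distribution. h x"
  obtains \<phi> \<phi>' B where "\<And>w. (\<phi> has_real_derivative \<phi>' w) (at w)" "continuous_on UNIV \<phi>'"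
    "\<And>w. \<bar>\<phi> w\<bar> \<le> B" "\<And>w. \<bar>\<phi>' w\<bar> \<le> 2" "\<And>w. h w - \<mu> = \<phi>' w - w * \<phi> w"
proof -
  let ?d = std_normal_density
  have d0: "?d t > 0" for t by (simp add: normal_density_pos)
  have [measurable]: "h \<in> borel_measurable borel" using cont by (rule borel_measurable_continuous_onI)
  have ih: "integrable std_normal_distribution h"
    using h by (intro std_normal.integrable_const_bound[of _ 1]) auto
  have mu: "0 \<le> \<mu>" "\<mu> \<le> 1"
    using h integral_mono[OF ih, of "\<lambda>_. 1"] std_normal.prob_space
    unfolding \<mu>_def by (auto intro: Bochner_Integration.integral_nonneg)
  define g where "g x = h x - \<mu>" for x
  have g1: "\<bar>g x\<bar> \<le> 1" for x using h[of x] mu unfolding g_def by linarith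
  have [measurable]: "g \<in> borel_measurable borel" unfolding g_def by measurable
  have ig: "integrable std_normal_distribution g" unfolding g_def using ih by simp
  have ig': "integrable lborel (\<lambda>x. g x * ?d x)"
    using ig by (simp add: integrable_density normal_density_nonneg mult.commute)
  have "(LINT x|std_normal_distribution. g x) = 0"
    unfolding g_def using ih std_normal.prob_space by (simp add: \<mu>_def)
  then have ig0: "(LINT x|lborel. g x * ?d x) = 0"
    by (simp add: integral_density normal_density_nonneg mult.commute)
  have cd: "continuous_on UNIV ?d"
    by (meson DERIV_continuous continuous_at_imp_continuous_on std_normal_density_has_derivative)
  have cg: "continuous_on UNIV g" unfolding g_def by (intro continuous_intros cont)
  obtain K where K: "\<And>w. (K has_real_derivative g w * ?d w) (at w)"
    "(K \<longlongrightarrow> 0) at_bot" "(K \<longlongrightarrow> 0) at_top"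
    using continuous_integrable_antiderivative[OF continuous_on_mult[OF cg cd] ig'] unfolding ig0 by blast
  define \<phi> where "\<phi> w = K w / ?d w" for w
  have wphi: "\<bar>w * \<phi> w\<bar> \<le> 1" for w
    using stein_tail_bound[OF K g1, of w] d0[of w] by (simp add: \<phi>_def abs_mult field_simps)
  have d: "(\<phi> has_real_derivative g w + w * \<phi> w) (at w)" for w
    unfolding \<phi>_def using d0[of w]
    by (auto intro!: derivative_eq_intros K std_normal_density_has_derivative simp: field_simps)
  have c\<phi>: "continuous_on UNIV \<phi>"
    using d by (meson DERIV_continuous continuous_at_imp_continuous_on)
  have "compact (\<phi> ` {-1..1})"
    by (intro compact_continuous_image continuous_on_subset[OF c\<phi>]) auto
  then have "bounded (\<phi> ` {-1..1})" by (rule compact_imp_bounded)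
  then obtain C where "\<forall>y\<in>\<phi> ` {-1..1}. \<bar>y\<bar> \<le> C" unfolding bounded_iff by auto
  then have C: "\<bar>\<phi> w\<bar> \<le> C" if "w \<in> {-1..1}" for w using that by blast
  have B: "\<bar>\<phi> w\<bar> \<le> max C 1" for w
  proof (cases "\<bar>w\<bar> \<le> 1")
    case True
    then have "w \<in> {-1..1}" by auto
    then show ?thesis using C[of w] by linarith
  next
    case False
    then have "1 * \<bar>\<phi> w\<bar> \<le> \<bar>w\<bar> * \<bar>\<phi> w\<bar>" by (intro mult_right_mono) auto
    then show ?thesis using wphi[of w] by (simp add: abs_mult)
  qed
  show ?thesis
  proof (rule that[of \<phi> "\<lambda>w. g w + w * \<phi> w" "max C 1"])
    show "continuous_on UNIV (\<lambda>w. g w + w * \<phi> w)" by (intro continuous_intros cg c\<phi>)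
    show "\<bar>g w + w * \<phi> w\<bar> \<le> 2" for w using g1[of w] wphi[of w] by linarith
    show "(\<phi> has_real_derivative g w + w * \<phi> w) (at w)" for w by (rule d)
  qed (auto simp: B g_def)
qed

text \<open>Inner regularity reduces a Borel set to a compact \<open>K\<close>, whose indicator is the limit of
  \<open>max 0 (1 - m d(x, K))\<close>.\<close>

lemma measure_diff_le_of_continuous:
  fixes P Q :: "real measure"
  assumes P: "prob_space P" "sets P = sets borel" and Q: "prob_space Q" "sets Q = sets borel"
    and le: "\<And>h. continuous_on UNIV h \<Longrightarrow> (\<And>x. 0 \<le> h x) \<Longrightarrow> (\<And>x. h x \<le> 1) \<Longrightarrow>
      (LINT x|P. h x) - (LINT x|Q. h x) \<le> e"
    and B: "B \<in> sets borel"
  shows "measure P B - measure Q B \<le> e"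
proof (rule ccontr)
  interpret P: prob_space P by fact
  interpret Q: prob_space Q by fact
  assume "\<not> measure P B - measure Q B \<le> e"
  then have lt: "e + measure Q B < measure P B" by simp
  have e0: "0 \<le> e" using le[of "\<lambda>_. 0"] by simp
  have "ennreal (e + measure Q B) < emeasure P B"
    unfolding P.emeasure_eq_measure using lt e0 measure_nonneg[of Q B]
    by (intro ennreal_lessI) linarith+
  also have "emeasure P B = (SUP K \<in> {K. K \<subseteq> B \<and> compact K}. emeasure P K)"
    by (rule inner_regular[OF P(2) _ B]) simp
  finally obtain K where K: "K \<subseteq> B" "compact K" "ennreal (e + measure Q B) < emeasure P K"
    unfolding less_SUP_iff by auto
  then have K3: "e + measure Q B < measure P K"
    using e0 by (simp add: P.emeasure_eq_measure ennreal_less_iff del: ennreal_plus)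
  have KP [measurable]: "K \<in> sets borel" using K(2) by (simp add: compact_imp_closed)
  have QK: "measure Q K \<le> measure Q B" using K(1) B Q(2) by (intro Q.finite_measure_mono) auto
  \<comment> \<open>\<open>infdist\<close> to the empty set is 0 by convention, which would make
    \<open>h\<close> constantly 1.\<close>
  have ne: "K \<noteq> {}"
  proof
    assume "K = {}"
    then show False using K3 e0 by (simp add: add_nonneg_nonneg leD)
  qed
  define h where "h m x = max 0 (1 - real m * infdist x K)" for m x
  have hc: "continuous_on UNIV (h m)" for m
    unfolding h_def by (intro continuous_intros)
  have h01: "0 \<le> h m x" "h m x \<le> 1" for m x
    unfolding h_def by (auto simp: infdist_nonneg)
  have hl: "(\<lambda>m. h m x) \<longlonglongrightarrow> indicator K x" for x
  proof (cases "x \<in> K")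
    case True
    then show ?thesis by (simp add: h_def)
  next
    case False
    then have p: "infdist x K > 0" using K(2) ne by (intro infdist_pos_not_in_closed) (auto simp: compact_imp_closed)
    obtain N where N: "1 < real N * infdist x K" using reals_Archimedean3[OF p] by blast
    have "\<forall>\<^sub>F m in sequentially. h m x = 0"
      using eventually_ge_at_top[of N]
    proof eventually_elim
      case (elim m)
      then have "real N * infdist x K \<le> real m * infdist x K" using p by (intro mult_right_mono) auto
      then show ?case using N by (simp add: h_def)
    qed
    then show ?thesis using False by (simp add: tendsto_eventually)
  qed
  have lim: "(\<lambda>m. LINT x|R. h m x) \<longlonglongrightarrow> measure R K" if R: "prob_space R" "sets R = sets borel" for R
  proof -
    interpret R: prob_space R by fact
    have sR: "space R = UNIV" using R(2) sets_eq_imp_space_eq[OF R(2)] by simp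
    have m: "h m \<in> borel_measurable R" for m
      using borel_measurable_continuous_onI[OF hc[of m]] R(2) by (simp cong: measurable_cong_sets)
    have "(\<lambda>m. LINT x|R. h m x) \<longlonglongrightarrow> (LINT x|R. indicator K x)"
      using h01 hl m KP R(2)
      by (intro integral_dominated_convergence[where w = "\<lambda>_. 1"]) auto
    also have "(LINT x|R. indicator K x) = measure R K" using KP R(2) sR by simp
    finally show ?thesis .
  qed
  have "measure P K - measure Q K \<le> e"
    using h01 hc
    by (intro LIMSEQ_le_const2[OF tendsto_diff[OF lim[OF P] lim[OF Q]]] exI[of _ 0] allI impI le)
  with K3 QK show False by linarith
qed

lemma tv_dist_le_of_continuous:
  assumes P: "prob_space P" "sets P = sets borel" and Q: "prob_space Q" "sets Q = sets borel"
    and le: "\<And>h. continuous_on UNIV h \<Longrightarrow> (\<And>x. 0 \<le> h x) \<Longrightarrow> (\<And>x. h x \<le> 1) \<Longrightarrow>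
      \<bar>(LINT x|P. h x) - (LINT x|Q. h x)\<bar> \<le> e"
  shows "tv_dist P Q \<le> e"
  unfolding tv_dist_def
proof (rule cSUP_least)
  fix B :: "real set" assume B: "B \<in> sets borel"
  have "measure P B - measure Q B \<le> e"
    using le by (intro measure_diff_le_of_continuous[OF P Q _ B]) (meson abs_le_D1)
  moreover have "measure Q B - measure P B \<le> e"
    using le by (intro measure_diff_le_of_continuous[OF Q P _ B]) (smt (verit, best))
  ultimately show "\<bar>measure P B - measure Q B\<bar> \<le> e" by linarith
qed auto

lemma tv_dist_nonneg:
  assumes "prob_space P" "prob_space Q"
  shows "0 \<le> tv_dist P Q"
proof -
  have "\<bar>measure P {} - measure Q {}\<bar> \<le> tv_dist P Q"
    unfolding tv_dist_def
  proof (rule cSUP_upper)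
    show "bdd_above ((\<lambda>B. \<bar>measure P B - measure Q B\<bar>) ` sets borel)"
    proof (intro bdd_aboveI[of _ 1], clarify)
      fix B
      show "\<bar>measure P B - measure Q B\<bar> \<le> 1"
        using prob_space.prob_le_1[OF assms(1), of B] prob_space.prob_le_1[OF assms(2), of B]
          measure_nonneg[of P B] measure_nonneg[of Q B] by linarith
    qed
  qed auto
  then show ?thesis by simp
qed

text \<open>The constant 4 is the bound 2 on \<open>\<phi>'\<close> times the square root of the 4
  in \<open>gVar_carre_le\<close>.\<close>

theorem second_order_poincare_pospoly:
  assumes F: "pospoly n F" and V: "gVar n F > 0"
  shows "tv_dist (distr (gauss n) borel (\<lambda>x. (F x - gE n F) / sqrt (gVar n F))) std_normal_distribution
    \<le> 4 * sqrt (\<Sum>j<n. gE n (\<lambda>x. (hess_grad n F j x)\<^sup>2)) / gVar n F"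
    (is "tv_dist ?P _ \<le> ?e")
proof (rule tv_dist_le_of_continuous)
  interpret g: prob_space "gauss n" by (rule prob_space_gauss)
  have Fm [measurable]: "F \<in> borel_measurable (gauss n)"
    using pospoly_integrable[OF F] by (rule borel_measurable_integrable)
  show "prob_space ?P" by (intro g.prob_space_distr) measurable
  show "prob_space std_normal_distribution" by (rule std_normal.prob_space_axioms)
  fix h :: "real \<Rightarrow> real"
  assume h: "continuous_on UNIV h" "\<And>x. 0 \<le> h x" "\<And>x. h x \<le> 1"
  define \<mu> where "\<mu> = (LINT x|std_normal_distribution. h x)"
  obtain \<phi> \<phi>' B where phi: "\<And>w. (\<phi> has_real_derivative \<phi>' w) (at w)" "continuous_on UNIV \<phi>'"
    "\<And>w. \<bar>\<phi> w\<bar> \<le> B" "\<And>w. \<bar>\<phi>' w\<bar> \<le> 2" "\<And>w. h w - \<mu> = \<phi>' w - w * \<phi> w"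
    using stein_solution[OF h] unfolding \<mu>_def by metis
  define V where "V = gVar n F"
  define s where "s = sqrt V"
  have V0: "V > 0" and s0: "s > 0" and ss: "s * s = V" using assms(2) by (auto simp: V_def s_def)
  define E where "E = gE n F"
  define S where "S y = (y - E) / s" for y
  have Sd: "(S has_real_derivative 1 / s) (at y)" for y
    unfolding S_def using s0 by (auto intro!: derivative_eq_intros)
  have Sc: "continuous_on UNIV S"
    using Sd by (meson DERIV_continuous continuous_at_imp_continuous_on)
  \<comment> \<open>Centring \<open>F\<close> itself would leave the class of nonnegative
    coefficients; the affine map \<open>S\<close> is therefore moved into the test function.\<close>
  define \<psi> where "\<psi> y = \<phi> (S y)" for y
  define \<psi>' where "\<psi>' y = \<phi>' (S y) / s" for y
  have psi: "(\<psi> has_real_derivative \<psi>' y) (at y)" for y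
    using DERIV_chain2[OF phi(1) Sd] unfolding \<psi>_def \<psi>'_def by (simp add: o_def)
  have cpsi': "continuous_on UNIV \<psi>'"
    unfolding \<psi>'_def using s0 by (intro continuous_intros continuous_on_compose2[OF phi(2) Sc]) auto
  have cpsi: "continuous_on UNIV \<psi>"
    using psi by (meson DERIV_continuous continuous_at_imp_continuous_on)
  have bpsi: "\<bar>\<psi> y\<bar> \<le> B" for y unfolding \<psi>_def by (rule phi)
  have bpsi': "\<bar>\<psi>' y\<bar> \<le> 2 / s" for y unfolding \<psi>'_def using phi(4) s0 by (simp add: divide_right_mono)
  obtain G where G: "pospoly n G" "ou_solves n 0 F G E" using ou_solution[OF F] unfolding E_def .
  define T where "T = carre n F G"
  have T: "pospoly n T" unfolding T_def by (intro pospoly_carre F G)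
  have ET: "gE n T = V" unfolding T_def V_def using gE_carre_solution[OF F G(1)] G(2) by (simp add: E_def)
  note bint = pospoly_bounded_integrable[OF _ F cpsi bpsi]
  note bint' = pospoly_bounded_integrable[OF _ F cpsi' bpsi']
  \<comment> \<open>The equation replaces \<open>F - E\<close> by
    \<open>x \<cdot> \<nabla>G - \<Delta>G\<close>. Integrating the first part by parts against
    \<open>\<psi> (F x)\<close> produces \<open>\<Delta>G\<close>, which cancels, and the chain rule
    term with \<open>T\<close>.\<close>
  have main: "gE n (\<lambda>x. (F x - E) * \<psi> (F x)) = gE n (\<lambda>x. T x * \<psi>' (F x))"
  proof -
    have i1: "integrable (gauss n) (\<lambda>x. x i * pd i G x * \<psi> (F x))" if "i < n" for i
      by (intro bint pospoly_mult pospoly_var pospoly_pd G that)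
    have i2: "integrable (gauss n) (\<lambda>x. pd i (pd i G) x * \<psi> (F x))" for i
      by (intro bint pospoly_pd G)
    have i3: "integrable (gauss n) (\<lambda>x. pd i G x * pd i F x * \<psi>' (F x))" for i
      by (intro bint' pospoly_mult pospoly_pd F G)
    have "(F x - E) * \<psi> (F x) = (\<Sum>i<n. x i * pd i G x * \<psi> (F x)) - (\<Sum>i<n. pd i (pd i G) x * \<psi> (F x))" for x
    proof -
      have "F x - E = (\<Sum>i<n. x i * pd i G x) - (\<Sum>i<n. pd i (pd i G) x)"
        using G(2)[unfolded ou_solves_def, rule_format, of x] by (simp add: algebra_simps)
      then show ?thesis by (simp add: left_diff_distrib sum_distrib_right)
    qed
    then have "gE n (\<lambda>x. (F x - E) * \<psi> (F x)) =
        gE n (\<lambda>x. (\<Sum>i<n. x i * pd i G x * \<psi> (F x)) - (\<Sum>i<n. pd i (pd i G) x * \<psi> (F x)))" by simp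
    also have "\<dots> = (\<Sum>i<n. gE n (\<lambda>x. x i * pd i G x * \<psi> (F x))) - (\<Sum>i<n. gE n (\<lambda>x. pd i (pd i G) x * \<psi> (F x)))"
      using i1 i2 by (subst Bochner_Integration.integral_diff) (auto simp: Bochner_Integration.integral_sum)
    also have "\<dots> = (\<Sum>i<n. gE n (\<lambda>x. pd i G x * pd i F x * \<psi>' (F x)))"
      unfolding sum_subtractf[symmetric]
    proof (rule sum.cong[OF refl])
      fix i assume "i \<in> {..<n}"
      then have "i < n" by simp
      then show "gE n (\<lambda>x. x i * pd i G x * \<psi> (F x)) - gE n (\<lambda>x. pd i (pd i G) x * \<psi> (F x)) =
          gE n (\<lambda>x. pd i G x * pd i F x * \<psi>' (F x))"
        using gauss_ibp[OF _ pospoly_pd[OF G(1)] F psi cpsi' bpsi bpsi', of i i] i2 i3 by simp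
    qed
    also have "\<dots> = gE n (\<lambda>x. \<Sum>i<n. pd i G x * pd i F x * \<psi>' (F x))"
      using i3 by (intro Bochner_Integration.integral_sum[symmetric]) auto
    also have "\<dots> = gE n (\<lambda>x. T x * \<psi>' (F x))"
      by (simp add: T_def carre_def sum_distrib_left mult_ac)
    finally show ?thesis .
  qed
  have iT: "integrable (gauss n) T" by (rule pospoly_integrable[OF T])
  have iTT: "integrable (gauss n) (\<lambda>x. T x * T x)" by (intro pospoly_integrable pospoly_mult T)
  have ip: "integrable (gauss n) (\<lambda>x. \<psi>' (F x))" using bint'[of "\<lambda>_. 1"] by (simp add: pospoly_const)
  have iTp: "integrable (gauss n) (\<lambda>x. T x * \<psi>' (F x))" by (rule bint'[OF T])
  have iFp: "integrable (gauss n) (\<lambda>x. (F x - E) * \<psi> (F x))"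
  proof -
    have "integrable (gauss n) (\<lambda>x. F x * \<psi> (F x) - E * \<psi> (F x))"
      using bint[OF F] bint[of "\<lambda>_. 1"] by (intro Bochner_Integration.integrable_diff integrable_mult_right) (auto simp: pospoly_const)
    then show ?thesis by (simp add: left_diff_distrib)
  qed
  have hm [measurable]: "h \<in> borel_measurable borel" using h(1) by (rule borel_measurable_continuous_onI)
  have ih: "integrable (gauss n) (\<lambda>x. h (S (F x)))"
  proof (rule g.integrable_const_bound[of _ 1])
    have [measurable]: "S \<in> borel_measurable borel" using Sc by (rule borel_measurable_continuous_onI)
    show "(\<lambda>x. h (S (F x))) \<in> borel_measurable (gauss n)" by measurable
  qed (use h in auto)
  have "(LINT x|?P. h x) = gE n (\<lambda>x. h (S (F x)))"
    by (subst integral_distr) (auto simp: S_def E_def s_def V_def)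
  then have "(LINT x|?P. h x) - \<mu> = gE n (\<lambda>x. h (S (F x)) - \<mu>)"
    using ih by (simp add: prob_gauss)
  also have "(\<lambda>x. h (S (F x)) - \<mu>) = (\<lambda>x. s * \<psi>' (F x) - (1 / s) * ((F x - E) * \<psi> (F x)))"
    unfolding phi(5) \<psi>_def \<psi>'_def using s0 by (auto simp: S_def)
  also have "gE n \<dots> = s * gE n (\<lambda>x. \<psi>' (F x)) - (1 / s) * gE n (\<lambda>x. T x * \<psi>' (F x))"
    using ip iFp main by simp
  also have "\<dots> = gE n (\<lambda>x. s * \<psi>' (F x) - (1 / s) * (T x * \<psi>' (F x)))"
    using ip iTp by simp
  also have "\<dots> = gE n (\<lambda>x. (1 / s) * ((V - T x) * \<psi>' (F x)))"
    using s0 ss by (intro Bochner_Integration.integral_cong refl) (simp add: field_simps)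
  finally have eq: "(LINT x|?P. h x) - \<mu> = (1 / s) * gE n (\<lambda>x. (V - T x) * \<psi>' (F x))" by simp
  have "\<bar>gE n (\<lambda>x. (V - T x) * \<psi>' (F x))\<bar> \<le> gE n (\<lambda>x. \<bar>T x - V\<bar> * (2 / s))"
  proof (rule order_trans[OF integral_abs_bound integral_mono])
    show "integrable (gauss n) (\<lambda>x. \<bar>(V - T x) * \<psi>' (F x)\<bar>)"
      using ip iTp by (intro integrable_abs) (simp add: left_diff_distrib)
    show "integrable (gauss n) (\<lambda>x. \<bar>T x - V\<bar> * (2 / s))" using iT by simp
    show "\<bar>(V - T x) * \<psi>' (F x)\<bar> \<le> \<bar>T x - V\<bar> * (2 / s)" for x
      unfolding abs_mult abs_minus_commute[of V] by (intro mult_left_mono bpsi') auto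
  qed
  also have "\<dots> = (2 / s) * gE n (\<lambda>x. \<bar>T x - V\<bar>)" by simp
  also have "gE n (\<lambda>x. \<bar>T x - V\<bar>) \<le> sqrt (gVar n T)"
  proof (rule real_le_rsqrt)
    have iV: "integrable (gauss n) (\<lambda>x. (T x - V)\<^sup>2)"
      using iT iTT by (simp add: power2_eq_square algebra_simps)
    \<comment> \<open>The variance of \<open>\<bar>T x - V\<bar>\<close> is nonnegative: this is
      Jensen's inequality.\<close>
    have "0 \<le> gE n (\<lambda>x. (\<bar>T x - V\<bar> - gE n (\<lambda>x. \<bar>T x - V\<bar>))\<^sup>2)" by simp
    also have "\<dots> = gE n (\<lambda>x. \<bar>T x - V\<bar>\<^sup>2) - (gE n (\<lambda>x. \<bar>T x - V\<bar>))\<^sup>2"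
      using iT iV by (intro g.variance_eq) auto
    finally show "(gE n (\<lambda>x. \<bar>T x - V\<bar>))\<^sup>2 \<le> gVar n T" by (simp add: gVar_def ET)
  qed
  also have "gVar n T \<le> 4 * (\<Sum>j<n. gE n (\<lambda>x. (hess_grad n F j x)\<^sup>2))"
    unfolding T_def using G(2) by (intro gVar_carre_le F G(1)) (simp add: E_def)
  finally have le: "\<bar>gE n (\<lambda>x. (V - T x) * \<psi>' (F x))\<bar> \<le>
      (2 / s) * sqrt (4 * (\<Sum>j<n. gE n (\<lambda>x. (hess_grad n F j x)\<^sup>2)))"
    using s0 by (simp add: divide_right_mono)
  have "\<bar>(LINT x|?P. h x) - \<mu>\<bar> \<le> (1 / s) * ((2 / s) * sqrt (4 * (\<Sum>j<n. gE n (\<lambda>x. (hess_grad n F j x)\<^sup>2))))"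
    unfolding eq abs_mult using s0 le by (intro mult_mono) auto
  also have "\<dots> = ?e" using s0 ss by (simp add: real_sqrt_mult V_def[symmetric] field_simps)
  finally show "\<bar>(LINT x|?P. h x) - (LINT x|std_normal_distribution. h x)\<bar> \<le> ?e" by (simp add: \<mu>_def)
qed simp_all

section \<open>Trace, Hilbert-Schmidt norm and operator norm\<close>

lemma toeplitz_carrier [simp]: "toeplitz n x \<in> carrier_mat n n"
  by (simp add: toeplitz_def)

lemma toeplitz_dim [simp]: "dim_row (toeplitz n x) = n" "dim_col (toeplitz n x) = n"
  by (simp_all add: toeplitz_def)

lemma toeplitz_index:
  "i < n \<Longrightarrow> j < n \<Longrightarrow> toeplitz n x $$ (i, j) = x (nat \<bar>int i - int j\<bar>) / sqrt (real n)"
  by (simp add: toeplitz_def)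

lemma toeplitz_sym: "i < n \<Longrightarrow> j < n \<Longrightarrow> toeplitz n x $$ (i, j) = toeplitz n x $$ (j, i)"
  by (simp add: toeplitz_index abs_minus_commute)

lemma toeplitz_diff_less: "i < n \<Longrightarrow> j < n \<Longrightarrow> nat \<bar>int i - int j\<bar> < n"
  by linarith

lemma mult_mat_index_sum:
  fixes A B :: "'a :: comm_semiring_0 Matrix.mat"
  assumes "A \<in> carrier_mat n n" "B \<in> carrier_mat n n" "i < n" "j < n"
  shows "(A * B) $$ (i, j) = (\<Sum>k<n. A $$ (i, k) * B $$ (k, j))"
  using assms by (simp add: scalar_prod_def atLeast0LessThan)

lemma pow_mat_add:
  fixes A :: "'a :: comm_ring_1 Matrix.mat"
  assumes A: "A \<in> carrier_mat n n"
  shows "A ^\<^sub>m (i + j) = A ^\<^sub>m i * A ^\<^sub>m j"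
proof (induction j)
  case 0
  have "A ^\<^sub>m i * 1\<^sub>m n = A ^\<^sub>m i" using A by (intro right_mult_one_mat) auto
  then show ?case using A by simp
next
  case (Suc j)
  have "A ^\<^sub>m i * A ^\<^sub>m j * A = A ^\<^sub>m i * (A ^\<^sub>m j * A)"
    using A by (intro assoc_mult_mat[of _ n n _ n _ n]) auto
  then show ?case using Suc by simp
qed

lemma pow_mat_square:
  fixes A :: "'a :: comm_ring_1 Matrix.mat"
  assumes A: "A \<in> carrier_mat n n"
  shows "(A * A) ^\<^sub>m k = A ^\<^sub>m (2 * k)"
proof (induction k)
  case (Suc k)
  have "A ^\<^sub>m (2 * k) * (A * A) = A ^\<^sub>m (2 * k) * A * A"
    using A by (intro assoc_mult_mat[symmetric, of _ n n _ n _ n]) auto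
  then show ?case using Suc by simp
qed (use A in simp)

lemma mat_trace_carrier: "A \<in> carrier_mat n m \<Longrightarrow> mat_trace A = (\<Sum>i<n. A $$ (i, i))"
  by (simp add: mat_trace_def)

lemma mat_trace_mult:
  fixes A B :: "'a :: comm_semiring_0 Matrix.mat"
  assumes "A \<in> carrier_mat n n" "B \<in> carrier_mat n n"
  shows "mat_trace (A * B) = (\<Sum>i<n. \<Sum>j<n. A $$ (i, j) * B $$ (j, i))"
  using assms by (simp add: mat_trace_carrier[of _ n n] mult_mat_index_sum[of _ n] del: index_mult_mat(1))

lemma mat_trace_mult_comm:
  fixes A B :: "'a :: comm_semiring_0 Matrix.mat"
  assumes "A \<in> carrier_mat n n" "B \<in> carrier_mat n n"
  shows "mat_trace (A * B) = mat_trace (B * A)"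
  unfolding mat_trace_mult[OF assms] mat_trace_mult[OF assms(2,1)]
  by (subst sum.swap) (simp add: mult.commute)

text \<open>The square of the Hilbert-Schmidt norm.\<close>

definition frob :: "real Matrix.mat \<Rightarrow> real" where
  "frob A = (\<Sum>i<dim_row A. \<Sum>j<dim_col A. (A $$ (i, j))\<^sup>2)"

lemma frob_nonneg: "frob A \<ge> 0"
  unfolding frob_def by (intro sum_nonneg) auto

lemma mat_trace_mult_le_frob:
  assumes "A \<in> carrier_mat n n" "B \<in> carrier_mat n n"
  shows "\<bar>mat_trace (A * B)\<bar> \<le> sqrt (frob A) * sqrt (frob B)"
proof -
  let ?I = "{..<n} \<times> {..<n}"
  have "(mat_trace (A * B))\<^sup>2 = (\<Sum>(i, j)\<in>?I. A $$ (i, j) * B $$ (j, i))\<^sup>2"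
    unfolding mat_trace_mult[OF assms] by (simp add: sum.cartesian_product)
  also have "\<dots> \<le> (\<Sum>(i, j)\<in>?I. (A $$ (i, j))\<^sup>2) * (\<Sum>(i, j)\<in>?I. (B $$ (j, i))\<^sup>2)"
    using Cauchy_Schwarz_ineq_sum[of "\<lambda>(i, j). A $$ (i, j)" "\<lambda>(i, j). B $$ (j, i)" ?I]
    by (simp add: case_prod_beta)
  also have "(\<Sum>(i, j)\<in>?I. (A $$ (i, j))\<^sup>2) = frob A"
    using assms by (simp add: frob_def sum.cartesian_product)
  also have "(\<Sum>(i, j)\<in>?I. (B $$ (j, i))\<^sup>2) = (\<Sum>i<n. \<Sum>j<n. (B $$ (j, i))\<^sup>2)"
    by (simp add: sum.cartesian_product)
  also have "\<dots> = frob B"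
    using assms by (subst sum.swap) (simp add: frob_def)
  finally show ?thesis
    by (simp add: real_le_rsqrt real_sqrt_mult[symmetric] flip: real_sqrt_abs)
qed

text \<open>A bound on the operator norm rather than the norm itself, so that the root of a trace
  can serve as \<open>l\<close>. Vectors are functions of which only the first \<open>n\<close>
  values enter.\<close>

definition op_bound :: "nat \<Rightarrow> real \<Rightarrow> real Matrix.mat \<Rightarrow> bool" where
  "op_bound n l A \<longleftrightarrow> l \<ge> 0 \<and> (\<forall>v. (\<Sum>i<n. (\<Sum>j<n. A $$ (i, j) * v j)\<^sup>2) \<le> l\<^sup>2 * (\<Sum>j<n. (v j)\<^sup>2))"

lemma op_boundD:
  "op_bound n l A \<Longrightarrow> (\<Sum>i<n. (\<Sum>j<n. A $$ (i, j) * v j)\<^sup>2) \<le> l\<^sup>2 * (\<Sum>j<n. (v j)\<^sup>2)"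
  unfolding op_bound_def by blast

lemma frob_mult_le:
  assumes A: "A \<in> carrier_mat n n" and M: "M \<in> carrier_mat n n" and l: "op_bound n l A"
  shows "frob (A * M) \<le> l\<^sup>2 * frob M"
proof -
  have "frob (A * M) = (\<Sum>k<n. \<Sum>i<n. (\<Sum>j<n. A $$ (i, j) * M $$ (j, k))\<^sup>2)"
    using A M by (subst sum.swap) (simp add: frob_def mult_mat_index_sum[of _ n] del: index_mult_mat(1))
  also have "\<dots> \<le> (\<Sum>k<n. l\<^sup>2 * (\<Sum>j<n. (M $$ (j, k))\<^sup>2))"
    by (intro sum_mono op_boundD[OF l])
  also have "\<dots> = l\<^sup>2 * (\<Sum>j<n. \<Sum>k<n. (M $$ (j, k))\<^sup>2)"
    unfolding sum_distrib_left by (rule sum.swap)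
  also have "\<dots> = l\<^sup>2 * frob M" using M by (simp add: frob_def)
  finally show ?thesis .
qed

lemma frob_pow_mult_le:
  assumes A: "A \<in> carrier_mat n n" and l: "op_bound n l A"
  shows "M \<in> carrier_mat n n \<Longrightarrow> frob (A ^\<^sub>m r * M) \<le> (l ^ r)\<^sup>2 * frob M"
proof (induction r arbitrary: M)
  case 0
  then show ?case using A by simp
next
  case (Suc r)
  have "A ^\<^sub>m Suc r * M = A ^\<^sub>m r * (A * M)"
    using A Suc.prems by (simp, intro assoc_mult_mat[of _ n n _ n _ n]) auto
  also have "frob \<dots> \<le> (l ^ r)\<^sup>2 * frob (A * M)"
    using A Suc.prems by (intro Suc.IH) auto
  also have "\<dots> \<le> (l ^ r)\<^sup>2 * (l\<^sup>2 * frob M)"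
    by (intro mult_left_mono frob_mult_le[OF A Suc.prems l]) auto
  finally show ?case by (simp add: power_mult_distrib mult_ac)
qed

lemma frob_one: "frob (1\<^sub>m n) = real n"
  by (simp add: frob_def sum.If_cases if_distrib[of "\<lambda>x. x\<^sup>2"] cong: if_cong)

lemma frob_pow_le:
  assumes A: "A \<in> carrier_mat n n" and l: "op_bound n l A"
  shows "frob (A ^\<^sub>m r) \<le> (l ^ r)\<^sup>2 * real n"
  using frob_pow_mult_le[OF assms, of "1\<^sub>m n" r] A by (simp add: frob_one)

text \<open>Here the Toeplitz structure enters: in row \<open>a\<close> the lag \<open>s\<close> can
  occur only in the columns \<open>a - s\<close> and \<open>a + s\<close>.\<close>

lemma
  fixes g :: "nat \<Rightarrow> real"
  assumes "a < n"
  shows sum_abs_diff: "(\<Sum>b<n. g (nat \<bar>int a - int b\<bar>)) =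
     (\<Sum>s<n. real (card {b. b < n \<and> nat \<bar>int a - int b\<bar> = s}) * g s)"
    and card_abs_diff_le: "card {b. b < n \<and> nat \<bar>int a - int b\<bar> = s} \<le> 2"
proof -
  have "(\<Sum>s<n. sum (\<lambda>b. g (nat \<bar>int a - int b\<bar>)) {b \<in> {..<n}. nat \<bar>int a - int b\<bar> = s}) =
    (\<Sum>b<n. g (nat \<bar>int a - int b\<bar>))"
    using assms by (intro sum.group) auto
  then show "(\<Sum>b<n. g (nat \<bar>int a - int b\<bar>)) =
     (\<Sum>s<n. real (card {b. b < n \<and> nat \<bar>int a - int b\<bar> = s}) * g s)"
    by simp
  have "card {b. b < n \<and> nat \<bar>int a - int b\<bar> = s} \<le> card {a - s, a + s}"
    by (intro card_mono) auto
  also have "\<dots> \<le> 2" by (simp add: card_insert_if)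
  finally show "card {b. b < n \<and> nat \<bar>int a - int b\<bar> = s} \<le> 2" .
qed

text \<open>Each row carries every entry at most twice, and the \<open>n\<close> rows cancel the
  normalisation \<open>1 / n\<close>.\<close>

lemma frob_toeplitz_le: "frob (toeplitz n v) \<le> 2 * (\<Sum>j<n. (v j)\<^sup>2)"
proof -
  have row: "(\<Sum>b<n. (v (nat \<bar>int a - int b\<bar>))\<^sup>2) \<le> 2 * (\<Sum>j<n. (v j)\<^sup>2)" if "a < n" for a
    unfolding sum_abs_diff[OF that, of "\<lambda>s. (v s)\<^sup>2"] sum_distrib_left
  proof (intro sum_mono mult_right_mono)
    fix s show "real (card {b. b < n \<and> nat \<bar>int a - int b\<bar> = s}) \<le> 2"
      using card_abs_diff_le[OF that, of s] by simp
  qed auto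
  have "frob (toeplitz n v) = (\<Sum>a<n. (\<Sum>b<n. (v (nat \<bar>int a - int b\<bar>))\<^sup>2) / real n)"
    by (simp add: frob_def toeplitz_index power_divide sum_divide_distrib)
  also have "\<dots> \<le> (\<Sum>a<n. (2 * (\<Sum>j<n. (v j)\<^sup>2)) / real n)"
    using row by (intro sum_mono divide_right_mono) auto
  also have "\<dots> \<le> 2 * (\<Sum>j<n. (v j)\<^sup>2)" by simp
  finally show ?thesis .
qed

text \<open>\<open>\<parallel>Mv\<parallel>\<^sup>2 = \<langle>v, M\<^sup>2v\<rangle> \<le> \<parallel>v\<parallel> \<parallel>M\<^sup>2v\<parallel>\<close>, iterated with
  \<open>M\<^sup>2\<close> in place of \<open>M\<close>; the iteration ends with the Hilbert-Schmidt norm.\<close>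

lemma symmetric_op_bound_trace:
  fixes M :: "real Matrix.mat"
  assumes "M \<in> carrier_mat n n" "\<And>i j. i < n \<Longrightarrow> j < n \<Longrightarrow> M $$ (i, j) = M $$ (j, i)"
  shows "(\<Sum>i<n. (\<Sum>j<n. M $$ (i, j) * v j)\<^sup>2) ^ (2 ^ k)
     \<le> (\<Sum>j<n. (v j)\<^sup>2) ^ (2 ^ k) * mat_trace (M ^\<^sub>m (2 ^ Suc k))"
  using assms
proof (induction k arbitrary: M)
  case 0
  have "(\<Sum>i<n. (\<Sum>j<n. M $$ (i, j) * v j)\<^sup>2) \<le> (\<Sum>i<n. (\<Sum>j<n. (M $$ (i, j))\<^sup>2) * (\<Sum>j<n. (v j)\<^sup>2))"
    by (intro sum_mono Cauchy_Schwarz_ineq_sum)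
  also have "\<dots> = (\<Sum>j<n. (v j)\<^sup>2) * (\<Sum>i<n. \<Sum>j<n. M $$ (i, j) * M $$ (j, i))"
    using 0 by (simp add: sum_distrib_left sum_distrib_right power2_eq_square mult_ac)
  also have "(\<Sum>i<n. \<Sum>j<n. M $$ (i, j) * M $$ (j, i)) = mat_trace (M * M)"
    using 0 by (simp add: mat_trace_mult[of _ n])
  also have "M * M = M ^\<^sub>m 2" using 0 by (simp add: numeral_2_eq_2)
  finally show ?case by (simp add: numeral_2_eq_2)
next
  case (Suc k)
  define u where "u i = (\<Sum>j<n. M $$ (i, j) * v j)" for i
  define w where "w i = (\<Sum>j<n. (M * M) $$ (i, j) * v j)" for i
  define N where "N = (\<Sum>j<n. (v j)\<^sup>2)"
  have N0: "0 \<le> N" by (simp add: N_def sum_nonneg)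
  have wu: "w i = (\<Sum>j<n. M $$ (i, j) * u j)" if "i < n" for i
  proof -
    have "w i = (\<Sum>j<n. \<Sum>k<n. M $$ (i, k) * (M $$ (k, j) * v j))"
      using Suc.prems that by (simp add: w_def mult_mat_index_sum[of _ n] sum_distrib_left sum_distrib_right mult_ac del: index_mult_mat(1))
    also have "\<dots> = (\<Sum>k<n. M $$ (i, k) * u k)"
      unfolding u_def sum_distrib_left by (rule sum.swap)
    finally show ?thesis .
  qed
  have "(\<Sum>i<n. (u i)\<^sup>2) = (\<Sum>i<n. \<Sum>j<n. u i * (M $$ (i, j) * v j))"
    unfolding power2_eq_square by (subst (2) u_def) (simp add: sum_distrib_left)
  also have "\<dots> = (\<Sum>j<n. \<Sum>i<n. v j * (M $$ (j, i) * u i))"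
    using Suc.prems by (subst sum.swap) (simp add: mult_ac)
  also have "\<dots> = (\<Sum>j<n. v j * w j)" by (simp add: wu sum_distrib_left)
  finally have uv: "(\<Sum>i<n. (u i)\<^sup>2) = (\<Sum>j<n. v j * w j)" .
  have "(\<Sum>i<n. (u i)\<^sup>2)\<^sup>2 \<le> N * (\<Sum>j<n. (w j)\<^sup>2)"
    unfolding uv N_def by (rule Cauchy_Schwarz_ineq_sum)
  then have "((\<Sum>i<n. (u i)\<^sup>2)\<^sup>2) ^ (2 ^ k) \<le> (N * (\<Sum>j<n. (w j)\<^sup>2)) ^ (2 ^ k)"
    by (intro power_mono) auto
  also have "\<dots> = N ^ (2 ^ k) * (\<Sum>j<n. (w j)\<^sup>2) ^ (2 ^ k)" by (rule power_mult_distrib)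
  also have "\<dots> \<le> N ^ (2 ^ k) * (N ^ (2 ^ k) * mat_trace ((M * M) ^\<^sub>m (2 ^ Suc k)))"
  proof (intro mult_left_mono)
    show "(\<Sum>j<n. (w j)\<^sup>2) ^ (2 ^ k) \<le> N ^ (2 ^ k) * mat_trace ((M * M) ^\<^sub>m (2 ^ Suc k))"
      unfolding w_def N_def
    proof (rule Suc.IH)
      show "M * M \<in> carrier_mat n n" using Suc.prems by auto
      fix i j assume "i < n" "j < n"
      then show "(M * M) $$ (i, j) = (M * M) $$ (j, i)"
        using Suc.prems by (simp add: mult_mat_index_sum[of _ n] mult.commute del: index_mult_mat(1))
    qed
  qed (simp add: N0)
  also have "\<dots> = N ^ (2 ^ Suc k) * mat_trace (M ^\<^sub>m (2 ^ Suc (Suc k)))"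
    unfolding pow_mat_square[OF Suc.prems(1)] by (simp add: power_add[symmetric] mult_2)
  finally show ?case by (simp add: u_def N_def power_mult[symmetric])
qed

text \<open>Apply \<open>symmetric_op_bound_trace\<close> to the first unit vector: the trace
  dominates a power of a sum of squares.\<close>

lemma mat_trace_even_power_nonneg:
  fixes M :: "real Matrix.mat"
  assumes "M \<in> carrier_mat n n" "\<And>i j. i < n \<Longrightarrow> j < n \<Longrightarrow> M $$ (i, j) = M $$ (j, i)"
  shows "0 \<le> mat_trace (M ^\<^sub>m (2 ^ Suc k))"
proof (cases "n = 0")
  case True
  then show ?thesis using assms by (simp add: mat_trace_def)
next
  case False
  have "(\<Sum>i<n. (\<Sum>j<n. M $$ (i, j) * of_bool (j = 0))\<^sup>2) ^ (2 ^ k)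
     \<le> (\<Sum>j<n. (of_bool (j = 0))\<^sup>2) ^ (2 ^ k) * mat_trace (M ^\<^sub>m (2 ^ Suc k))"
    by (rule symmetric_op_bound_trace[OF assms])
  also have "(\<Sum>j<n. (of_bool (j = 0) :: real)\<^sup>2) = 1"
    using False by (simp add: power2_eq_square flip: of_bool_conj)
  finally have "(\<Sum>i<n. (\<Sum>j<n. M $$ (i, j) * of_bool (j = 0))\<^sup>2) ^ (2 ^ k) \<le> mat_trace (M ^\<^sub>m (2 ^ Suc k))"
    by simp
  moreover have "0 \<le> (\<Sum>i<n. (\<Sum>j<n. M $$ (i, j) * of_bool (j = 0))\<^sup>2) ^ (2 ^ k)"
    by (intro zero_le_power sum_nonneg zero_le_power2)
  ultimately show ?thesis by linarith
qed

lemma toeplitz_op_bound: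
  "op_bound n (root (2 ^ Suc k) (mat_trace (toeplitz n x ^\<^sub>m (2 ^ Suc k)))) (toeplitz n x)"
  unfolding op_bound_def
proof (intro conjI allI)
  define q :: nat where "q = 2 ^ Suc k"
  define t where "t = mat_trace (toeplitz n x ^\<^sub>m q)"
  have t0: "0 \<le> t" unfolding t_def q_def
    by (intro mat_trace_even_power_nonneg[of _ n] toeplitz_sym) auto
  then show "0 \<le> root (2 ^ Suc k) (mat_trace (toeplitz n x ^\<^sub>m (2 ^ Suc k)))"
    by (simp add: t_def q_def)
  fix v :: "nat \<Rightarrow> real"
  have "((root q t)\<^sup>2) ^ (2 ^ k) = t"
    using t0 unfolding power_mult[symmetric] by (simp add: q_def)
  then have "(\<Sum>i<n. (\<Sum>j<n. toeplitz n x $$ (i, j) * v j)\<^sup>2) ^ (2 ^ k)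
     \<le> ((root q t)\<^sup>2 * (\<Sum>j<n. (v j)\<^sup>2)) ^ (2 ^ k)"
    using symmetric_op_bound_trace[of "toeplitz n x" n v k] toeplitz_sym
    unfolding power_mult_distrib by (simp add: t_def q_def mult.commute)
  then show "(\<Sum>i<n. (\<Sum>j<n. toeplitz n x $$ (i, j) * v j)\<^sup>2)
     \<le> (root (2 ^ Suc k) (mat_trace (toeplitz n x ^\<^sub>m (2 ^ Suc k))))\<^sup>2 * (\<Sum>j<n. (v j)\<^sup>2)"
    unfolding t_def q_def
    by (subst (asm) power_mono_iff) (auto intro!: mult_nonneg_nonneg sum_nonneg)
qed

section \<open>Derivatives of traces of Toeplitz powers\<close>

lemma pospoly_toeplitz_index:
  assumes "i < n" "j < n"
  shows "pospoly n (\<lambda>x. toeplitz n x $$ (i, j))"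
proof -
  have "pospoly n (\<lambda>x. (1 / sqrt (real n)) * x (nat \<bar>int i - int j\<bar>))"
    using assms by (intro pospoly_cmult pospoly_var toeplitz_diff_less) auto
  then show ?thesis by (simp add: toeplitz_index assms)
qed

lemma toeplitz_pow_Suc_index:
  assumes "a < n" "b < n"
  shows "(toeplitz n x ^\<^sub>m Suc k) $$ (a, b) = (\<Sum>c<n. (toeplitz n x ^\<^sub>m k) $$ (a, c) * toeplitz n x $$ (c, b))"
  using assms by (simp add: mult_mat_index_sum[of _ n] del: index_mult_mat(1))

lemma pospoly_toeplitz_pow:
  "a < n \<Longrightarrow> b < n \<Longrightarrow> pospoly n (\<lambda>x. (toeplitz n x ^\<^sub>m k) $$ (a, b))"
proof (induction k arbitrary: b)
  case 0
  then show ?case by (simp add: pospoly_const)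
next
  case (Suc k)
  show ?case unfolding toeplitz_pow_Suc_index[OF Suc.prems]
    by (intro pospoly_sum pospoly_mult pospoly_toeplitz_index Suc) auto
qed

lemma pospoly_mat_trace_toeplitz_pow: "pospoly n (\<lambda>x. mat_trace (toeplitz n x ^\<^sub>m k))"
  unfolding mat_trace_carrier[OF pow_carrier_mat[OF toeplitz_carrier]]
  by (intro pospoly_sum pospoly_toeplitz_pow) auto

text \<open>The derivative of \<open>toeplitz n x\<close> in \<open>x j\<close>; it is constant in
  \<open>x\<close> because \<open>toeplitz\<close> is linear, and its entries are
  nonnegative.\<close>

definition toeplitz_unit :: "nat \<Rightarrow> nat \<Rightarrow> real Matrix.mat" where
  "toeplitz_unit n j = toeplitz n (\<lambda>k. of_bool (j = k))"

lemma toeplitz_unit_carrier [simp]: "toeplitz_unit n j \<in> carrier_mat n n"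
  by (simp add: toeplitz_unit_def)

lemma toeplitz_unit_nonneg: "a < n \<Longrightarrow> b < n \<Longrightarrow> 0 \<le> toeplitz_unit n j $$ (a, b)"
  by (simp add: toeplitz_unit_def toeplitz_index)

lemma pd_toeplitz_index:
  assumes "a < n" "b < n"
  shows "pd j (\<lambda>x. toeplitz n x $$ (a, b)) = (\<lambda>_. toeplitz_unit n j $$ (a, b))"
proof -
  have "pd j (\<lambda>x. (1 / sqrt (real n)) * x (nat \<bar>int a - int b\<bar>)) =
      (\<lambda>x. (1 / sqrt (real n)) * pd j (\<lambda>x. x (nat \<bar>int a - int b\<bar>)) x)"
    using assms by (intro pd_cmult[of n] pospoly_var toeplitz_diff_less)
  then show ?thesis using assms by (simp add: toeplitz_index toeplitz_unit_def pd_var of_bool_def)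
qed

lemma sum_toeplitz_unit:
  assumes "a < n" "b < n"
  shows "(\<Sum>j<n. v j * toeplitz_unit n j $$ (a, b)) = toeplitz n v $$ (a, b)"
  using toeplitz_diff_less[OF assms] assms
  by (simp add: toeplitz_unit_def toeplitz_index sum_divide_distrib[symmetric])

text \<open>Leibniz rule for noncommuting factors; \<open>r\<close> is the number of factors to the
  left of the differentiated one.\<close>

lemma pd_toeplitz_pow:
  assumes "a < n" "b < n"
  shows "pd j (\<lambda>x. (toeplitz n x ^\<^sub>m k) $$ (a, b)) =
    (\<lambda>x. \<Sum>r<k. (toeplitz n x ^\<^sub>m r * toeplitz_unit n j * toeplitz n x ^\<^sub>m (k - 1 - r)) $$ (a, b))"
  using assms(2)
proof (induction k arbitrary: b)
  case 0
  then show ?case using assms by (simp add: pd_const)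
next
  case (Suc k)
  let ?T = "toeplitz n" and ?E = "toeplitz_unit n j"
  note pp = pospoly_toeplitz_pow[OF assms(1)] pospoly_toeplitz_index
  have "pd j (\<lambda>x. (?T x ^\<^sub>m Suc k) $$ (a, b)) x =
     (\<Sum>r<Suc k. (?T x ^\<^sub>m r * ?E * ?T x ^\<^sub>m (Suc k - 1 - r)) $$ (a, b))" for x
  proof -
    define T where "T = ?T x"
    have T: "T \<in> carrier_mat n n" by (simp add: T_def)
    have E: "?E \<in> carrier_mat n n" by simp
    have "pd j (\<lambda>x. (?T x ^\<^sub>m Suc k) $$ (a, b)) =
        (\<lambda>x. \<Sum>c<n. pd j (\<lambda>x. (?T x ^\<^sub>m k) $$ (a, c) * ?T x $$ (c, b)) x)"
      unfolding toeplitz_pow_Suc_index[OF assms(1) Suc.prems]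
      using Suc.prems by (intro pd_sum[of _ n] pospoly_mult pp) auto
    then have "pd j (\<lambda>x. (?T x ^\<^sub>m Suc k) $$ (a, b)) x =
        (\<Sum>c<n. pd j (\<lambda>x. (?T x ^\<^sub>m k) $$ (a, c) * ?T x $$ (c, b)) x)" by simp
    also have "\<dots> = (\<Sum>c<n. (\<Sum>r<k. (T ^\<^sub>m r * ?E * T ^\<^sub>m (k - 1 - r)) $$ (a, c)) * T $$ (c, b)
        + (T ^\<^sub>m k) $$ (a, c) * ?E $$ (c, b))"
    proof (intro sum.cong refl)
      fix c assume "c \<in> {..<n}"
      then have c: "c < n" by simp
      show "pd j (\<lambda>x. (?T x ^\<^sub>m k) $$ (a, c) * ?T x $$ (c, b)) x =
        (\<Sum>r<k. (T ^\<^sub>m r * ?E * T ^\<^sub>m (k - 1 - r)) $$ (a, c)) * T $$ (c, b) + (T ^\<^sub>m k) $$ (a, c) * ?E $$ (c, b)"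
        unfolding pd_mult[OF pp(1)[OF c] pp(2)[OF c Suc.prems]] pd_toeplitz_index[OF c Suc.prems] Suc.IH[OF c]
        by (simp add: T_def)
    qed
    also have "\<dots> = (\<Sum>r<k. \<Sum>c<n. (T ^\<^sub>m r * ?E * T ^\<^sub>m (k - 1 - r)) $$ (a, c) * T $$ (c, b))
        + (\<Sum>c<n. (T ^\<^sub>m k) $$ (a, c) * ?E $$ (c, b))"
      unfolding sum.distrib sum_distrib_right by (subst sum.swap) simp
    also have "(\<Sum>c<n. (T ^\<^sub>m k) $$ (a, c) * ?E $$ (c, b)) = (T ^\<^sub>m k * ?E) $$ (a, b)"
      using assms(1) Suc.prems T E by (intro mult_mat_index_sum[symmetric]) auto
    also have "T ^\<^sub>m k * ?E = T ^\<^sub>m k * ?E * T ^\<^sub>m 0"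
      using T E by (simp add: right_mult_one_mat[of _ n n] del: toeplitz_unit_carrier)
    also have "(\<Sum>r<k. \<Sum>c<n. (T ^\<^sub>m r * ?E * T ^\<^sub>m (k - 1 - r)) $$ (a, c) * T $$ (c, b)) =
        (\<Sum>r<k. (T ^\<^sub>m r * ?E * T ^\<^sub>m (k - r)) $$ (a, b))"
    proof (intro sum.cong refl)
      fix r assume "r \<in> {..<k}"
      then have r: "k - r = Suc (k - 1 - r)" by auto
      have "(\<Sum>c<n. (T ^\<^sub>m r * ?E * T ^\<^sub>m (k - 1 - r)) $$ (a, c) * T $$ (c, b)) =
          (T ^\<^sub>m r * ?E * T ^\<^sub>m (k - 1 - r) * T) $$ (a, b)"
        using assms(1) Suc.prems T E by (intro mult_mat_index_sum[symmetric]) (auto intro!: mult_carrier_mat)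
      also have "T ^\<^sub>m r * ?E * T ^\<^sub>m (k - 1 - r) * T = T ^\<^sub>m r * ?E * (T ^\<^sub>m (k - 1 - r) * T)"
        using T E by (intro assoc_mult_mat[of _ n n _ n _ n]) (auto intro!: mult_carrier_mat)
      finally show "(\<Sum>c<n. (T ^\<^sub>m r * ?E * T ^\<^sub>m (k - 1 - r)) $$ (a, c) * T $$ (c, b)) =
          (T ^\<^sub>m r * ?E * T ^\<^sub>m (k - r)) $$ (a, b)" unfolding r by simp
    qed
    finally show ?thesis by (simp add: T_def)
  qed
  then show ?case by blast
qed

lemma pd_mat_trace_toeplitz_pow:
  "pd j (\<lambda>x. mat_trace (toeplitz n x ^\<^sub>m k)) =
    (\<lambda>x. real k * mat_trace (toeplitz n x ^\<^sub>m (k - 1) * toeplitz_unit n j))"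
proof
  fix x
  define T where "T = toeplitz n x"
  have T: "T \<in> carrier_mat n n" by (simp add: T_def)
  let ?E = "toeplitz_unit n j"
  have E: "?E \<in> carrier_mat n n" by simp
  have "pd j (\<lambda>x. mat_trace (toeplitz n x ^\<^sub>m k)) = (\<lambda>x. \<Sum>a<n. pd j (\<lambda>x. (toeplitz n x ^\<^sub>m k) $$ (a, a)) x)"
    unfolding mat_trace_carrier[OF pow_carrier_mat[OF toeplitz_carrier]]
    by (intro pd_sum[of _ n] pospoly_toeplitz_pow) auto
  then have "pd j (\<lambda>x. mat_trace (toeplitz n x ^\<^sub>m k)) x =
      (\<Sum>a<n. \<Sum>r<k. (T ^\<^sub>m r * ?E * T ^\<^sub>m (k - 1 - r)) $$ (a, a))"
    by (simp add: pd_toeplitz_pow T_def)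
  also have "\<dots> = (\<Sum>r<k. mat_trace (T ^\<^sub>m r * ?E * T ^\<^sub>m (k - 1 - r)))"
    using T E by (subst sum.swap) (simp add: mat_trace_carrier[of _ n n] mult_carrier_mat[of _ n n _ n] del: index_mult_mat(1))
  \<comment> \<open>Cyclicity of the trace makes the summand independent of the position
    \<open>r\<close>.\<close>
  also have "\<dots> = (\<Sum>r<k. mat_trace (T ^\<^sub>m (k - 1) * ?E))"
  proof (intro sum.cong refl)
    fix r assume "r \<in> {..<k}"
    then have r: "k - 1 - r + r = k - 1" by auto
    have "mat_trace (T ^\<^sub>m r * ?E * T ^\<^sub>m (k - 1 - r)) = mat_trace (T ^\<^sub>m (k - 1 - r) * (T ^\<^sub>m r * ?E))"
      using T E by (intro mat_trace_mult_comm[of _ n]) (auto intro!: mult_carrier_mat)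
    also have "T ^\<^sub>m (k - 1 - r) * (T ^\<^sub>m r * ?E) = T ^\<^sub>m (k - 1 - r) * T ^\<^sub>m r * ?E"
      using T E by (intro assoc_mult_mat[symmetric, of _ n n _ n _ n]) auto
    also have "T ^\<^sub>m (k - 1 - r) * T ^\<^sub>m r = T ^\<^sub>m (k - 1)"
      using pow_mat_add[OF T, of "k - 1 - r" r] r by simp
    finally show "mat_trace (T ^\<^sub>m r * ?E * T ^\<^sub>m (k - 1 - r)) = mat_trace (T ^\<^sub>m (k - 1) * ?E)" .
  qed
  finally show "pd j (\<lambda>x. mat_trace (toeplitz n x ^\<^sub>m k)) x =
      real k * mat_trace (toeplitz n x ^\<^sub>m (k - 1) * ?E)" by (simp add: T_def)
qed

lemma pospoly_mat_trace_mult_unit: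
  "pospoly n (\<lambda>x. mat_trace (toeplitz n x ^\<^sub>m k * toeplitz_unit n j))"
  unfolding mat_trace_mult[OF pow_carrier_mat[OF toeplitz_carrier] toeplitz_unit_carrier]
  by (intro pospoly_sum pospoly_mult pospoly_toeplitz_pow pospoly_const toeplitz_unit_nonneg) auto

lemma pd_pd_mat_trace_toeplitz_pow:
  "pd i (pd j (\<lambda>x. mat_trace (toeplitz n x ^\<^sub>m k))) =
    (\<lambda>x. real k * (\<Sum>r<k-1. mat_trace (toeplitz n x ^\<^sub>m r * toeplitz_unit n i *
        toeplitz n x ^\<^sub>m (k - 2 - r) * toeplitz_unit n j)))"
proof
  fix x
  let ?T = "toeplitz n" and ?E = "toeplitz_unit n"
  note c = pow_carrier_mat[OF toeplitz_carrier]
  have "pd i (\<lambda>x. mat_trace (?T x ^\<^sub>m (k - 1) * ?E j)) =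
      (\<lambda>x. \<Sum>a<n. pd i (\<lambda>x. \<Sum>b<n. (?T x ^\<^sub>m (k - 1)) $$ (a, b) * ?E j $$ (b, a)) x)"
    unfolding mat_trace_mult[OF c toeplitz_unit_carrier]
    by (intro pd_sum[of _ n] pospoly_sum pospoly_mult pospoly_toeplitz_pow pospoly_const toeplitz_unit_nonneg) auto
  also have "\<dots> = (\<lambda>x. \<Sum>a<n. \<Sum>b<n. pd i (\<lambda>x. (?T x ^\<^sub>m (k - 1)) $$ (a, b) * ?E j $$ (b, a)) x)"
    by (intro ext sum.cong refl fun_cong[OF pd_sum[of _ n]] pospoly_mult pospoly_toeplitz_pow pospoly_const toeplitz_unit_nonneg) auto
  also have "\<dots> = (\<lambda>x. \<Sum>a<n. \<Sum>b<n. (\<Sum>r<k-1. (?T x ^\<^sub>m r * ?E i * ?T x ^\<^sub>m (k - 1 - 1 - r)) $$ (a, b)) * ?E j $$ (b, a))"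
  proof (intro ext sum.cong refl)
    fix x a b assume "a \<in> {..<n}" "b \<in> {..<n}"
    then have ab: "a < n" "b < n" by auto
    show "pd i (\<lambda>x. (?T x ^\<^sub>m (k - 1)) $$ (a, b) * ?E j $$ (b, a)) x =
        (\<Sum>r<k-1. (?T x ^\<^sub>m r * ?E i * ?T x ^\<^sub>m (k - 1 - 1 - r)) $$ (a, b)) * ?E j $$ (b, a)"
      using pd_cmult[OF pospoly_toeplitz_pow[OF ab], of i "?E j $$ (b, a)" "k - 1"]
      by (simp add: mult.commute[of _ "?E j $$ (b, a)"] pd_toeplitz_pow[OF ab])
  qed
  also have "\<dots> = (\<lambda>x. \<Sum>r<k-1. \<Sum>a<n. \<Sum>b<n. (?T x ^\<^sub>m r * ?E i * ?T x ^\<^sub>m (k - 1 - 1 - r)) $$ (a, b) * ?E j $$ (b, a))"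
    unfolding sum_distrib_right
    by (intro ext trans[OF sum.cong[OF refl sum.swap] sum.swap])
  also have "\<dots> = (\<lambda>x. \<Sum>r<k-1. mat_trace (?T x ^\<^sub>m r * ?E i * ?T x ^\<^sub>m (k - 2 - r) * ?E j))"
  proof (intro ext sum.cong refl)
    fix x r
    have m: "?T x ^\<^sub>m r * ?E i * ?T x ^\<^sub>m (k - 2 - r) \<in> carrier_mat n n"
      using c toeplitz_unit_carrier by (intro mult_carrier_mat)
    have e: "k - 1 - 1 - r = k - 2 - r" by simp
    show "(\<Sum>a<n. \<Sum>b<n. (?T x ^\<^sub>m r * ?E i * ?T x ^\<^sub>m (k - 1 - 1 - r)) $$ (a, b) * ?E j $$ (b, a)) =
      mat_trace (?T x ^\<^sub>m r * ?E i * ?T x ^\<^sub>m (k - 2 - r) * ?E j)"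
      unfolding e mat_trace_mult[OF m toeplitz_unit_carrier] ..
  qed
  finally show "pd i (pd j (\<lambda>x. mat_trace (?T x ^\<^sub>m k))) x =
     real k * (\<Sum>r<k-1. mat_trace (?T x ^\<^sub>m r * ?E i * ?T x ^\<^sub>m (k - 2 - r) * ?E j))"
    unfolding pd_mat_trace_toeplitz_pow pd_cmult[OF pospoly_mat_trace_mult_unit] by simp
qed

text \<open>Pairing a gradient with a vector \<open>v\<close> gives a single trace against the
  Toeplitz matrix of \<open>v\<close>, whose Hilbert-Schmidt norm is controlled by
  \<open>\<parallel>v\<parallel>\<close>. The estimates below take for \<open>v\<close> the very
  vector to be bounded.\<close>

lemma sum_mat_trace_toeplitz_unit:
  assumes "A \<in> carrier_mat n n"
  shows "(\<Sum>j<n. v j * mat_trace (A * toeplitz_unit n j)) = mat_trace (A * toeplitz n v)"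
proof -
  have "(\<Sum>j<n. v j * mat_trace (A * toeplitz_unit n j)) =
    (\<Sum>a<n. \<Sum>b<n. A $$ (a, b) * (\<Sum>j<n. v j * toeplitz_unit n j $$ (b, a)))"
    unfolding mat_trace_mult[OF assms toeplitz_unit_carrier] sum_distrib_left
    by (rule trans[OF sum.swap sum.cong[OF refl trans[OF sum.swap sum.cong[OF refl]]]])
       (simp add: mult_ac)
  also have "\<dots> = mat_trace (A * toeplitz n v)"
    unfolding mat_trace_mult[OF assms toeplitz_carrier] by (intro sum.cong refl) (simp add: sum_toeplitz_unit)
  finally show ?thesis .
qed

lemma sum_mat_trace_toeplitz_unit2:
  assumes "A \<in> carrier_mat n n" "B \<in> carrier_mat n n"
  shows "(\<Sum>i<n. \<Sum>j<n. u i * v j * mat_trace (A * toeplitz_unit n i * B * toeplitz_unit n j)) =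
     mat_trace (A * toeplitz n u * B * toeplitz n v)"
proof -
  have 1: "(\<Sum>j<n. u i * v j * mat_trace (A * toeplitz_unit n i * B * toeplitz_unit n j)) =
      u i * mat_trace (A * toeplitz_unit n i * B * toeplitz n v)" for i
  proof -
    have "A * toeplitz_unit n i * B \<in> carrier_mat n n"
      using assms toeplitz_unit_carrier by (intro mult_carrier_mat)
    from sum_mat_trace_toeplitz_unit[OF this, of v] show ?thesis
      by (simp add: sum_distrib_left[symmetric] mult.assoc)
  qed
  have cyc: "mat_trace (A * M * B * toeplitz n v) = mat_trace (B * toeplitz n v * A * M)"
    if M: "M \<in> carrier_mat n n" for M
  proof -
    have c: "A * M \<in> carrier_mat n n" "B * toeplitz n v \<in> carrier_mat n n"
      using assms M by (auto intro!: mult_carrier_mat)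
    have "A * M * B * toeplitz n v = A * M * (B * toeplitz n v)"
      using c assms by (intro assoc_mult_mat[of _ n n _ n _ n]) auto
    also have "mat_trace \<dots> = mat_trace (B * toeplitz n v * (A * M))"
      by (rule mat_trace_mult_comm[OF c])
    also have "B * toeplitz n v * (A * M) = B * toeplitz n v * A * M"
      using c assms M by (intro assoc_mult_mat[symmetric, of _ n n _ n _ n]) auto
    finally show ?thesis .
  qed
  have "B * toeplitz n v * A \<in> carrier_mat n n" using assms by (auto intro!: mult_carrier_mat)
  from sum_mat_trace_toeplitz_unit[OF this, of u] show ?thesis
    by (simp add: 1 cyc)
qed

section \<open>Gradient, Hessian and moment bounds\<close>

text \<open>A coefficient sequence with a separate degree covers both a single power whose exponent
  varies with \<open>n\<close> and a fixed polynomial.\<close>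

definition trace_poly :: "nat \<Rightarrow> (nat \<Rightarrow> real) \<Rightarrow> nat \<Rightarrow> (nat \<Rightarrow> real) \<Rightarrow> real" where
  "trace_poly n c d x = (\<Sum>k\<le>d. c k * mat_trace (toeplitz n x ^\<^sub>m k))"

lemma sqrt_frob_pow_mult_le:
  assumes "A \<in> carrier_mat n n" "op_bound n l A" "M \<in> carrier_mat n n"
  shows "sqrt (frob (A ^\<^sub>m r * M)) \<le> l ^ r * sqrt (frob M)"
proof -
  have "l \<ge> 0" using assms(2) by (simp add: op_bound_def)
  then show ?thesis
    using real_sqrt_le_mono[OF frob_pow_mult_le[OF assms, of r]] by (simp add: real_sqrt_mult)
qed

lemma sqrt_frob_toeplitz_le: "sqrt (frob (toeplitz n v)) \<le> sqrt 2 * sqrt (\<Sum>j<n. (v j)\<^sup>2)"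
  using real_sqrt_le_mono[OF frob_toeplitz_le[of n v]] by (simp add: real_sqrt_mult)

text \<open>Closes the duality arguments: there \<open>N\<close> is the square of a norm, written as
  a pairing of a vector with itself and bounded linearly in the norm.\<close>

lemma le_mult_sqrt_imp_le_square:
  fixes N K :: real
  assumes "N \<le> K * sqrt N" "0 \<le> N" "0 \<le> K"
  shows "N \<le> K\<^sup>2"
proof (cases "N = 0")
  case False
  then have p: "0 < sqrt N" using assms by simp
  have "sqrt N * sqrt N \<le> K * sqrt N" using assms by simp
  then have "sqrt N \<le> K" using p by (rule mult_right_le_imp_le)
  then have "(sqrt N)\<^sup>2 \<le> K\<^sup>2" using p by (intro power_mono) auto
  then show ?thesis using assms by simp
qed simp

context
  fixes n d :: nat and c :: "nat \<Rightarrow> real"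
  assumes c: "\<And>k. 0 \<le> c k"
begin

lemma pospoly_trace_poly: "pospoly n (trace_poly n c d)"
  unfolding trace_poly_def[abs_def]
  by (intro pospoly_sum pospoly_cmult pospoly_mat_trace_toeplitz_pow c)

lemma pd_trace_poly:
  "pd j (trace_poly n c d) = (\<lambda>x. \<Sum>k\<le>d. c k * (real k * mat_trace (toeplitz n x ^\<^sub>m (k - 1) * toeplitz_unit n j)))"
proof -
  have "pd j (trace_poly n c d) = (\<lambda>x. \<Sum>k\<le>d. pd j (\<lambda>x. c k * mat_trace (toeplitz n x ^\<^sub>m k)) x)"
    unfolding trace_poly_def[abs_def]
    by (intro pd_sum[of _ n] pospoly_cmult pospoly_mat_trace_toeplitz_pow c)
  then show ?thesis
    by (simp add: pd_cmult[OF pospoly_mat_trace_toeplitz_pow] pd_mat_trace_toeplitz_pow)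
qed

lemma pd_pd_trace_poly:
  "pd i (pd j (trace_poly n c d)) = (\<lambda>x. \<Sum>k\<le>d. c k * (real k * (\<Sum>r<k-1. mat_trace (toeplitz n x ^\<^sub>m r * toeplitz_unit n i *
        toeplitz n x ^\<^sub>m (k - 2 - r) * toeplitz_unit n j))))"
proof -
  note p = pospoly_pd[OF pospoly_mat_trace_toeplitz_pow]
  have "pd j (trace_poly n c d) = (\<lambda>x. \<Sum>k\<le>d. c k * pd j (\<lambda>x. mat_trace (toeplitz n x ^\<^sub>m k)) x)"
    unfolding pd_trace_poly pd_mat_trace_toeplitz_pow ..
  then have "pd i (pd j (trace_poly n c d)) = (\<lambda>x. \<Sum>k\<le>d. pd i (\<lambda>x. c k * pd j (\<lambda>x. mat_trace (toeplitz n x ^\<^sub>m k)) x) x)"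
    using c by (simp only:) (intro pd_sum[of _ n] pospoly_cmult p, auto)
  then show ?thesis
    by (simp only: pd_cmult[OF p] pd_pd_mat_trace_toeplitz_pow)
qed

text \<open>Pair the gradient \<open>g\<close> with itself. Cauchy-Schwarz for the trace leaves the
  Hilbert-Schmidt norms of \<open>T ^\<^sub>m (k - 1)\<close>, at most
  \<open>l ^ (k - 1) * sqrt n\<close>, and of \<open>toeplitz n g\<close>.\<close>

lemma grad_trace_poly_le:
  assumes l: "op_bound n l (toeplitz n x)"
  shows "(\<Sum>j<n. (pd j (trace_poly n c d) x)\<^sup>2) \<le> 2 * real n * (\<Sum>k\<le>d. c k * real k * l ^ (k - 1))\<^sup>2"
proof -
  have l0: "0 \<le> l" using l by (simp add: op_bound_def)
  define T where "T = toeplitz n x"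
  have T: "T \<in> carrier_mat n n" by (simp add: T_def)
  define g where "g j = pd j (trace_poly n c d) x" for j
  define N where "N = (\<Sum>j<n. (g j)\<^sup>2)"
  define K where "K = (\<Sum>k\<le>d. c k * real k * l ^ (k - 1))"
  have N0: "0 \<le> N" unfolding N_def by (intro sum_nonneg) auto
  have K0: "0 \<le> K" unfolding K_def using c l0 by (intro sum_nonneg mult_nonneg_nonneg) auto
  have tr: "mat_trace (T ^\<^sub>m (k - 1) * toeplitz n g) \<le> l ^ (k - 1) * sqrt (real n) * (sqrt 2 * sqrt N)" for k
  proof -
    have "mat_trace (T ^\<^sub>m (k - 1) * toeplitz n g) \<le> sqrt (frob (T ^\<^sub>m (k - 1))) * sqrt (frob (toeplitz n g))"
      using T by (intro order_trans[OF abs_ge_self mat_trace_mult_le_frob[of _ n]]) auto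
    also have "\<dots> \<le> (l ^ (k - 1) * sqrt (real n)) * (sqrt 2 * sqrt N)"
    proof (intro mult_mono)
      show "sqrt (frob (T ^\<^sub>m (k - 1))) \<le> l ^ (k - 1) * sqrt (real n)"
        using real_sqrt_le_mono[OF frob_pow_le[OF T, of l "k - 1"]] l l0 by (simp add: real_sqrt_mult T_def)
      show "sqrt (frob (toeplitz n g)) \<le> sqrt 2 * sqrt N"
        unfolding N_def by (rule sqrt_frob_toeplitz_le)
    qed (use l0 in \<open>auto simp: frob_nonneg\<close>)
    finally show ?thesis .
  qed
  have "N = (\<Sum>j<n. g j * (\<Sum>k\<le>d. c k * (real k * mat_trace (T ^\<^sub>m (k - 1) * toeplitz_unit n j))))"
    unfolding N_def power2_eq_square by (subst (2) g_def) (simp add: pd_trace_poly T_def)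
  also have "\<dots> = (\<Sum>k\<le>d. c k * real k * (\<Sum>j<n. g j * mat_trace (T ^\<^sub>m (k - 1) * toeplitz_unit n j)))"
    unfolding sum_distrib_left
    by (rule trans[OF sum.swap]) (simp add: mult_ac)
  also have "\<dots> = (\<Sum>k\<le>d. c k * real k * mat_trace (T ^\<^sub>m (k - 1) * toeplitz n g))"
    using T by (simp add: sum_mat_trace_toeplitz_unit)
  also have "\<dots> \<le> (\<Sum>k\<le>d. c k * real k * (l ^ (k - 1) * sqrt (real n) * (sqrt 2 * sqrt N)))"
    using c by (intro sum_mono mult_left_mono tr) auto
  also have "\<dots> = (K * sqrt (real n) * sqrt 2) * sqrt N"
    unfolding K_def by (simp add: sum_distrib_left sum_distrib_right mult_ac)
  finally have "N \<le> (K * sqrt (real n) * sqrt 2)\<^sup>2"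
    using N0 K0 by (intro le_mult_sqrt_imp_le_square) auto
  then show ?thesis by (simp add: N_def K_def g_def power_mult_distrib mult_ac)
qed

text \<open>Pair \<open>z\<close>, the Hessian applied to \<open>g\<close>, with itself. Each trace
  splits into two halves containing one Toeplitz matrix each, of \<open>z\<close> and of
  \<open>g\<close>; the powers of \<open>T\<close> are taken out in operator norm. No factor
  \<open>n\<close> appears, in contrast to the gradient bound.\<close>

lemma hess_grad_trace_poly_le:
  assumes l: "op_bound n l (toeplitz n x)"
  shows "(\<Sum>j<n. (hess_grad n (trace_poly n c d) j x)\<^sup>2) \<le>
    4 * (\<Sum>k\<le>d. c k * real k * real (k - 1) * l ^ (k - 2))\<^sup>2 * (\<Sum>j<n. (pd j (trace_poly n c d) x)\<^sup>2)"
proof -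
  have l0: "0 \<le> l" using l by (simp add: op_bound_def)
  define T where "T = toeplitz n x"
  have T: "T \<in> carrier_mat n n" by (simp add: T_def)
  have lT: "op_bound n l T" using l by (simp add: T_def)
  define g where "g j = pd j (trace_poly n c d) x" for j
  define z where "z j = hess_grad n (trace_poly n c d) j x" for j
  define N where "N = (\<Sum>j<n. (g j)\<^sup>2)"
  define M where "M = (\<Sum>j<n. (z j)\<^sup>2)"
  define K where "K = (\<Sum>k\<le>d. c k * real k * real (k - 1) * l ^ (k - 2))"
  have N0: "0 \<le> N" "0 \<le> M" unfolding N_def M_def by (intro sum_nonneg; simp)+
  have K0: "0 \<le> K" unfolding K_def using c l0 by (intro sum_nonneg mult_nonneg_nonneg) auto
  have tr: "mat_trace (T ^\<^sub>m r * toeplitz n z * T ^\<^sub>m (k - 2 - r) * toeplitz n g) \<le> l ^ (k - 2) * (2 * sqrt M * sqrt N)"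
    if "r < k - 1" for r k
  proof -
    have "T ^\<^sub>m r * toeplitz n z * T ^\<^sub>m (k - 2 - r) * toeplitz n g =
       (T ^\<^sub>m r * toeplitz n z) * (T ^\<^sub>m (k - 2 - r) * toeplitz n g)"
      using T by (intro assoc_mult_mat[of _ n n _ n _ n]) (auto intro!: mult_carrier_mat)
    also have "mat_trace \<dots> \<le> sqrt (frob (T ^\<^sub>m r * toeplitz n z)) * sqrt (frob (T ^\<^sub>m (k - 2 - r) * toeplitz n g))"
      using T by (intro order_trans[OF abs_ge_self mat_trace_mult_le_frob[of _ n]]) (auto intro!: mult_carrier_mat)
    also have "\<dots> \<le> (l ^ r * (sqrt 2 * sqrt M)) * (l ^ (k - 2 - r) * (sqrt 2 * sqrt N))"
    proof (intro mult_mono)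
      show "sqrt (frob (T ^\<^sub>m r * toeplitz n z)) \<le> l ^ r * (sqrt 2 * sqrt M)"
        unfolding M_def using l0
        by (intro order_trans[OF sqrt_frob_pow_mult_le[OF T lT toeplitz_carrier]] mult_left_mono sqrt_frob_toeplitz_le) auto
      show "sqrt (frob (T ^\<^sub>m (k - 2 - r) * toeplitz n g)) \<le> l ^ (k - 2 - r) * (sqrt 2 * sqrt N)"
        unfolding N_def using l0
        by (intro order_trans[OF sqrt_frob_pow_mult_le[OF T lT toeplitz_carrier]] mult_left_mono sqrt_frob_toeplitz_le) auto
    qed (use l0 N0 in \<open>auto simp: frob_nonneg\<close>)
    also have "\<dots> = l ^ (r + (k - 2 - r)) * ((sqrt 2 * sqrt 2) * sqrt M * sqrt N)"
      by (simp only: power_add mult_ac)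
    also have "r + (k - 2 - r) = k - 2" using that by simp
    finally show ?thesis by simp
  qed
  have "M = (\<Sum>j<n. \<Sum>i<n. z j * g i * pd j (pd i (trace_poly n c d)) x)"
    unfolding M_def power2_eq_square
    by (subst (2) z_def) (simp add: hess_grad_def g_def sum_distrib_left mult_ac)
  also have "\<dots> = (\<Sum>j<n. \<Sum>i<n. \<Sum>k\<le>d. \<Sum>r<k-1. c k * real k *
     (z j * g i * mat_trace (T ^\<^sub>m r * toeplitz_unit n j * T ^\<^sub>m (k - 2 - r) * toeplitz_unit n i)))"
    unfolding pd_pd_trace_poly by (simp add: sum_distrib_left T_def mult_ac)
  also have "\<dots> = (\<Sum>k\<le>d. \<Sum>r<k-1. \<Sum>j<n. \<Sum>i<n. c k * real k *
     (z j * g i * mat_trace (T ^\<^sub>m r * toeplitz_unit n j * T ^\<^sub>m (k - 2 - r) * toeplitz_unit n i)))"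
    by (rule trans[OF sum.cong[OF refl sum.swap] trans[OF sum.swap
        sum.cong[OF refl trans[OF sum.cong[OF refl sum.swap] sum.swap]]]])
  also have "\<dots> = (\<Sum>k\<le>d. \<Sum>r<k-1. c k * real k *
     mat_trace (T ^\<^sub>m r * toeplitz n z * T ^\<^sub>m (k - 2 - r) * toeplitz n g))"
    using T by (simp add: sum_distrib_left[symmetric] sum_mat_trace_toeplitz_unit2)
  also have "\<dots> \<le> (\<Sum>k\<le>d. \<Sum>r<k-1. c k * real k * (l ^ (k - 2) * (2 * sqrt M * sqrt N)))"
    using c by (intro sum_mono mult_left_mono tr) auto
  also have "\<dots> = (K * 2 * sqrt N) * sqrt M"
    unfolding K_def by (simp add: sum_distrib_left sum_distrib_right mult_ac)
  finally have "M \<le> (K * 2 * sqrt N)\<^sup>2"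
    using N0 K0 by (intro le_mult_sqrt_imp_le_square) auto
  then show ?thesis using N0 by (simp add: M_def N_def K_def g_def z_def power_mult_distrib mult_ac)
qed

lemma hess_grad_trace_poly_crude_le:
  assumes l: "op_bound n l (toeplitz n x)"
  shows "(\<Sum>j<n. (hess_grad n (trace_poly n c d) j x)\<^sup>2) \<le>
    8 * real n * (\<Sum>k\<le>d. c k) ^ 4 * real d ^ 6 * (1 + l) ^ (4 * d)"
proof -
  have l0: "0 \<le> l" using l by (simp add: op_bound_def)
  define S where "S = (\<Sum>k\<le>d. c k)"
  define K1 where "K1 = (\<Sum>k\<le>d. c k * real k * l ^ (k - 1))"
  define K2 where "K2 = (\<Sum>k\<le>d. c k * real k * real (k - 1) * l ^ (k - 2))"
  have pw: "l ^ j \<le> (1 + l) ^ d" if "j \<le> d" for j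
    using l0 that by (intro order_trans[OF power_mono[of l "1 + l"] power_increasing]) auto
  have K0: "0 \<le> K1" "0 \<le> K2"
    unfolding K1_def K2_def using c l0 by (intro sum_nonneg mult_nonneg_nonneg; simp)+
  have "K1 \<le> (\<Sum>k\<le>d. c k * real d * (1 + l) ^ d)"
    unfolding K1_def using c l0 by (intro sum_mono mult_mono pw) auto
  then have K1: "K1 \<le> S * real d * (1 + l) ^ d" by (simp add: S_def sum_distrib_right)
  have "K2 \<le> (\<Sum>k\<le>d. c k * real d * real d * (1 + l) ^ d)"
    unfolding K2_def using c l0 by (intro sum_mono mult_mono pw) auto
  then have K2: "K2 \<le> S * real d * real d * (1 + l) ^ d" by (simp add: S_def sum_distrib_right)
  have "(\<Sum>j<n. (hess_grad n (trace_poly n c d) j x)\<^sup>2) \<le> 4 * K2\<^sup>2 * (2 * real n * K1\<^sup>2)"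
    unfolding K2_def K1_def
    by (intro order_trans[OF hess_grad_trace_poly_le[OF l]] mult_left_mono grad_trace_poly_le[OF l]) auto
  also have "\<dots> \<le> 4 * (S * real d * real d * (1 + l) ^ d)\<^sup>2 * (2 * real n * (S * real d * (1 + l) ^ d)\<^sup>2)"
    using K0 by (intro mult_mono power_mono K1 K2) auto
  also have "\<dots> = 8 * real n * S ^ 4 * real d ^ 6 * ((1 + l) ^ d) ^ 4"
    by (simp add: power_mult_distrib power2_eq_square power4_eq_xxxx numeral_eq_Suc mult_ac)
  also have "((1 + l) ^ d) ^ 4 = (1 + l) ^ (4 * d)" by (simp add: power_mult[symmetric] mult.commute)
  finally show ?thesis by (simp add: S_def)
qed

end

section \<open>Moments of traces by coefficientwise domination\<close>

lemma pospoly_row_dominated: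
  assumes "a < n"
  shows "pospoly n (\<lambda>x. (\<Sum>s<n. (2 / sqrt (real n)) * x s) - (\<Sum>b<n. toeplitz n x $$ (a, b)))"
proof -
  define m where "m s = card {b. b < n \<and> nat \<bar>int a - int b\<bar> = s}" for s
  have "(\<Sum>s<n. (2 / sqrt (real n)) * x s) - (\<Sum>b<n. toeplitz n x $$ (a, b)) =
      (\<Sum>s<n. ((2 - real (m s)) / sqrt (real n)) * x s)" for x :: "nat \<Rightarrow> real"
  proof -
    have "(\<Sum>b<n. toeplitz n x $$ (a, b)) = (\<Sum>b<n. x (nat \<bar>int a - int b\<bar>)) / sqrt (real n)"
      using assms by (simp add: toeplitz_index sum_divide_distrib)
    then have e: "(\<Sum>b<n. toeplitz n x $$ (a, b)) = (\<Sum>s<n. real (m s) * x s / sqrt (real n))"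
      unfolding sum_abs_diff[OF assms, of x] m_def[symmetric] sum_divide_distrib .
    show ?thesis
      unfolding e sum_subtractf[symmetric]
      by (simp add: left_diff_distrib diff_divide_distrib)
  qed
  moreover have "pospoly n (\<lambda>x. \<Sum>s<n. ((2 - real (m s)) / sqrt (real n)) * x s)"
    using card_abs_diff_le[OF assms] unfolding m_def
    by (intro pospoly_sum pospoly_cmult pospoly_var) (auto intro!: divide_nonneg_nonneg)
  ultimately show ?thesis by simp
qed

text \<open>Dominates every row sum of \<open>toeplitz n x\<close>, the 2 being the largest
  multiplicity of a lag. Under \<open>gauss n\<close> with \<open>n > 0\<close> it is one centred
  gaussian of variance 4.\<close>

definition row_sum :: "nat \<Rightarrow> (nat \<Rightarrow> real) \<Rightarrow> real" where
  "row_sum n x = (\<Sum>s<n. (2 / sqrt (real n)) * x s)"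

lemma pospoly_row_sum: "pospoly n (row_sum n)"
  unfolding row_sum_def[abs_def] by (intro pospoly_sum pospoly_cmult pospoly_var) auto

text \<open>Coefficientwise domination is expressed by saying that the difference is a
  \<open>pospoly\<close>. In the step the difference telescopes: either the first \<open>k\<close>
  factors or the last one are compared, and both parts have nonnegative coefficients.\<close>

lemma pospoly_pow_dominated:
  assumes a: "a < n"
  shows "pospoly n (\<lambda>x. row_sum n x ^ k - (\<Sum>b<n. (toeplitz n x ^\<^sub>m k) $$ (a, b)))"
proof (induction k)
  case 0
  have "(\<Sum>b<n. (toeplitz n x ^\<^sub>m 0) $$ (a, b)) = 1" for x :: "nat \<Rightarrow> real"
    using a by (simp add: sum.If_cases)
  then show ?case by (simp add: pospoly_const del: pow_mat.simps)
next
  case (Suc k)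
  let ?T = "toeplitz n"
  have "row_sum n x ^ Suc k - (\<Sum>b<n. (?T x ^\<^sub>m Suc k) $$ (a, b)) =
     row_sum n x * (row_sum n x ^ k - (\<Sum>b<n. (?T x ^\<^sub>m k) $$ (a, b)))
     + (\<Sum>b<n. (?T x ^\<^sub>m k) $$ (a, b) * (row_sum n x - (\<Sum>e<n. ?T x $$ (b, e))))" for x
  proof -
    have "(\<Sum>b<n. (?T x ^\<^sub>m Suc k) $$ (a, b)) = (\<Sum>b<n. \<Sum>e<n. (?T x ^\<^sub>m k) $$ (a, b) * ?T x $$ (b, e))"
      using a by (subst sum.swap) (simp add: toeplitz_pow_Suc_index del: pow_mat.simps)
    also have "\<dots> = (\<Sum>b<n. (?T x ^\<^sub>m k) $$ (a, b) * (\<Sum>e<n. ?T x $$ (b, e)))"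
      by (simp add: sum_distrib_left)
    finally show ?thesis
      by (simp add: right_diff_distrib sum_subtractf sum_distrib_left mult.commute del: pow_mat.simps)
  qed
  moreover have "pospoly n (\<lambda>x. row_sum n x * (row_sum n x ^ k - (\<Sum>b<n. (?T x ^\<^sub>m k) $$ (a, b)))
     + (\<Sum>b<n. (?T x ^\<^sub>m k) $$ (a, b) * (row_sum n x - (\<Sum>e<n. ?T x $$ (b, e)))))"
    using pospoly_row_dominated unfolding row_sum_def[symmetric]
    by (intro pospoly_add pospoly_mult pospoly_row_sum Suc pospoly_sum pospoly_toeplitz_pow a) auto
  ultimately show ?case by simp
qed

text \<open>The moment recursion of a gaussian of variance 4, from integration by parts:
  \<open>n\<close> coordinates contribute \<open>(2 / sqrt n)\<^sup>2\<close> each.\<close>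

lemma gE_row_sum_power_Suc:
  assumes "n > 0"
  shows "gE n (\<lambda>x. row_sum n x ^ Suc (Suc k)) = 4 * real (Suc k) * gE n (\<lambda>x. row_sum n x ^ k)"
proof -
  have pdr: "pd s (row_sum n) = (\<lambda>_. 2 / sqrt (real n))" if "s < n" for s
  proof -
    have "pd s (row_sum n) = (\<lambda>x. \<Sum>t<n. pd s (\<lambda>x. (2 / sqrt (real n)) * x t) x)"
      unfolding row_sum_def[abs_def] by (intro pd_sum[of _ n] pospoly_cmult pospoly_var) auto
    also have "\<dots> = (\<lambda>x. \<Sum>t<n. (2 / sqrt (real n)) * of_bool (s = t))"
    proof (intro ext sum.cong refl)
      fix x t assume "t \<in> {..<n}"
      then have "t < n" by simp
      show "pd s (\<lambda>x. (2 / sqrt (real n)) * x t) x = (2 / sqrt (real n)) * of_bool (s = t)"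
        unfolding pd_cmult[OF pospoly_var[OF \<open>t < n\<close>]] pd_var of_bool_def ..
    qed
    also have "\<dots> = (\<lambda>_. 2 / sqrt (real n))"
      unfolding of_bool_def mult_delta_right using that by simp
    finally show ?thesis .
  qed
  define q where "q = 2 / sqrt (real n)"
  have pdk: "pd s (\<lambda>x. row_sum n x ^ Suc k) = (\<lambda>x. real (Suc k) * q * row_sum n x ^ k)" if "s < n" for s
  proof (induction k)
    case 0
    then show ?case using pdr[OF that] by (simp add: q_def)
  next
    case (Suc k)
    have "pd s (\<lambda>x. row_sum n x * row_sum n x ^ Suc k) =
       (\<lambda>x. pd s (row_sum n) x * row_sum n x ^ Suc k + row_sum n x * pd s (\<lambda>x. row_sum n x ^ Suc k) x)"
      by (intro pd_mult[of n] pospoly_row_sum pospoly_power)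
    then show ?case unfolding Suc pdr[OF that] q_def[symmetric] by (simp add: algebra_simps)
  qed
  have "gE n (\<lambda>x. row_sum n x ^ Suc (Suc k)) = gE n (\<lambda>x. \<Sum>s<n. (2 / sqrt (real n)) * (x s * row_sum n x ^ Suc k))"
    by (subst power_Suc, subst row_sum_def) (simp add: sum_distrib_right mult.assoc)
  also have "\<dots> = (\<Sum>s<n. gE n (\<lambda>x. (2 / sqrt (real n)) * (x s * row_sum n x ^ Suc k)))"
    by (intro gE_sum pospoly_cmult pospoly_mult pospoly_var pospoly_power pospoly_row_sum) auto
  also have "\<dots> = (\<Sum>s<n. (2 / sqrt (real n)) * gE n (pd s (\<lambda>x. row_sum n x ^ Suc k)))"
    by (intro sum.cong refl)
       (subst integral_mult_right_zero, subst gauss_ibp_pospoly, auto intro!: pospoly_mult pospoly_power pospoly_row_sum)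
  also have "\<dots> = (\<Sum>s<n. (2 / sqrt (real n)) * (real (Suc k) * q * gE n (\<lambda>x. row_sum n x ^ k)))"
    by (intro sum.cong refl) (simp only: pdk lessThan_iff integral_mult_right_zero)
  also have "\<dots> = 4 * real (Suc k) * gE n (\<lambda>x. row_sum n x ^ k)"
    using assms by (simp add: q_def field_simps)
  finally show ?thesis .
qed

text \<open>Keeping \<open>M\<close> fixed gives a uniform factor in the recursion:
  \<open>4 * (2 * m + 1) \<le> 8 * M\<close> as long as \<open>m + 1 \<le> M\<close>.\<close>

lemma gE_row_sum_even_power_le:
  assumes "n > 0" "m \<le> M"
  shows "gE n (\<lambda>x. row_sum n x ^ (2 * m)) \<le> (8 * real M) ^ m"
  using assms(2)
proof (induction m)
  case 0
  then show ?case by (simp add: prob_gauss)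
next
  case (Suc m)
  have "real (Suc m) \<le> real M" using Suc.prems by (simp only: of_nat_le_iff)
  then have le: "4 * real (Suc (2 * m)) \<le> 8 * real M" by simp
  have "gE n (\<lambda>x. row_sum n x ^ (2 * Suc m)) = 4 * real (Suc (2 * m)) * gE n (\<lambda>x. row_sum n x ^ (2 * m))"
    using gE_row_sum_power_Suc[OF assms(1), of "2 * m"] by simp
  also have "\<dots> \<le> (8 * real M) * (8 * real M) ^ m"
    using Suc.prems by (intro mult_mono le Suc.IH pospoly_expectation_nonneg pospoly_power pospoly_row_sum) simp_all
  finally show ?case by simp
qed

text \<open>A diagonal entry is dominated by its row sum, since the other entries of the row have
  nonnegative coefficients as well.\<close>

lemma gE_mat_trace_even_power_le:
  assumes "n > 0"
  shows "gE n (\<lambda>x. mat_trace (toeplitz n x ^\<^sub>m (2 * m))) \<le> real n * (8 * real m) ^ m"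
proof -
  let ?T = "toeplitz n"
  have le: "gE n (\<lambda>x. (?T x ^\<^sub>m (2 * m)) $$ (a, a)) \<le> gE n (\<lambda>x. row_sum n x ^ (2 * m))" if a: "a < n" for a
  proof -
    let ?r = "\<lambda>x. row_sum n x ^ (2 * m) - (\<Sum>b<n. (?T x ^\<^sub>m (2 * m)) $$ (a, b))"
    let ?o = "\<lambda>x. \<Sum>b\<in>{..<n}-{a}. (?T x ^\<^sub>m (2 * m)) $$ (a, b)"
    have "(\<lambda>x. row_sum n x ^ (2 * m)) = (\<lambda>x. (?T x ^\<^sub>m (2 * m)) $$ (a, a) + (?r x + ?o x))"
      using a by (simp add: sum.remove[of "{..<n}" a])
    moreover have p: "pospoly n (\<lambda>x. ?r x + ?o x)"
      by (intro pospoly_add pospoly_pow_dominated a pospoly_sum pospoly_toeplitz_pow) auto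
    ultimately have "gE n (\<lambda>x. row_sum n x ^ (2 * m)) =
        gE n (\<lambda>x. (?T x ^\<^sub>m (2 * m)) $$ (a, a)) + gE n (\<lambda>x. ?r x + ?o x)"
      using gE_add[OF pospoly_toeplitz_pow[OF a a] p] by simp
    then show ?thesis using pospoly_expectation_nonneg[OF p] by simp
  qed
  have "gE n (\<lambda>x. mat_trace (?T x ^\<^sub>m (2 * m))) = (\<Sum>a<n. gE n (\<lambda>x. (?T x ^\<^sub>m (2 * m)) $$ (a, a)))"
    unfolding mat_trace_carrier[OF pow_carrier_mat[OF toeplitz_carrier]]
    by (intro gE_sum pospoly_toeplitz_pow) auto
  also have "\<dots> \<le> (\<Sum>a<n. (8 * real m) ^ m)"
    using le gE_row_sum_even_power_le[OF assms order_refl, of m] by (intro sum_mono) force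
  finally show ?thesis by simp
qed

section \<open>Quantitative central limit theorem\<close>

lemma gE_square_var: "s < n \<Longrightarrow> gE n (\<lambda>x. x s * x s) = 1"
  using gauss_ibp_pospoly[of s n "\<lambda>x. x s"] by (simp add: pospoly_var pd_var prob_gauss)

lemma gE_toeplitz_square_index:
  assumes "a < n"
  shows "gE n (\<lambda>x. (toeplitz n x ^\<^sub>m 2) $$ (a, a)) = 1"
proof -
  let ?s = "\<lambda>b. nat \<bar>int a - int b\<bar>"
  have "gE n (\<lambda>x. (toeplitz n x ^\<^sub>m 2) $$ (a, a)) = gE n (\<lambda>x. \<Sum>b<n. (1 / real n) * (x (?s b) * x (?s b)))"
  proof (intro arg_cong[of _ _ "gE n"] ext)
    fix x :: "nat \<Rightarrow> real"
    have "(toeplitz n x ^\<^sub>m 2) $$ (a, a) = (toeplitz n x * toeplitz n x) $$ (a, a)"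
      by (simp add: numeral_2_eq_2 left_mult_one_mat[of _ n n] del: index_mult_mat(1))
    also have "\<dots> = (\<Sum>b<n. toeplitz n x $$ (a, b) * toeplitz n x $$ (b, a))"
      using assms by (intro mult_mat_index_sum) auto
    also have "\<dots> = (\<Sum>b<n. (1 / real n) * (x (?s b) * x (?s b)))"
      using assms by (intro sum.cong refl) (simp add: toeplitz_index abs_minus_commute[of _ "int a"])
    finally show "(toeplitz n x ^\<^sub>m 2) $$ (a, a) = (\<Sum>b<n. (1 / real n) * (x (?s b) * x (?s b)))" .
  qed
  also have "\<dots> = (\<Sum>b<n. gE n (\<lambda>x. (1 / real n) * (x (?s b) * x (?s b))))"
    using assms by (intro gE_sum pospoly_cmult pospoly_mult pospoly_var) (auto intro: toeplitz_diff_less)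
  also have "\<dots> = (\<Sum>b<n. 1 / real n)"
    using assms by (intro sum.cong refl) (subst integral_mult_right_zero, subst gE_square_var, auto)
  finally show ?thesis using assms by simp
qed

text \<open>Split off \<open>T\<^sup>2\<close>, whose diagonal has mean 1. The off-diagonal products
  have nonnegative mean, and the two diagonal entries are positively correlated.\<close>

lemma gE_toeplitz_even_power_index_ge:
  assumes "a < n"
  shows "1 \<le> gE n (\<lambda>x. (toeplitz n x ^\<^sub>m (2 * m)) $$ (a, a))"
proof (induction m)
  case 0
  then show ?case using assms by (simp add: prob_gauss)
next
  case (Suc m)
  let ?u = "\<lambda>x. (toeplitz n x ^\<^sub>m (2 * m)) $$ (a, a)"
  let ?v = "\<lambda>x. (toeplitz n x ^\<^sub>m 2) $$ (a, a)"
  let ?o = "\<lambda>x. \<Sum>b\<in>{..<n}-{a}. (toeplitz n x ^\<^sub>m (2 * m)) $$ (a, b) * (toeplitz n x ^\<^sub>m 2) $$ (b, a)"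
  have eq: "(toeplitz n x ^\<^sub>m (2 * Suc m)) $$ (a, a) = ?u x * ?v x + ?o x" for x
  proof -
    have "toeplitz n x ^\<^sub>m (2 * Suc m) = toeplitz n x ^\<^sub>m (2 * m) * toeplitz n x ^\<^sub>m 2"
      using pow_mat_add[OF toeplitz_carrier, of n x "2 * m" 2] by (simp only: mult_Suc_right add.commute)
    then have "(toeplitz n x ^\<^sub>m (2 * Suc m)) $$ (a, a) =
        (\<Sum>b<n. (toeplitz n x ^\<^sub>m (2 * m)) $$ (a, b) * (toeplitz n x ^\<^sub>m 2) $$ (b, a))"
      using assms by (simp only:) (intro mult_mat_index_sum pow_carrier_mat toeplitz_carrier)
    then show ?thesis using assms by (simp only:) (intro sum.remove, auto)
  qed
  have o: "pospoly n ?o" and u: "pospoly n ?u" and v: "pospoly n ?v"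
    using assms by (intro pospoly_sum pospoly_mult pospoly_toeplitz_pow; simp)+
  have "1 * 1 \<le> gE n ?u * gE n ?v"
    using Suc gE_toeplitz_square_index[OF assms] by (intro mult_mono) auto
  also have "\<dots> \<le> gE n (\<lambda>x. ?u x * ?v x)" by (rule pospoly_cov_nonneg[OF u v])
  also have "\<dots> \<le> gE n (\<lambda>x. ?u x * ?v x) + gE n ?o"
    using pospoly_expectation_nonneg[OF o] by simp
  also have "\<dots> = gE n (\<lambda>x. (toeplitz n x ^\<^sub>m (2 * Suc m)) $$ (a, a))"
    unfolding eq by (intro gE_add[symmetric] pospoly_mult u v o)
  finally show ?case by simp
qed

lemma gE_mat_trace_mult_ge:
  assumes B: "B \<in> carrier_mat n n" "\<And>a b. a < n \<Longrightarrow> b < n \<Longrightarrow> 0 \<le> B $$ (a, b)"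
  shows "mat_trace B \<le> gE n (\<lambda>x. mat_trace (toeplitz n x ^\<^sub>m (2 * m) * B))"
proof -
  let ?P = "\<lambda>a b x. (toeplitz n x ^\<^sub>m (2 * m)) $$ (a, b)"
  have p: "pospoly n (\<lambda>x. ?P a b x * B $$ (b, a))" if "a < n" "b < n" for a b
    using that by (intro pospoly_mult pospoly_toeplitz_pow pospoly_const B)
  have "mat_trace B = (\<Sum>a<n. 1 * B $$ (a, a))" using B by (simp add: mat_trace_carrier)
  also have "\<dots> \<le> (\<Sum>a<n. gE n (?P a a) * B $$ (a, a))"
    using B by (intro sum_mono mult_right_mono gE_toeplitz_even_power_index_ge) auto
  also have "\<dots> = (\<Sum>a<n. gE n (\<lambda>x. ?P a a x * B $$ (a, a)))" by simp
  also have "\<dots> \<le> (\<Sum>a<n. \<Sum>b<n. gE n (\<lambda>x. ?P a b x * B $$ (b, a)))"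
    by (intro sum_mono member_le_sum pospoly_expectation_nonneg p) auto
  also have "\<dots> = (\<Sum>a<n. gE n (\<lambda>x. \<Sum>b<n. ?P a b x * B $$ (b, a)))"
    by (intro sum.cong refl gE_sum[symmetric] p) auto
  also have "\<dots> = gE n (\<lambda>x. \<Sum>a<n. \<Sum>b<n. ?P a b x * B $$ (b, a))"
    by (intro gE_sum[symmetric] pospoly_sum p) auto
  also have "\<dots> = gE n (\<lambda>x. mat_trace (toeplitz n x ^\<^sub>m (2 * m) * B))"
    unfolding mat_trace_mult[OF pow_carrier_mat[OF toeplitz_carrier] B(1)] ..
  finally show ?thesis .
qed

lemma mat_trace_toeplitz_unit_0:
  assumes "n > 0"
  shows "mat_trace (toeplitz_unit n 0) = sqrt (real n)"
  using assms by (simp add: mat_trace_carrier[of _ n n] toeplitz_unit_def toeplitz_index real_div_sqrt)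

lemma sum_mat_trace_toeplitz_unit_square:
  assumes "n > 0"
  shows "(\<Sum>j<n. mat_trace (toeplitz_unit n j * toeplitz_unit n j)) = real n"
proof -
  have "(\<Sum>j<n. mat_trace (toeplitz_unit n j * toeplitz_unit n j)) =
      (\<Sum>a<n. \<Sum>b<n. \<Sum>j<n. toeplitz_unit n j $$ (a, b) * toeplitz_unit n j $$ (b, a))"
    unfolding mat_trace_mult[OF toeplitz_unit_carrier toeplitz_unit_carrier]
    by (rule trans[OF sum.swap sum.cong[OF refl sum.swap]])
  also have "\<dots> = (\<Sum>a<n. \<Sum>b<n. \<Sum>j<n. (1 / real n) * of_bool (j = nat \<bar>int a - int b\<bar>))"
  proof (intro sum.cong refl)
    fix a b j assume "a \<in> {..<n}" "b \<in> {..<n}"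
    then show "toeplitz_unit n j $$ (a, b) * toeplitz_unit n j $$ (b, a) =
        (1 / real n) * of_bool (j = nat \<bar>int a - int b\<bar>)"
      by (simp add: toeplitz_unit_def toeplitz_index abs_minus_commute[of "int b"])
  qed
  also have "\<dots> = (\<Sum>a<n. \<Sum>b<n. 1 / real n)"
    unfolding of_bool_def mult_delta_right by (intro sum.cong refl) (simp add: toeplitz_diff_less)
  finally show ?thesis using assms by simp
qed

text \<open>Means of traces are bounded below when an even number of random factors remains. One
  derivative leaves \<open>d - 1\<close> of them and two leave \<open>d - 2\<close>, whence the
  split by parity. Lower degrees are discarded, their contributions being nonnegative.\<close>

lemma gVar_trace_poly_ge:
  assumes c: "\<And>k. 0 \<le> c k" and d: "d \<ge> 1" and n: "n \<ge> 1"
  shows "(c d)\<^sup>2 * real n \<le> gVar n (trace_poly n c d)"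
proof -
  let ?T = "toeplitz n" and ?E = "toeplitz_unit n" and ?F = "trace_poly n c d"
  note F = pospoly_trace_poly[of c n d, OF c]
  show ?thesis
  proof (cases "odd d")
    case True
    then have "even (d - 1)" by simp
    then obtain m where m: "d - 1 = 2 * m" by (rule evenE)
    note p = pospoly_cmult[OF c pospoly_cmult[OF of_nat_0_le_iff pospoly_mat_trace_mult_unit]]
    \<comment> \<open>Direction 0 is chosen because \<open>toeplitz_unit n 0\<close> is the identity
      divided by \<open>sqrt n\<close>, with trace \<open>sqrt n\<close>.\<close>
    have "c d * (1 * sqrt (real n)) \<le> c d * (real d * gE n (\<lambda>x. mat_trace (?T x ^\<^sub>m (2 * m) * ?E 0)))"
      using c d n gE_mat_trace_mult_ge[of "?E 0" n m] mat_trace_toeplitz_unit_0[of n]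
      by (intro mult_left_mono mult_mono) (auto simp: toeplitz_unit_nonneg)
    also have "\<dots> = gE n (\<lambda>x. c d * (real d * mat_trace (?T x ^\<^sub>m (d - 1) * ?E 0)))"
      unfolding m integral_mult_right_zero ..
    also have "\<dots> \<le> (\<Sum>k\<le>d. gE n (\<lambda>x. c k * (real k * mat_trace (?T x ^\<^sub>m (k - 1) * ?E 0))))"
      by (intro member_le_sum[of d] pospoly_expectation_nonneg p) auto
    also have "\<dots> = gE n (pd 0 ?F)"
      unfolding pd_trace_poly[of c, OF c] by (intro gE_sum[symmetric] p)
    finally have "(c d * sqrt (real n))\<^sup>2 \<le> (gE n (pd 0 ?F))\<^sup>2"
      using c by (intro power_mono) auto
    also have "\<dots> \<le> gVar n ?F" using n by (intro gVar_ge_first F) simp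
    finally show ?thesis by (simp add: power_mult_distrib)
  next
    case False
    then have d2: "d \<ge> 2" using d by (cases "d = 1") auto
    have "even (d - 2)" using False by simp
    then obtain m where m: "d - 2 = 2 * m" by (rule evenE)
    let ?t = "\<lambda>k r j x. mat_trace (?T x ^\<^sub>m r * ?E j * ?T x ^\<^sub>m (k - 2 - r) * ?E j)"
    have pt: "pospoly n (?t k r j)" for k r j
    proof -
      have mm: "pospoly n (\<lambda>x. (A x * B x) $$ (a, b))"
        if "\<And>x. A x \<in> carrier_mat n n" "\<And>x. B x \<in> carrier_mat n n"
          "\<And>a b. a < n \<Longrightarrow> b < n \<Longrightarrow> pospoly n (\<lambda>x. A x $$ (a, b))"
          "\<And>a b. a < n \<Longrightarrow> b < n \<Longrightarrow> pospoly n (\<lambda>x. B x $$ (a, b))" "a < n" "b < n"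
        for A B :: "(nat \<Rightarrow> real) \<Rightarrow> real Matrix.mat" and a b
        using that by (simp only: mult_mat_index_sum[of _ n]) (intro pospoly_sum pospoly_mult, auto)
      have E: "pospoly n (\<lambda>x. ?E j $$ (a, b))" if "a < n" "b < n" for a b
        using that by (intro pospoly_const toeplitz_unit_nonneg)
      have cc: "?T x ^\<^sub>m r * ?E j * ?T x ^\<^sub>m (k - 2 - r) * ?E j \<in> carrier_mat n n" for x
        by (intro mult_carrier_mat[of _ n n _ n] pow_carrier_mat toeplitz_carrier toeplitz_unit_carrier)
      show ?thesis unfolding mat_trace_carrier[OF cc]
        by (intro pospoly_sum mm mult_carrier_mat[of _ n n _ n] pow_carrier_mat toeplitz_carrier toeplitz_unit_carrier
            pospoly_toeplitz_pow E) auto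
    qed
    have ps: "pospoly n (\<lambda>x. \<Sum>r<k-1. ?t k r j x)" for k j by (intro pospoly_sum pt)
    note p = pospoly_cmult[OF c pospoly_cmult[OF of_nat_0_le_iff ps]]
    have ge: "c d * (real d * mat_trace (?E j * ?E j)) \<le> gE n (pd j (pd j ?F))" for j
    proof -
      have EE: "0 \<le> (?E j * ?E j) $$ (a, b)" if "a < n" "b < n" for a b
        using that by (simp only: mult_mat_index_sum[OF toeplitz_unit_carrier toeplitz_unit_carrier])
          (intro sum_nonneg mult_nonneg_nonneg toeplitz_unit_nonneg, auto)
      have "mat_trace (?E j * ?E j) \<le> gE n (\<lambda>x. mat_trace (?T x ^\<^sub>m (2 * m) * (?E j * ?E j)))"
        by (intro gE_mat_trace_mult_ge EE mult_carrier_mat[of _ n n _ n] toeplitz_unit_carrier)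
      \<comment> \<open>Of all positions only \<open>r = d - 2\<close> is kept: the second power is
        then the identity, and the two copies of \<open>?E j\<close> are adjacent.\<close>
      also have "\<dots> = gE n (?t d (d - 2) j)"
      proof (intro arg_cong[of _ _ "gE n"] ext)
        fix x
        have "?T x ^\<^sub>m (d - 2) * ?E j * ?T x ^\<^sub>m (d - 2 - (d - 2)) = ?T x ^\<^sub>m (d - 2) * ?E j"
          by (simp add: right_mult_one_mat[of _ n n] mult_carrier_mat[of _ n n _ n])
        moreover have "?T x ^\<^sub>m (2 * m) * (?E j * ?E j) = ?T x ^\<^sub>m (d - 2) * ?E j * ?E j"
          unfolding m[symmetric] by (intro assoc_mult_mat[symmetric, of _ n n _ n _ n]) auto
        ultimately show "mat_trace (?T x ^\<^sub>m (2 * m) * (?E j * ?E j)) = ?t d (d - 2) j x" by simp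
      qed
      also have "\<dots> \<le> (\<Sum>r<d-1. gE n (?t d r j))"
        using d2 by (intro member_le_sum[of "d - 2"] pospoly_expectation_nonneg pt) auto
      also have "\<dots> = gE n (\<lambda>x. \<Sum>r<d-1. ?t d r j x)" by (intro gE_sum[symmetric] pt)
      finally have "c d * (real d * mat_trace (?E j * ?E j)) \<le> c d * (real d * gE n (\<lambda>x. \<Sum>r<d-1. ?t d r j x))"
        using c by (intro mult_left_mono) auto
      also have "\<dots> = gE n (\<lambda>x. c d * (real d * (\<Sum>r<d-1. ?t d r j x)))"
        unfolding integral_mult_right_zero ..
      also have "\<dots> \<le> (\<Sum>k\<le>d. gE n (\<lambda>x. c k * (real k * (\<Sum>r<k-1. ?t k r j x))))"
        by (intro member_le_sum[of d] pospoly_expectation_nonneg p) auto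
      also have "\<dots> = gE n (pd j (pd j ?F))"
        unfolding pd_pd_trace_poly[of c, OF c] by (intro gE_sum[symmetric] p)
      finally show ?thesis .
    qed
    \<comment> \<open>The 2 from \<open>d \<ge> 2\<close> gets squared and so outweighs the 2 in
      \<open>gVar_ge_second\<close>.\<close>
    have "c d * (2 * real n) \<le> c d * (real d * real n)"
      using c d2 by (intro mult_left_mono mult_right_mono) auto
    also have "\<dots> = (\<Sum>j<n. c d * (real d * mat_trace (?E j * ?E j)))"
      unfolding sum_distrib_left[symmetric] using sum_mat_trace_toeplitz_unit_square n by simp
    also have "\<dots> \<le> (\<Sum>j<n. gE n (pd j (pd j ?F)))" by (intro sum_mono ge)
    finally have "(c d * (2 * real n))\<^sup>2 \<le> (\<Sum>j<n. gE n (pd j (pd j ?F)))\<^sup>2"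
      using c by (intro power_mono) auto
    also have "\<dots> \<le> 2 * real n * gVar n ?F" by (intro gVar_ge_second F)
    finally have "(2 * real n) * (2 * ((c d)\<^sup>2 * real n)) \<le> (2 * real n) * gVar n ?F"
      by (simp add: power_mult_distrib power2_eq_square mult_ac)
    then have "2 * ((c d)\<^sup>2 * real n) \<le> gVar n ?F" using n by (simp add: mult_ac)
    moreover have "0 \<le> (c d)\<^sup>2 * real n" by simp
    ultimately show ?thesis by linarith
  qed
qed

section \<open>Expected size of the Hessian term and the rate\<close>

lemma one_plus_power_le:
  fixes l N :: real
  assumes "0 \<le> l" "0 < N" "e \<le> m"
  shows "(1 + l) ^ e \<le> 2 ^ m * (1 + N / 2 + l ^ (2 * m) / (2 * N))"
proof -
  have "(1 + l) ^ e \<le> (1 + l) ^ m" using assms by (intro power_increasing) auto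
  also have "\<dots> \<le> (2 * max 1 l) ^ m" using assms by (intro power_mono) auto
  also have "\<dots> = 2 ^ m * max 1 l ^ m" by (rule power_mult_distrib)
  also have "max 1 l ^ m \<le> 1 + l ^ m" using assms by (auto simp: max_def)
  \<comment> \<open>Weighted arithmetic-geometric mean inequality. Later \<open>l ^ (2 * m)\<close>
    is a trace whose mean has order n and \<open>N\<close> is \<open>sqrt n\<close>, so both terms
    have order \<open>sqrt n\<close>. Bounding by the trace itself would cost a full factor n and
    leave no decay in the final estimate.\<close>
  also have "l ^ m \<le> N / 2 + l ^ (2 * m) / (2 * N)"
  proof -
    have p: "l ^ (2 * m) = l ^ m * l ^ m" by (simp add: mult_2 power_add)
    have "0 \<le> (l ^ m - N) * (l ^ m - N)" by simp
    then have "2 * N * l ^ m \<le> N * N + l ^ (2 * m)"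
      unfolding p by (simp add: algebra_simps)
    then show ?thesis using assms by (simp add: field_simps)
  qed
  finally show ?thesis by (simp add: add.assoc)
qed

lemma gE_hess_grad_trace_poly_le:
  assumes c: "\<And>k. 0 \<le> c k" and d: "d \<ge> 1" and n: "n \<ge> 1"
  shows "(\<Sum>j<n. gE n (\<lambda>x. (hess_grad n (trace_poly n c d) j x)\<^sup>2))
    \<le> 16 * (real n * sqrt (real n)) * (\<Sum>k\<le>d. c k) ^ 4 * ((64 * real d) ^ (11 * d))\<^sup>2"
proof -
  let ?F = "trace_poly n c d"
  define S where "S = (\<Sum>k\<le>d. c k)"
  define N where "N = sqrt (real n)"
  have N: "N \<ge> 1" "N * N = real n" using n by (simp_all add: N_def)
  \<comment> \<open>The trace of the power \<open>2 * m\<close> brings in \<open>8 * m\<close>,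
    which is at most \<open>64 * d\<close>.\<close>
  define b where "b = 64 * real d"
  have b: "b \<ge> 64" using d by (simp add: b_def)
  \<comment> \<open>A power of two \<open>m\<close> between \<open>4 * d\<close> and
    \<open>8 * d\<close>: large enough for the exponent in
    \<open>hess_grad_trace_poly_crude_le\<close>, and still comparable to the degree.\<close>
  obtain k where k: "2 ^ k \<le> 8 * d" "8 * d < 2 ^ (k + 1)" using ex_power_ivl1[of 2 "8 * d"] d by auto
  define m :: nat where "m = 2 ^ k"
  have m: "4 * d \<le> m" "m \<le> 8 * d" "2 ^ Suc k = 2 * m" using k by (simp_all add: m_def)
  define t where "t x = mat_trace (toeplitz n x ^\<^sub>m (2 * m))" for x
  define C where "C = 8 * real n * S ^ 4 * real d ^ 6 * 2 ^ m"
  have S0: "0 \<le> S" unfolding S_def by (intro sum_nonneg c)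
  have C0: "0 \<le> C" using S0 by (simp add: C_def)
  have pt: "pospoly n t" unfolding t_def by (rule pospoly_mat_trace_toeplitz_pow)
  have pw: "(\<Sum>j<n. (hess_grad n ?F j x)\<^sup>2) \<le> C * (1 + N / 2 + (1 / (2 * N)) * t x)" for x
  proof -
    define l where "l = root (2 ^ Suc k) (t x)"
    have op: "op_bound n l (toeplitz n x)"
      using toeplitz_op_bound[of n k x] by (simp only: l_def t_def m(3))
    have l0: "0 \<le> l" using op by (simp add: op_bound_def)
    have t0: "0 \<le> t x"
      unfolding t_def m(3)[symmetric] by (intro mat_trace_even_power_nonneg[of _ n] toeplitz_sym) auto
    have lq: "l ^ (2 * m) = t x" unfolding l_def m(3)[symmetric] using t0 by simp
    have "(\<Sum>j<n. (hess_grad n ?F j x)\<^sup>2) \<le> 8 * real n * S ^ 4 * real d ^ 6 * (1 + l) ^ (4 * d)"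
      unfolding S_def by (rule hess_grad_trace_poly_crude_le[OF c op])
    also have "\<dots> \<le> 8 * real n * S ^ 4 * real d ^ 6 * (2 ^ m * (1 + N / 2 + l ^ (2 * m) / (2 * N)))"
      using S0 N l0 m by (intro mult_left_mono one_plus_power_le) auto
    finally show ?thesis unfolding lq by (simp add: C_def mult_ac)
  qed
  have pz: "pospoly n (\<lambda>x. (hess_grad n ?F j x)\<^sup>2)" for j
    by (intro pospoly_power pospoly_hess_grad pospoly_trace_poly c)
  have i: "integrable (gauss n) t" by (rule pospoly_integrable[OF pt])
  have "(\<Sum>j<n. gE n (\<lambda>x. (hess_grad n ?F j x)\<^sup>2)) = gE n (\<lambda>x. \<Sum>j<n. (hess_grad n ?F j x)\<^sup>2)"
    by (intro gE_sum[symmetric] pz)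
  also have "\<dots> \<le> gE n (\<lambda>x. C * (1 + N / 2 + (1 / (2 * N)) * t x))"
    using C0 N by (intro gE_mono pospoly_sum pz pospoly_cmult pospoly_add pospoly_const pt pw) auto
  also have "\<dots> = C * (1 + N / 2 + (1 / (2 * N)) * gE n t)"
  proof -
    have "pospoly n (\<lambda>x. (1 / (2 * N)) * t x)" using N by (intro pospoly_cmult pt) simp
    moreover have "pospoly n (\<lambda>_. 1 + N / 2)" using N by (intro pospoly_const) simp
    ultimately show ?thesis by (simp only: integral_mult_right_zero gE_add gE_const)
  qed
  also have "\<dots> \<le> C * (2 * N * b ^ (8 * d))"
  proof (intro mult_left_mono C0)
    have "gE n t \<le> real n * (8 * real m) ^ m"
      unfolding t_def using n by (intro gE_mat_trace_even_power_le) simp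
    also have "(8 * real m) ^ m \<le> b ^ m"
      using m(2) by (intro power_mono) (auto simp: b_def)
    also have "b ^ m \<le> b ^ (8 * d)" using m b by (intro power_increasing) auto
    finally have "gE n t \<le> real n * b ^ (8 * d)" by (simp add: mult_left_mono)
    then have "(1 / (2 * N)) * gE n t \<le> (1 / (2 * N)) * (N * N * b ^ (8 * d))"
      using N by (intro mult_left_mono) auto
    also have "\<dots> = N / 2 * b ^ (8 * d)" using N(1) by simp
    finally have t: "(1 / (2 * N)) * gE n t \<le> N / 2 * b ^ (8 * d)" .
    have b1: "1 \<le> b ^ (8 * d)" using b by simp
    have "1 * 1 \<le> N * b ^ (8 * d)" using N b1 by (intro mult_mono) auto
    moreover have "N / 2 * 1 \<le> N / 2 * b ^ (8 * d)" using N b1 by (intro mult_left_mono) auto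
    ultimately show "1 + N / 2 + (1 / (2 * N)) * gE n t \<le> 2 * N * b ^ (8 * d)" using t by linarith
  qed
  also have "\<dots> = 16 * (real n * N) * S ^ 4 * (real d ^ 6 * 2 ^ m * b ^ (8 * d))"
    by (simp add: C_def mult_ac)
  also have "\<dots> \<le> 16 * (real n * N) * S ^ 4 * (b ^ (6 * d) * b ^ (8 * d) * b ^ (8 * d))"
  proof (intro mult_left_mono mult_right_mono mult_mono)
    have "real d ^ 6 \<le> b ^ 6" by (intro power_mono) (auto simp: b_def)
    also have "b ^ 6 \<le> b ^ (6 * d)" using b d by (intro power_increasing) auto
    finally show "real d ^ 6 \<le> b ^ (6 * d)" .
    have "(2::real) ^ m \<le> b ^ m" using b by (intro power_mono) auto
    also have "b ^ m \<le> b ^ (8 * d)" using m b by (intro power_increasing) auto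
    finally show "2 ^ m \<le> b ^ (8 * d)" .
  qed (use b N S0 in auto)
  \<comment> \<open>The exponents 6, 8 and 8 add up to 22, the origin of the 11.\<close>
  also have "b ^ (6 * d) * b ^ (8 * d) * b ^ (8 * d) = (b ^ (11 * d))\<^sup>2"
    unfolding power_add[symmetric] power_mult[symmetric] by simp
  finally show ?thesis by (simp add: S_def N_def b_def)
qed

text \<open>In terms of \<open>w = n ^ (1/4)\<close>, the root of the Hessian term is of order
  \<open>w ^ 3\<close> and the variance at least of order \<open>w ^ 4\<close>. The coefficients
  enter only through a ratio, as they must for a standardised quantity.\<close>

lemma tv_dist_trace_poly_le:
  assumes c: "\<And>k. 0 \<le> c k" and cd: "c d > 0" and d: "d \<ge> 1" and n: "n \<ge> 1"
  defines "F \<equiv> trace_poly n c d"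
  shows "tv_dist (distr (gauss n) borel (\<lambda>x. (F x - gE n F) / sqrt (gVar n F))) std_normal_distribution
    \<le> 16 * ((\<Sum>k\<le>d. c k) / c d)\<^sup>2 * (64 * real d) ^ (11 * d) / sqrt (sqrt (real n))"
proof -
  define w where "w = sqrt (sqrt (real n))"
  define S where "S = (\<Sum>k\<le>d. c k)"
  define b where "b = (64 * real d) ^ (11 * d)"
  have w: "w > 0" "real n = w ^ 4" "sqrt (real n) = w ^ 2"
  proof -
    show "w > 0" using n by (simp add: w_def)
    show w2: "sqrt (real n) = w ^ 2" by (simp add: w_def)
    have "real n = (sqrt (real n)) ^ 2" by simp
    then show "real n = w ^ 4" unfolding w2 by (simp add: power_mult[symmetric])
  qed
  have S0: "0 \<le> S" unfolding S_def by (intro sum_nonneg c)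
  have b0: "0 \<le> b" by (simp add: b_def)
  have F: "pospoly n F" unfolding F_def by (rule pospoly_trace_poly[OF c])
  have Vge: "(c d)\<^sup>2 * w ^ 4 \<le> gVar n F"
    using gVar_trace_poly_ge[OF c d n] by (simp add: F_def w(2))
  have pos: "0 < (c d)\<^sup>2 * w ^ 4" using cd w by simp
  have V: "gVar n F > 0" using Vge pos by linarith
  have "(\<Sum>j<n. gE n (\<lambda>x. (hess_grad n F j x)\<^sup>2)) \<le> (4 * w ^ 3 * S\<^sup>2 * b)\<^sup>2"
  proof -
    have "(\<Sum>j<n. gE n (\<lambda>x. (hess_grad n F j x)\<^sup>2)) \<le> 16 * (real n * sqrt (real n)) * S ^ 4 * b\<^sup>2"
      using gE_hess_grad_trace_poly_le[of c, OF c d n] unfolding F_def S_def b_def .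
    also have "real n * sqrt (real n) = w ^ 4 * w ^ 2" unfolding w(3) by (simp only: w(2))
    also have "16 * (w ^ 4 * w ^ 2) * S ^ 4 * b\<^sup>2 = (4 * w ^ 3 * S\<^sup>2 * b)\<^sup>2" by (simp add: power_mult_distrib power_mult[symmetric] power_add[symmetric])
    finally show ?thesis .
  qed
  then have h: "sqrt (\<Sum>j<n. gE n (\<lambda>x. (hess_grad n F j x)\<^sup>2)) \<le> 4 * w ^ 3 * S\<^sup>2 * b"
    using w S0 b0 by (intro real_le_lsqrt) auto
  have "4 * sqrt (\<Sum>j<n. gE n (\<lambda>x. (hess_grad n F j x)\<^sup>2)) / gVar n F \<le> 4 * (4 * w ^ 3 * S\<^sup>2 * b) / ((c d)\<^sup>2 * w ^ 4)"
    using w(1) S0 b0 by (intro frac_le mult_left_mono h Vge pos) auto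
  also have "\<dots> = 16 * (S / c d)\<^sup>2 * b / w"
    using w cd by (simp add: power_divide field_simps eval_nat_numeral)
  finally show ?thesis
    using second_order_poincare_pospoly[OF F V] unfolding S_def b_def w_def by linarith
qed

section \<open>Asymptotics\<close>

lemma toeplitz_cong: "(\<And>k. k < n \<Longrightarrow> x k = y k) \<Longrightarrow> toeplitz n x = toeplitz n y"
  by (intro eq_matI) (auto simp: toeplitz_index toeplitz_diff_less)

lemma std_gaussian_family_distr:
  assumes "std_gaussian_family M n X" "n \<ge> 1"
  shows "(\<lambda>\<omega>. \<lambda>i\<in>{..<n}. X i \<omega>) \<in> measurable M (gauss n)"
    and "distr M (gauss n) (\<lambda>\<omega>. \<lambda>i\<in>{..<n}. X i \<omega>) = gauss n"
proof -
  interpret prob_space M using assms(1) by (simp add: std_gaussian_family_def)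
  have dist: "distributed M lborel (X i) std_normal_density" if "i < n" for i
    using assms(1) that by (simp add: std_gaussian_family_def)
  have rv: "X i \<in> borel_measurable M" if "i < n" for i
    using distributed_measurable[OF dist[OF that]] by simp
  have sg: "sets (Pi\<^sub>M {..<n} (\<lambda>_. borel :: real measure)) = sets (gauss n)"
    unfolding gauss_def by (intro sets_PiM_cong) auto
  have "(\<lambda>\<omega>. \<lambda>i\<in>{..<n}. X i \<omega>) \<in> measurable M (Pi\<^sub>M {..<n} (\<lambda>_. borel))"
    using rv by (intro measurable_restrict) auto
  then show "(\<lambda>\<omega>. \<lambda>i\<in>{..<n}. X i \<omega>) \<in> measurable M (gauss n)"
    using sg by (simp cong: measurable_cong_sets)
  have "distr M (gauss n) (\<lambda>\<omega>. \<lambda>i\<in>{..<n}. X i \<omega>) = distr M (Pi\<^sub>M {..<n} (\<lambda>_. borel)) (\<lambda>\<omega>. \<lambda>i\<in>{..<n}. X i \<omega>)"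
    using sg by (intro distr_cong) auto
  also have "\<dots> = Pi\<^sub>M {..<n} (\<lambda>i. distr M borel (X i))"
  proof -
    \<comment> \<open>The characterisation of independence by a product law is applied to a nonempty
      index set; this is where \<open>n \<ge> 1\<close> enters.\<close>
    have "{..<n} \<noteq> {}" using assms(2) by (auto simp: lessThan_empty_iff)
    moreover have "indep_vars (\<lambda>_. borel) X {..<n}" using assms(1) by (simp add: std_gaussian_family_def)
    ultimately show ?thesis
      using indep_vars_iff_distr_eq_PiM'[where I = "{..<n}" and M' = "\<lambda>_. borel" and X = X] rv by auto
  qed
  also have "\<dots> = gauss n"
    unfolding gauss_def
  proof (intro PiM_cong refl)
    fix i assume "i \<in> {..<n}"
    then have "distr M lborel (X i) = std_normal_distribution"
      using distributed_distr_eq_density[OF dist, of i] by simp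
    moreover have "distr M borel (X i) = distr M lborel (X i)" by (intro distr_cong) auto
    ultimately show "distr M borel (X i) = std_normal_distribution" by simp
  qed
  finally show "distr M (gauss n) (\<lambda>\<omega>. \<lambda>i\<in>{..<n}. X i \<omega>) = gauss n" .
qed

text \<open>Transfers the statements from an arbitrary probability space to \<open>gauss n\<close>.
  The family is restricted to \<open>{..<n}\<close> because the product measure lives on extensional
  functions; the trace sees only those coordinates.\<close>

lemma trace_poly_family:
  fixes W :: "'w \<Rightarrow> real"
  assumes fam: "std_gaussian_family M n X" and n: "n \<ge> 1" and c: "\<And>k. 0 \<le> c k"
    and W: "\<And>\<omega>. W \<omega> = trace_poly n c d (\<lambda>k. X k \<omega>)"
  shows "prob_space.variance M W = gVar n (trace_poly n c d)"
    and "distr M borel (standardized M W) = distr (gauss n) borel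
      (\<lambda>x. (trace_poly n c d x - gE n (trace_poly n c d)) / sqrt (gVar n (trace_poly n c d)))"
proof -
  let ?F = "trace_poly n c d"
  define Y where "Y \<omega> = (\<lambda>i\<in>{..<n}. X i \<omega>)" for \<omega>
  have Y [measurable]: "Y \<in> measurable M (gauss n)" and dY: "distr M (gauss n) Y = gauss n"
    using std_gaussian_family_distr[OF fam n] by (simp_all add: Y_def[abs_def])
  have WY: "W = (\<lambda>\<omega>. ?F (Y \<omega>))"
  proof
    fix \<omega>
    have "toeplitz n (\<lambda>k. X k \<omega>) = toeplitz n (Y \<omega>)" by (intro toeplitz_cong) (simp add: Y_def)
    then show "W \<omega> = ?F (Y \<omega>)" by (simp add: W trace_poly_def)
  qed
  have Fm [measurable]: "?F \<in> borel_measurable (gauss n)"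
    by (intro borel_measurable_integrable pospoly_integrable pospoly_trace_poly c)
  have int: "(LINT \<omega>|M. f (Y \<omega>)) = gE n f" if "f \<in> borel_measurable (gauss n)" for f :: "(nat \<Rightarrow> real) \<Rightarrow> real"
    using integral_distr[OF Y that] by (simp add: dY)
  have E: "(LINT \<omega>|M. W \<omega>) = gE n ?F" unfolding WY by (rule int) measurable
  have V: "(LINT \<omega>|M. (W \<omega> - (LINT \<omega>|M. W \<omega>))\<^sup>2) = gVar n ?F"
    unfolding E gVar_def unfolding WY by (rule int) measurable
  show "prob_space.variance M W = gVar n ?F" by (rule V)
  have "standardized M W = (\<lambda>x. (?F x - gE n ?F) / sqrt (gVar n ?F)) \<circ> Y"
    unfolding standardized_def[abs_def] V unfolding E unfolding WY by (simp add: o_def)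
  then have "distr M borel (standardized M W) = distr M borel ((\<lambda>x. (?F x - gE n ?F) / sqrt (gVar n ?F)) \<circ> Y)"
    by simp
  also have "\<dots> = distr (distr M (gauss n) Y) borel (\<lambda>x. (?F x - gE n ?F) / sqrt (gVar n ?F))"
    by (intro distr_distr[symmetric] Y) measurable
  finally show "distr M borel (standardized M W) = distr (gauss n) borel (\<lambda>x. (?F x - gE n ?F) / sqrt (gVar n ?F))"
    by (simp add: dY)
qed

text \<open>With \<open>L = ln n\<close>, the logarithm of the numerator is of order
  \<open>p * ln p\<close>, and \<open>p = o(L / ln L)\<close> makes this \<open>o(L)\<close>,
  whereas the denominator is \<open>exp (L / 4)\<close>.\<close>

lemma power_tendsto_zero_of_little_o:
  fixes p :: "nat \<Rightarrow> nat"
  assumes p: "\<And>n. n \<ge> 1 \<Longrightarrow> p n \<ge> 1" and o: "(\<lambda>n. real (p n)) \<in> o(\<lambda>n. ln (real n) / ln (ln (real n)))"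
  shows "(\<lambda>n. (64 * real (p n)) ^ (11 * p n) / sqrt (sqrt (real n))) \<longlonglongrightarrow> 0"
proof (rule tendsto_sandwich[of "\<lambda>_. 0" _ _ "\<lambda>n. exp (- (ln (real n) / 8))"])
  have "filterlim (\<lambda>n. ln (ln (real n))) at_top sequentially" by real_asymp
  then have ev1: "\<forall>\<^sub>F n in sequentially. 1 \<le> ln (ln (real n))"
    by (simp add: filterlim_at_top)
  \<comment> \<open>The margin is chosen so that \<open>11 / 88 = 1 / 8\<close>, half of the
    exponent \<open>1 / 4\<close> available in the denominator.\<close>
  have ev2: "\<forall>\<^sub>F n in sequentially. norm (real (p n)) \<le> 1 / 88 * norm (ln (real n) / ln (ln (real n)))"
    by (rule landau_o.smallD[OF o]) simp
  show "\<forall>\<^sub>F n in sequentially. (64 * real (p n)) ^ (11 * p n) / sqrt (sqrt (real n)) \<le> exp (- (ln (real n) / 8))"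
    using ev1 ev2 eventually_ge_at_top[of 2]
  proof eventually_elim
    case (elim n)
    define L where "L = ln (real n)"
    define q where "q = real (p n)"
    have n0: "real n > 0" using elim by simp
    have L0: "L > 0" unfolding L_def using elim by simp
    have L1: "1 \<le> ln L" using elim(1) by (simp add: L_def)
    have L2: "1 < L" using L0 L1 ln_gt_zero_iff[of L] by linarith
    have q1: "1 \<le> q" using p[of n] elim by (simp add: q_def)
    have qL: "q \<le> 1 / 88 * (L / ln L)"
      using elim(2) L0 L1 by (simp add: q_def L_def)
    also have "\<dots> \<le> 1 / 88 * (L / 1)" using L1 L2 by (intro mult_left_mono divide_left_mono) auto
    finally have "64 * q \<le> L" using L0 by simp
    then have lq: "ln (64 * q) \<le> ln L" using q1 by simp
    have lq0: "0 \<le> ln (64 * q)" using q1 by simp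
    have "11 * q * ln (64 * q) \<le> 11 * q * ln L"
      using lq q1 by (intro mult_left_mono) auto
    also have "\<dots> \<le> 11 * (1 / 88 * (L / ln L)) * ln L"
      using qL L1 by (intro mult_right_mono mult_left_mono) auto
    also have "\<dots> = L / 8" using L1 by simp
    finally have bound: "11 * q * ln (64 * q) \<le> L / 8" .
    have "(64 * q) ^ (11 * p n) = exp (ln (64 * q) * real (11 * p n))"
      using q1 exp_of_nat2_mult[of "ln (64 * q)" "11 * p n"] by simp
    also have "\<dots> = exp (11 * q * ln (64 * q))" by (simp add: q_def mult_ac)
    also have "\<dots> \<le> exp (L / 8)" using bound by simp
    finally have num: "(64 * q) ^ (11 * p n) \<le> exp (L / 8)" .
    have den: "sqrt (sqrt (real n)) = exp (L / 4)"
    proof -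
      have "real n = (exp (L / 4)) ^ 4"
        unfolding exp_of_nat_mult[symmetric] using n0 by (simp add: L_def)
      also have "\<dots> = ((exp (L / 4))\<^sup>2)\<^sup>2" by (simp add: power_mult[symmetric])
      finally have r: "real n = ((exp (L / 4))\<^sup>2)\<^sup>2" .
      show ?thesis by (simp only: r real_sqrt_abs abs_power2 abs_exp_cancel)
    qed
    have "(64 * q) ^ (11 * p n) / sqrt (sqrt (real n)) \<le> exp (L / 8) / exp (L / 4)"
      unfolding den using num by (intro divide_right_mono) auto
    also have "\<dots> = exp (- (L / 8))" by (simp add: exp_diff[symmetric])
    finally show ?case by (simp add: q_def L_def)
  qed
  show "(\<lambda>n. exp (- (ln (real n) / 8))) \<longlonglongrightarrow> 0" by real_asymp
qed (auto intro!: always_eventually)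

lemma tv_clt_of_bound:
  fixes W :: "nat \<Rightarrow> 'w \<Rightarrow> real"
  assumes fam: "\<And>n. n \<ge> 1 \<Longrightarrow> std_gaussian_family (M n) n (X n)"
    and c: "\<And>n k. 0 \<le> c n k" and cd: "\<And>n. n \<ge> 1 \<Longrightarrow> c n (d n) > 0" and d: "\<And>n. n \<ge> 1 \<Longrightarrow> d n \<ge> 1"
    and W: "\<And>n \<omega>. W n \<omega> = trace_poly n (c n) (d n) (\<lambda>k. X n k \<omega>)"
    and lim: "(\<lambda>n. 16 * ((\<Sum>k\<le>d n. c n k) / c n (d n))\<^sup>2 * (64 * real (d n)) ^ (11 * d n) / sqrt (sqrt (real n))) \<longlonglongrightarrow> 0"
  shows "tv_clt M W"
  unfolding tv_clt_def
proof (rule tendsto_sandwich[OF _ _ tendsto_const lim])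
  let ?F = "\<lambda>n. trace_poly n (c n) (d n)"
  let ?P = "\<lambda>n. distr (gauss n) borel (\<lambda>x. (?F n x - gE n (?F n)) / sqrt (gVar n (?F n)))"
  have eq: "distr (M n) borel (standardized (M n) (W n)) = ?P n" if "n \<ge> 1" for n
    by (rule trace_poly_family(2)[OF fam[OF that] that c W])
  show "\<forall>\<^sub>F n in sequentially. tv_dist (distr (M n) borel (standardized (M n) (W n))) std_normal_distribution
     \<le> 16 * ((\<Sum>k\<le>d n. c n k) / c n (d n))\<^sup>2 * (64 * real (d n)) ^ (11 * d n) / sqrt (sqrt (real n))"
    using eventually_ge_at_top[of 1]
  proof eventually_elim
    case (elim n)
    show ?case unfolding eq[OF elim] by (rule tv_dist_trace_poly_le[of "c n" "d n" n, OF c cd[OF elim] d[OF elim] elim])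
  qed
  show "\<forall>\<^sub>F n in sequentially. 0 \<le> tv_dist (distr (M n) borel (standardized (M n) (W n))) std_normal_distribution"
    using eventually_ge_at_top[of 1]
  proof eventually_elim
    case (elim n)
    interpret g: prob_space "gauss n" by (rule prob_space_gauss)
    have [measurable]: "?F n \<in> borel_measurable (gauss n)"
      by (intro borel_measurable_integrable pospoly_integrable pospoly_trace_poly c)
    have "prob_space (?P n)" by (intro g.prob_space_distr) measurable
    then show ?case unfolding eq[OF elim] by (intro tv_dist_nonneg std_normal.prob_space_axioms)
  qed
qed

text \<open>The polynomial is taken nonconstant: for constant \<open>f\<close> the trace is
  deterministic and has no variance to normalise by.\<close>

theorem theorem4p5:
  fixes M :: "nat \<Rightarrow> 'w measure"
    and X :: "nat \<Rightarrow> nat \<Rightarrow> 'w \<Rightarrow> real"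
    and A :: "nat \<Rightarrow> 'w \<Rightarrow> real Matrix.mat"
  assumes gaussian: "\<And>n. n \<ge> 1 \<Longrightarrow> std_gaussian_family (M n) n (X n)"
  defines "A \<equiv> \<lambda>n \<omega>. toeplitz n (\<lambda>k. X n k \<omega>)"
  shows
    "(\<forall>p :: nat \<Rightarrow> nat.
        (\<forall>n\<ge>1. p n \<ge> 1) \<and>
        (\<lambda>n. real (p n)) \<in> o(\<lambda>n. ln (real n) / ln (ln (real n))) \<longrightarrow>
        tv_clt M (\<lambda>n \<omega>. mat_trace (A n \<omega> ^\<^sub>m p n)) \<and>
        (\<exists>C>0. \<forall>n\<ge>1.
           prob_space.variance (M n) (\<lambda>\<omega>. mat_trace (A n \<omega> ^\<^sub>m p n))
             \<ge> (C / real (p n)) ^ p n * real n)) \<and>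
     (\<forall>f :: real poly.
        degree f \<ge> 1 \<and> (\<forall>k. coeff f k \<ge> 0) \<longrightarrow>
        tv_clt M (\<lambda>n \<omega>. mat_trace (mat_poly f (A n \<omega>))) \<and>
        (\<exists>C>0. \<forall>n\<ge>1.
           prob_space.variance (M n) (\<lambda>\<omega>. mat_trace (mat_poly f (A n \<omega>)))
             \<ge> C * real n))"
proof (intro conjI allI impI)
  fix p :: "nat \<Rightarrow> nat"
  assume "(\<forall>n\<ge>1. p n \<ge> 1) \<and> (\<lambda>n. real (p n)) \<in> o(\<lambda>n. ln (real n) / ln (ln (real n)))"
  then have p: "\<And>n. n \<ge> 1 \<Longrightarrow> p n \<ge> 1"
    and o: "(\<lambda>n. real (p n)) \<in> o(\<lambda>n. ln (real n) / ln (ln (real n)))" by auto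
  \<comment> \<open>A single power is a polynomial whose coefficients are concentrated at
    \<open>p n\<close>, so the ratio of coefficients in the rate is 1.\<close>
  define c :: "nat \<Rightarrow> nat \<Rightarrow> real" where "c n k = of_bool (k = p n)" for n k
  have c: "0 \<le> c n k" for n k by (simp add: c_def)
  have W: "mat_trace (A n \<omega> ^\<^sub>m p n) = trace_poly n (c n) (p n) (\<lambda>k. X n k \<omega>)" for n \<omega>
    by (simp add: A_def trace_poly_def c_def)
  have S: "(\<Sum>k\<le>p n. c n k) = 1" for n by (simp add: c_def)
  have lim: "(\<lambda>n. 16 * ((\<Sum>k\<le>p n. c n k) / c n (p n))\<^sup>2 * (64 * real (p n)) ^ (11 * p n) / sqrt (sqrt (real n))) \<longlonglongrightarrow> 0"
    using tendsto_mult_right_zero[OF power_tendsto_zero_of_little_o[OF p o], of 16]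
    unfolding S by (simp add: c_def)
  show "tv_clt M (\<lambda>n \<omega>. mat_trace (A n \<omega> ^\<^sub>m p n))"
    by (rule tv_clt_of_bound[OF gaussian c _ p W lim]) (simp_all add: c_def)
  show "\<exists>C>0. \<forall>n\<ge>1. prob_space.variance (M n) (\<lambda>\<omega>. mat_trace (A n \<omega> ^\<^sub>m p n)) \<ge> (C / real (p n)) ^ p n * real n"
  \<comment> \<open>\<open>C = 1\<close> works: the variance is at least \<open>n\<close>, and
    \<open>(1 / p n) ^ p n \<le> 1\<close>.\<close>
  proof (intro exI[of _ "1 :: real"] conjI allI impI)
    fix n :: nat assume n: "1 \<le> n"
    have "(1 / real (p n)) ^ p n * real n \<le> 1 * real n"
      using p[OF n] by (intro mult_right_mono power_le_one) auto
    also have "\<dots> \<le> gVar n (trace_poly n (c n) (p n))"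
      using gVar_trace_poly_ge[of "c n" "p n", OF c p[OF n] n] by (simp add: c_def)
    also have "\<dots> = prob_space.variance (M n) (\<lambda>\<omega>. mat_trace (A n \<omega> ^\<^sub>m p n))"
      by (rule trace_poly_family(1)[OF gaussian[OF n] n c W, symmetric])
    finally show "(1 / real (p n)) ^ p n * real n \<le> prob_space.variance (M n) (\<lambda>\<omega>. mat_trace (A n \<omega> ^\<^sub>m p n))" .
  qed simp
next
  fix f :: "real poly"
  assume "degree f \<ge> 1 \<and> (\<forall>k. coeff f k \<ge> 0)"
  then have d: "degree f \<ge> 1" and c: "\<And>k. 0 \<le> coeff f k" by auto
  have "coeff f (degree f) \<noteq> 0" using d by auto
  then have cd: "coeff f (degree f) > 0" by (intro le_neq_trans[OF c]) auto
  have W: "mat_trace (mat_poly f (A n \<omega>)) = trace_poly n (coeff f) (degree f) (\<lambda>k. X n k \<omega>)" for n \<omega>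
  proof -
    have "mat_trace (mat_poly f (A n \<omega>)) = (\<Sum>i<n. \<Sum>k\<le>degree f. coeff f k * (A n \<omega> ^\<^sub>m k) $$ (i, i))"
      by (simp add: mat_trace_def mat_poly_def A_def)
    also have "\<dots> = (\<Sum>k\<le>degree f. coeff f k * mat_trace (A n \<omega> ^\<^sub>m k))"
      by (subst sum.swap) (simp add: mat_trace_def A_def sum_distrib_left)
    finally show ?thesis by (simp add: trace_poly_def A_def)
  qed
  have "(\<lambda>n. (16 * ((\<Sum>k\<le>degree f. coeff f k) / coeff f (degree f))\<^sup>2 * (64 * real (degree f)) ^ (11 * degree f))
      * (1 / sqrt (sqrt (real n)))) \<longlonglongrightarrow> 0"
    by (intro tendsto_mult_right_zero) real_asymp
  then have lim: "(\<lambda>n. 16 * ((\<Sum>k\<le>degree f. coeff f k) / coeff f (degree f))\<^sup>2 * (64 * real (degree f)) ^ (11 * degree f)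
      / sqrt (sqrt (real n))) \<longlonglongrightarrow> 0" by simp
  show "tv_clt M (\<lambda>n \<omega>. mat_trace (mat_poly f (A n \<omega>)))"
    by (rule tv_clt_of_bound[OF gaussian c cd d W lim])
  show "\<exists>C>0. \<forall>n\<ge>1. prob_space.variance (M n) (\<lambda>\<omega>. mat_trace (mat_poly f (A n \<omega>))) \<ge> C * real n"
  proof (intro exI[of _ "(coeff f (degree f))\<^sup>2"] conjI allI impI)
    show "(coeff f (degree f))\<^sup>2 > 0" using cd by (rule zero_less_power)
    fix n :: nat assume n: "1 \<le> n"
    show "(coeff f (degree f))\<^sup>2 * real n \<le> prob_space.variance (M n) (\<lambda>\<omega>. mat_trace (mat_poly f (A n \<omega>)))"
      unfolding trace_poly_family(1)[OF gaussian[OF n] n c W]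
      by (rule gVar_trace_poly_ge[OF c d n])
  qed
qed

end
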